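(* Let $(X,G)$ be one of the following pairs of a labeled affine Dynkin diagram $X$ and a finite group $G$ acting on its vertex set (the folded type $Y$ is recorded only for reference): (a) $X=\widetilde{A}_{2,2}$: vertex set $[4]$, underlying graph the $4$-cycle $1-2-4-3-1$, $G=\mathbb{Z}/2\mathbb{Z}=\langle\tau\rangle$ with $\tau=(1\,4)(2\,3)$ ($Y=\widetilde{A}_1$); (b) $X=\widetilde{A}_{n,n}$ ($n\ge 2$): vertex set $[2n]$, underlying graph the $2n$-cycle with edges $\{i,i+1\}$ for $1\le i\le n-1$, $\{n,2n\}$, $\{1,n+1\}$, $\{j,j+1\}$ for $n+1\le j\le 2n-1$; $G=\langle\tau\rangle\cong\mathbb{Z}/2\mathbb{Z}$ with $\tau(1)=1$, $\tau(2n)=2n$, $\tau(i)=n+i-1$ and $\tau(n+i-1)=i$ for $2\le i\le n$ ($Y=D_{n+1}^{(2)}$); (c) $X=\widetilde{D}_4$: vertex set $[5]$, edges $\{1,2\},\{1,3\},\{1,4\},\{1,5\}$; $G\cong(\mathbb{Z}/2\mathbb{Z})^2=\{\mathrm{id},(2\,3)(4\,5),(2\,4)(3\,5),(2\,5)(3\,4)\}$ ($Y=A_2^{(2)}$); (d) $X=\widetilde{D}_4$ as in (c), $G=\langle(3\,4\,5)\rangle\cong\mathbb{Z}/3\mathbb{Z}$ ($Y=D_4^{(3)}$); (e) $X=\widetilde{D}_n$ ($n\ge5$): vertex set $[n+1]$, edges $\{1,2\},\{1,3\},\{1,4\}$, $\{i,i+1\}$ for $4\le i\le n-2$, $\{n-1,n\},\{n-1,n+1\}$;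 $G=\langle(2\,3)(n\ \,n{+}1)\rangle\cong\mathbb{Z}/2\mathbb{Z}$ ($Y=\widetilde{C}_{n-2}$); (f) $X=\widetilde{D}_n$ ($n\ge5$) as in (e), $G=\langle(n\ \,n{+}1)\rangle\cong\mathbb{Z}/2\mathbb{Z}$ ($Y=A^{(2)}_{2(n-1)-1}$); (g) $X=\widetilde{D}_{2n}$ ($n\ge3$): vertex set $[2n+1]$, edges $\{1,2\},\{1,3\},\{1,4\}$, $\{i,i+1\}$ for $4\le i\le 2n-2$, $\{2n-1,2n\},\{2n-1,2n+1\}$; $G=\langle\sigma\rangle\cong\mathbb{Z}/2\mathbb{Z}$ where $\sigma$ is the involution with $\sigma(1)=2n-1$, $\sigma(2)=2n+1$, $\sigma(3)=2n$, $\sigma(i)=2n+2-i$ for $4\le i\le 2n-2$ ($Y=\widetilde{B}_n$); (h) $X=\widetilde{D}_{2n}$ ($n\ge3$) as in (g), $G=\langle\sigma,\rho\rangle\cong(\mathbb{Z}/2\mathbb{Z})^2$ with $\sigma$ as in (g) and $\rho=(2\,3)(2n\ \,2n{+}1)$ ($Y=A^{(2)}_{2n-2}$); (i) $X=\widetilde{E}_6$: vertex set $[7]$, edges $\{1,2\},\{1,4\},\{1,6\},\{2,3\},\{4,5\},\{6,7\}$; $G=\langle(2\,4\,6)(3\,5\,7)\rangle\cong\mathbb{Z}/3\mathbb{Z}$ ($Y=\widetilde{G}_2$); (j) $X=\widetilde{E}_6$ as in (i), $G=\langle(4\,6)(5\,7)\rangle\cong\mathbb{Z}/2\mathbb{Z}$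 ($Y=E_6^{(2)}$); (k) $X=\widetilde{E}_7$: vertex set $[8]$, edges $\{1,2\},\{1,3\},\{1,6\},\{3,4\},\{4,5\},\{6,7\},\{7,8\}$; $G=\langle(3\,6)(4\,7)(5\,8)\rangle\cong\mathbb{Z}/2\mathbb{Z}$ ($Y=\widetilde{F}_4$). Let $Q$ be a quiver of type $X$. If $Q$ is $G$-invariant, then $Q$ is $G$-admissible. In particular, for quivers of type $X$, $G$-invariance and $G$-admissibility are equivalent.
   Context: A quiver on $[N]=\{1,\dots,N\}$ is a finite directed multigraph with vertex set $[N]$ with no loops and no directed $2$-cycles. Its adjacency matrix $B=(b_{i,j})$ has $b_{i,j}=$ (number of arrows $i\to j$) $-$ (number of arrows $j\to i$). The mutation $\mu_k(Q)$ at $k\in[N]$ is the quiver with adjacency matrix $b'_{i,j}=-b_{i,j}$ if $k\in\{i,j\}$ and $b'_{i,j}=b_{i,j}+\frac{|b_{i,k}|b_{k,j}+b_{i,k}|b_{k,j}|}{2}$ otherwise. Quivers are mutation equivalent if one is obtained from the other by finitely many mutations; a quiver is acyclic if it has no directed cycle. For a labeled diagram $X$ on $[N]$ (a simple undirected graph with the given vertex labels), a quiver is of type $X$ if it is mutation equivalent to an acyclic quiver whose underlying undirected graph is $X$ (with the same labels); for $X=\widetilde{A}_{p,q}$ one additionally requires that this acyclic quiver on the cycle has exactly $p$ arrows oriented in one direction around the cycle and $q$ in the other. For a finite group $G$ acting on $[N]$: $Q$ is $G$-invariant if $b_{g(i),g(j)}=b_{i,j}$ for all $i,j\in[N]$ and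 $g\in G$; a $G$-invariant $Q$ is $G$-admissible if for all $i,i'$ in the same $G$-orbit, $b_{i,i'}=0$ and $b_{i,j}b_{i',j}\ge 0$ for all $j\in[N]$. *)

theory Defs
  imports "HOL-Library.Multiset" "HOL-Algebra.Sym_Groups"
begin

section \<open>Quivers and mutation\<close>

text \<open>A finite directed multigraph on \<open>{1..N}\<close> is given by its multiset of arrows;
  \<open>(i, j)\<close> is an arrow from \<open>i\<close> to \<open>j\<close>.\<close>

type_synonym quiver = "(nat \<times> nat) multiset"

definition quiver :: "nat \<Rightarrow> quiver \<Rightarrow> bool" where
  "quiver N Q \<longleftrightarrow>
     set_mset Q \<subseteq> {1..N} \<times> {1..N} \<and>
     (\<forall>i. (i, i) \<notin># Q) \<and>
     (\<forall>i j. (i, j) \<in># Q \<longrightarrow> (j, i) \<notin># Q)"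

definition adj :: "quiver \<Rightarrow> nat \<Rightarrow> nat \<Rightarrow> int" where
  "adj Q i j = int (count Q (i, j)) - int (count Q (j, i))"

text \<open>The integer division by 2 is exact: the numerator is \<open>0\<close> or
  \<open>\<plusminus>2 * adj Q i k * adj Q k j\<close>.\<close>

definition mutated_adj :: "nat \<Rightarrow> quiver \<Rightarrow> nat \<Rightarrow> nat \<Rightarrow> int" where
  "mutated_adj k Q i j =
     (if k \<in> {i, j} then - adj Q i j
      else adj Q i j + (\<bar>adj Q i k\<bar> * adj Q k j + adj Q i k * \<bar>adj Q k j\<bar>) div 2)"

text \<open>\<open>is_mutation N k Q Q'\<close> says \<open>Q' = \<mu>\<^sub>k(Q)\<close>; a quiver is determined by its adjacency
  matrix.\<close>

definition is_mutation :: "nat \<Rightarrow> nat \<Rightarrow> quiver \<Rightarrow> quiver \<Rightarrow> bool" where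
  "is_mutation N k Q Q' \<longleftrightarrow>
     quiver N Q \<and> quiver N Q' \<and> k \<in> {1..N} \<and>
     (\<forall>i\<in>{1..N}. \<forall>j\<in>{1..N}. adj Q' i j = mutated_adj k Q i j)"

definition mutation_equivalent :: "nat \<Rightarrow> quiver \<Rightarrow> quiver \<Rightarrow> bool" where
  "mutation_equivalent N Q Q' \<longleftrightarrow>
     (\<lambda>P P'. \<exists>k. is_mutation N k P P')\<^sup>*\<^sup>* Q Q' \<or>
     (\<lambda>P P'. \<exists>k. is_mutation N k P P')\<^sup>*\<^sup>* Q' Q"


section \<open>Type of a quiver\<close>

text \<open>Simple graphs on \<open>{1..N}\<close> are given by their set of edges. Comparing multisets of
  unoriented edges forces every edge of \<open>X\<close> to carry exactly one arrow.\<close>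

definition has_underlying_graph :: "quiver \<Rightarrow> nat set set \<Rightarrow> bool" where
  "has_underlying_graph Q X \<longleftrightarrow> image_mset (\<lambda>(i, j). {i, j}) Q = mset_set X"

definition of_type :: "nat \<Rightarrow> nat set set \<Rightarrow> quiver \<Rightarrow> bool" where
  "of_type N X Q \<longleftrightarrow>
     (\<exists>Q'. quiver N Q' \<and> acyclic (set_mset Q') \<and> has_underlying_graph Q' X \<and>
           mutation_equivalent N Q Q')"

text \<open>Number of arrows oriented along the cyclic sequence of vertices \<open>c\<close>.\<close>

definition arrows_along :: "nat list \<Rightarrow> quiver \<Rightarrow> nat" where
  "arrows_along c Q = (\<Sum>k<length c. count Q (c ! k, c ! (Suc k mod length c)))"

text \<open>Type \<open>A\<close> tilde with parameters \<open>p\<close>, \<open>q\<close>; the list \<open>c\<close> traverses the cycle \<open>X\<close> once.\<close>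

definition of_type_A :: "nat \<Rightarrow> nat set set \<Rightarrow> nat list \<Rightarrow> nat \<Rightarrow> nat \<Rightarrow> quiver \<Rightarrow> bool" where
  "of_type_A N X c p q Q \<longleftrightarrow>
     (\<exists>Q'. quiver N Q' \<and> acyclic (set_mset Q') \<and> has_underlying_graph Q' X \<and>
           {#arrows_along c Q', arrows_along (rev c) Q'#} = {#p, q#} \<and>
           mutation_equivalent N Q Q')"


section \<open>Invariance and admissibility\<close>

text \<open>A group acting on \<open>{1..N}\<close> is given by its set of permutations.\<close>

definition G_invariant :: "nat \<Rightarrow> (nat \<Rightarrow> nat) set \<Rightarrow> quiver \<Rightarrow> bool" where
  "G_invariant N G Q \<longleftrightarrow>
     (\<forall>g\<in>G. \<forall>i\<in>{1..N}. \<forall>j\<in>{1..N}. adj Q (g i) (g j) = adj Q i j)"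

definition same_orbit :: "(nat \<Rightarrow> nat) set \<Rightarrow> nat \<Rightarrow> nat \<Rightarrow> bool" where
  "same_orbit G i i' \<longleftrightarrow> (\<exists>g\<in>G. g i = i')"

definition G_admissible :: "nat \<Rightarrow> (nat \<Rightarrow> nat) set \<Rightarrow> quiver \<Rightarrow> bool" where
  "G_admissible N G Q \<longleftrightarrow>
     G_invariant N G Q \<and>
     (\<forall>i\<in>{1..N}. \<forall>i'\<in>{1..N}. same_orbit G i i' \<longrightarrow>
        adj Q i i' = 0 \<and> (\<forall>j\<in>{1..N}. adj Q i j * adj Q i' j \<ge> 0))"


section \<open>The affine diagrams with group actions\<close>

definition A_edges :: "nat \<Rightarrow> nat set set" where
  "A_edges n = {{i, i + 1} | i. 1 \<le> i \<and> i \<le> n - 1} \<union> {{n, 2*n}, {1, n + 1}} \<union>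
               {{j, j + 1} | j. n + 1 \<le> j \<and> j \<le> 2*n - 1}"

definition D4_edges :: "nat set set" where
  "D4_edges = {{1, 2}, {1, 3}, {1, 4}, {1, 5}}"

definition D_edges :: "nat \<Rightarrow> nat set set" where
  "D_edges n = {{1, 2}, {1, 3}, {1, 4}} \<union> {{i, i + 1} | i. 4 \<le> i \<and> i \<le> n - 2} \<union>
               {{n - 1, n}, {n - 1, n + 1}}"

definition E6_edges :: "nat set set" where
  "E6_edges = {{1, 2}, {1, 4}, {1, 6}, {2, 3}, {4, 5}, {6, 7}}"

definition E7_edges :: "nat set set" where
  "E7_edges = {{1, 2}, {1, 3}, {1, 6}, {3, 4}, {4, 5}, {6, 7}, {7, 8}}"

definition tau :: "nat \<Rightarrow> nat \<Rightarrow> nat" where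
  "tau n x = (if 2 \<le> x \<and> x \<le> n then n + x - 1
              else if n + 1 \<le> x \<and> x \<le> 2*n - 1 then x + 1 - n
              else x)"

definition sigma :: "nat \<Rightarrow> nat \<Rightarrow> nat" where
  "sigma n x = (if x = 1 then 2*n - 1 else if x = 2*n - 1 then 1
                else if x = 2 then 2*n + 1 else if x = 2*n + 1 then 2
                else if x = 3 then 2*n else if x = 2*n then 3
                else if 4 \<le> x \<and> x \<le> 2*n - 2 then 2*n + 2 - x
                else x)"

text \<open>\<open>folding_pair N T G\<close>: \<open>T\<close> is the predicate ``of type \<open>X\<close>'' for a diagram \<open>X\<close> on \<open>{1..N}\<close>
  and \<open>G\<close> is the group acting on its vertices. In the cases \<open>A\<close> tilde the list of vertices is
  a traversal of the cycle.\<close>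

inductive folding_pair :: "nat \<Rightarrow> (quiver \<Rightarrow> bool) \<Rightarrow> (nat \<Rightarrow> nat) set \<Rightarrow> bool" where
  a: "folding_pair 4 (of_type_A 4 {{1, 2}, {2, 4}, {4, 3}, {3, 1}} [1, 2, 4, 3] 2 2)
        (generate (sym_group 4) {transpose 1 4 \<circ> transpose 2 3})"
| b: "n \<ge> 2 \<Longrightarrow>
      folding_pair (2*n)
        (of_type_A (2*n) (A_edges n) ([1..<n + 1] @ rev [n + 1..<2*n + 1]) n n)
        (generate (sym_group (2*n)) {tau n})"
| c: "folding_pair 5 (of_type 5 D4_edges)
        {id, transpose 2 3 \<circ> transpose 4 5, transpose 2 4 \<circ> transpose 3 5,
         transpose 2 5 \<circ> transpose 3 4}"
| d: "folding_pair 5 (of_type 5 D4_edges) (generate (sym_group 5) {cycle_of_list [3, 4, 5]})"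
| e: "n \<ge> 5 \<Longrightarrow>
      folding_pair (n + 1) (of_type (n + 1) (D_edges n))
        (generate (sym_group (n + 1)) {transpose 2 3 \<circ> transpose n (n + 1)})"
| f: "n \<ge> 5 \<Longrightarrow>
      folding_pair (n + 1) (of_type (n + 1) (D_edges n))
        (generate (sym_group (n + 1)) {transpose n (n + 1)})"
| g: "n \<ge> 3 \<Longrightarrow>
      folding_pair (2*n + 1) (of_type (2*n + 1) (D_edges (2*n)))
        (generate (sym_group (2*n + 1)) {sigma n})"
| h: "n \<ge> 3 \<Longrightarrow>
      folding_pair (2*n + 1) (of_type (2*n + 1) (D_edges (2*n)))
        (generate (sym_group (2*n + 1))
           {sigma n, transpose 2 3 \<circ> transpose (2*n) (2*n + 1)})"
| i: "folding_pair 7 (of_type 7 E6_edges)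
        (generate (sym_group 7) {cycle_of_list [2, 4, 6] \<circ> cycle_of_list [3, 5, 7]})"
| j: "folding_pair 7 (of_type 7 E6_edges)
        (generate (sym_group 7) {transpose 4 6 \<circ> transpose 5 7})"
| k: "folding_pair 8 (of_type 8 E7_edges)
        (generate (sym_group 8) {transpose 3 6 \<circ> transpose 4 7 \<circ> transpose 5 8})"

end

theory Submission
  imports Complex_Main Defs
begin

text \<open>Fix an acyclic quiver of the given affine type. Along every mutation sequence the
  \<open>c\<close>-vectors are roots of its Euler form, pairwise \<open>compatible\<close>, and the exchange matrix \<open>B\<close> is the
  skew-symmetrization of their Gram matrix. That mutation preserves compatibility comes down to
  excluding three configurations of positive roots: applying the reflections in a cyclic order of the
  vertices moves some root of the family that is not orthogonal to the null root \<open>\<delta>\<close> to a simple root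
  at a source or sink, and the other roots then live on the graph without that vertex, where the form
  is positive definite.

  The symmetrized Gram matrix \<open>A\<close> is a companion of \<open>B\<close>: it has diagonal \<open>2\<close>, \<open>\<bar>A i j\<bar> = \<bar>B i j\<bar>\<close>
  for \<open>i \<noteq> j\<close>, it is positive semidefinite of corank one, and the sign of its product along a
  triangle or an oriented square of \<open>B\<close> is prescribed. When the graph is a tree, \<open>A\<close> is determined by \<open>B\<close>
  up to conjugation by signs, so an automorphism of \<open>B\<close> acts on \<open>A\<close> through signs. If an involution
  \<open>g\<close> with a fixed vertex preserves \<open>B\<close>, these signs are constant on orbits; a failure of admissibility
  would give an oriented square \<open>i \<rightarrow> j \<rightarrow> g i \<rightarrow> g j \<rightarrow> i\<close>, on which the product of \<open>A\<close> would be both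
  negative and a square. For a cycle, \<open>A\<close> is the Gram matrix of vectors \<open>e\<^sub>a - e\<^sub>b\<close>, and no such vectors
  form a square with negative product. If \<open>B\<close> is preserved by a rotation of order three, some companion
  is preserved as well; its triangle signs and its decomposition into isotypic parts, only the trivial
  one of which is singular, leave only admissible matrices.\<close>

section \<open>Euler forms and reflections\<close>

lemma uminus_uminus_fun [simp]: "- (- x) = x" for x :: "'a \<Rightarrow> int"
  by (simp add: fun_Compl_def)

locale weighted_graph =
  fixes wt :: "'v \<Rightarrow> 'v \<Rightarrow> int"
  assumes wt_sym: "wt i j = wt j i" and wt_nonneg: "0 \<le> wt i j" and wt_irrefl [simp]: "wt i i = 0"
begin

text \<open>An enumeration \<open>L\<close> of the vertices encodes the orientation in which every edge points from the
  earlier to the later of its ends; \<open>euler L x y\<close> is the Euler form of that acyclic quiver at \<open>(y, x)\<close>.\<close>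

fun euler :: "'v list \<Rightarrow> ('v \<Rightarrow> int) \<Rightarrow> ('v \<Rightarrow> int) \<Rightarrow> int" where
  "euler [] x y = 0"
| "euler (s # L) x y = (x s - (\<Sum>j\<in>set L. wt j s * x j)) * y s + euler L x y"

definition cartan_form :: "'v set \<Rightarrow> ('v \<Rightarrow> int) \<Rightarrow> int" where
  "cartan_form J x = 2 * (\<Sum>i\<in>J. x i * x i) - (\<Sum>i\<in>J. \<Sum>j\<in>J. wt i j * x i * x j)"

definition reflect :: "'v set \<Rightarrow> 'v \<Rightarrow> ('v \<Rightarrow> int) \<Rightarrow> 'v \<Rightarrow> int" where
  "reflect J s x = x(s := (\<Sum>j\<in>J. wt j s * x j) - x s)"

subsection \<open>Bilinearity\<close>

lemma euler_cong:
  assumes "\<And>i. i \<in> set L \<Longrightarrow> x i = x' i" "\<And>i. i \<in> set L \<Longrightarrow> y i = y' i"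
  shows "euler L x y = euler L x' y'"
  using assms by (induction L) (auto intro!: sum.cong)

lemma euler_add_scaled_left: "euler L (\<lambda>i. x i + m * z i) y = euler L x y + m * euler L z y"
  by (induction L) (simp_all add: algebra_simps sum.distrib sum_distrib_left)

lemma euler_add_scaled_right: "euler L x (\<lambda>i. y i + m * z i) = euler L x y + m * euler L x z"
  by (induction L) (simp_all add: algebra_simps)

lemma euler_uminus_left [simp]: "euler L (- x) y = - euler L x y"
  by (induction L) (simp_all add: algebra_simps sum_negf)

lemma euler_uminus_right [simp]: "euler L x (- y) = - euler L x y"
  by (induction L) (simp_all add: algebra_simps)

lemma euler_zero_left: "(\<And>i. i \<in> set L \<Longrightarrow> x i = 0) \<Longrightarrow> euler L x y = 0"
  by (induction L) simp_all

lemma euler_zero_right: "(\<And>i. i \<in> set L \<Longrightarrow> y i = 0) \<Longrightarrow> euler L x y = 0"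
  by (induction L) simp_all

lemma euler_scale_left: "euler L (\<lambda>v. m * x v) y = m * euler L x y"
  using euler_add_scaled_left[of L "\<lambda>i. 0" m x y] euler_zero_left[of L "\<lambda>i. 0" y] by simp

lemma euler_scale_right: "euler L x (\<lambda>v. m * y v) = m * euler L x y"
  using euler_add_scaled_right[of L x "\<lambda>i. 0" m y] euler_zero_right[of L "\<lambda>i. 0" x] by simp

lemma euler_sum_left: "finite T \<Longrightarrow> euler L (\<lambda>v. \<Sum>t\<in>T. f t v) y = (\<Sum>t\<in>T. euler L (f t) y)"
  by (induction T rule: finite_induct)
     (simp_all add: euler_zero_left euler_add_scaled_left[where m = 1, simplified])

lemma euler_sum_right: "finite T \<Longrightarrow> euler L x (\<lambda>v. \<Sum>t\<in>T. f t v) = (\<Sum>t\<in>T. euler L x (f t))"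
  by (induction T rule: finite_induct)
     (simp_all add: euler_zero_right euler_add_scaled_right[where m = 1, simplified])

lemma reflect_add_scaled:
  "reflect J s (\<lambda>i. x i + m * y i) = (\<lambda>i. reflect J s x i + m * reflect J s y i)"
  by (auto simp: reflect_def fun_eq_iff algebra_simps sum.distrib sum_distrib_left)

lemma reflect_uminus: "reflect J s (- x) = - reflect J s x"
  by (auto simp: reflect_def fun_eq_iff sum_negf)

lemma reflect_eq_add_scaled:
  assumes "\<And>i. i \<in> J \<Longrightarrow> x i = y i + m * z i" "i \<in> J" "s \<in> J"
  shows "reflect J s x i = reflect J s y i + m * reflect J s z i"
proof -
  have "(\<Sum>j\<in>J. wt j s * x j) = (\<Sum>j\<in>J. wt j s * (y j + m * z j))"
    using assms(1) by (intro sum.cong) auto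
  then have "reflect J s x i = reflect J s (\<lambda>i. y i + m * z i) i"
    using assms by (simp add: reflect_def)
  then show ?thesis by (simp add: reflect_add_scaled)
qed

subsection \<open>Reflections at the ends of an enumeration\<close>

lemma reflect_other: "i \<noteq> s \<Longrightarrow> reflect J s x i = x i"
  by (simp add: reflect_def)

lemma reflect_reflect [simp]: "reflect J s (reflect J s x) = x"
proof -
  have "(\<Sum>j\<in>J. wt j s * reflect J s x j) = (\<Sum>j\<in>J. wt j s * x j)"
    by (intro sum.cong) (auto simp: reflect_def)
  then show ?thesis by (auto simp: fun_eq_iff reflect_def)
qed

lemma reflect_insert_self:
  "finite J \<Longrightarrow> s \<notin> J \<Longrightarrow> reflect (insert s J) s x s = (\<Sum>j\<in>J. wt j s * x j) - x s"
  by (simp add: reflect_def)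

lemma euler_first:
  "s \<notin> set L \<Longrightarrow> euler (s # L) x y = euler L x y - reflect (set (s # L)) s x s * y s"
  by (simp add: reflect_insert_self algebra_simps)

lemma euler_snoc:
  "distinct (L @ [s]) \<Longrightarrow>
     euler (L @ [s]) x y = euler L x y + x s * (y s - (\<Sum>j\<in>set L. wt j s * y j))"
proof (induction L)
  case (Cons t L)
  have "(\<Sum>j\<in>insert s (set L). wt j t * x j) = wt s t * x s + (\<Sum>j\<in>set L. wt j t * x j)"
    using Cons.prems by (subst sum.insert) auto
  moreover have "(\<Sum>j\<in>insert t (set L). wt j s * y j) = wt t s * y t + (\<Sum>j\<in>set L. wt j s * y j)"
    using Cons.prems by (subst sum.insert) auto
  moreover have "wt t s = wt s t" by (rule wt_sym)
  ultimately show ?case using Cons by (simp add: algebra_simps)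
qed simp

lemma euler_last:
  assumes "distinct (L @ [s])"
  shows "euler (L @ [s]) x y = euler L x y - x s * reflect (set (L @ [s])) s y s"
  using assms unfolding euler_snoc[OF assms] by (simp add: reflect_insert_self algebra_simps)

lemma euler_rev: "distinct L \<Longrightarrow> euler (rev L) x y = euler L y x"
  by (induction L) (simp_all add: euler_snoc algebra_simps)

definition flip :: "'v \<Rightarrow> 'v list \<Rightarrow> 'v list \<Rightarrow> bool" where
  "flip s L L' \<longleftrightarrow> (\<exists>M. L = s # M \<and> L' = M @ [s] \<or> L = M @ [s] \<and> L' = s # M)"

lemma flip_rev: "flip s L L' \<Longrightarrow> flip s (rev L) (rev L')"
  unfolding flip_def by (metis rev.simps(2) rev_append rev_rev_ident append_Nil rev_singleton_conv append_Cons)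

lemma flip_set [simp]: "flip s L L' \<Longrightarrow> set L' = set L"
  and flip_distinct: "flip s L L' \<Longrightarrow> distinct L' = distinct L"
  and flip_mem: "flip s L L' \<Longrightarrow> s \<in> set L"
  by (auto simp: flip_def)

lemma euler_flip:
  assumes "distinct L" "flip s L L'"
  shows "euler L' (reflect (set L) s x) (reflect (set L) s y) = euler L x y"
proof -
  have forward: "euler (M @ [s]) (reflect J s x) (reflect J s y) = euler (s # M) x y"
    if "distinct (s # M)" "J = set (s # M)" for M J x y
  proof -
    have "euler M (reflect J s x) (reflect J s y) = euler M x y"
      using that by (intro euler_cong) (auto simp: reflect_def)
    then show ?thesis
      using that euler_last[of M s "reflect J s x" "reflect J s y"] euler_first[of s M x y] by simp
  qed
  obtain M where "L = s # M \<and> L' = M @ [s] \<or> L = M @ [s] \<and> L' = s # M"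
    using assms(2) unfolding flip_def by blast
  then show ?thesis
  proof
    assume "L = s # M \<and> L' = M @ [s]"
    then show ?thesis using assms(1) by (simp only: forward)
  next
    assume L: "L = M @ [s] \<and> L' = s # M"
    then have "distinct (s # M)" "set L = set (s # M)" using assms(1) by auto
    then show ?thesis
      using L forward[of M "set L" "reflect (set L) s x" "reflect (set L) s y"] by simp
  qed
qed

lemma euler_self: "distinct L \<Longrightarrow> 2 * euler L x x = cartan_form (set L) x"
proof (induction L)
  case (Cons s L)
  have "(\<Sum>i\<in>set L. wt i s * x i * x s) = x s * (\<Sum>i\<in>set L. wt i s * x i)"
    "(\<Sum>i\<in>set L. wt s i * x s * x i) = x s * (\<Sum>i\<in>set L. wt i s * x i)"
    by (simp_all add: sum_distrib_left algebra_simps wt_sym[of s])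
  then have "cartan_form (set (s # L)) x
      = 2 * x s * x s - 2 * x s * (\<Sum>i\<in>set L. wt i s * x i) + cartan_form (set L) x"
    using Cons.prems by (simp add: cartan_form_def sum.distrib algebra_simps)
  then show ?case using Cons by (simp add: algebra_simps)
qed (simp add: cartan_form_def)

lemma cartan_form_reflect:
  assumes "finite J" "s \<in> J"
  shows "cartan_form J (reflect J s x) = cartan_form J x"
proof -
  obtain M where M: "distinct M" "set M = J - {s}" using finite_distinct_list[of "J - {s}"] assms by blast
  have "distinct (s # M)" "set (s # M) = J" "distinct (M @ [s])" "set (M @ [s]) = J"
    using M assms by auto
  moreover have "flip s (s # M) (M @ [s])" by (auto simp: flip_def)
  ultimately show ?thesis using euler_flip[of "s # M" s "M @ [s]" x x] euler_self by metis
qed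

subsection \<open>Roots\<close>

definition root :: "'v set \<Rightarrow> ('v \<Rightarrow> int) \<Rightarrow> bool" where
  "root J x \<longleftrightarrow> cartan_form J x = 2"

definition nonneg_on :: "'v set \<Rightarrow> ('v \<Rightarrow> int) \<Rightarrow> bool" where
  "nonneg_on J x \<longleftrightarrow> (\<forall>i\<in>J. 0 \<le> x i)"

definition pos_root :: "'v set \<Rightarrow> ('v \<Rightarrow> int) \<Rightarrow> bool" where
  "pos_root J x \<longleftrightarrow> root J x \<and> nonneg_on J x"

definition simple_root :: "'v set \<Rightarrow> 'v \<Rightarrow> ('v \<Rightarrow> int) \<Rightarrow> bool" where
  "simple_root J s x \<longleftrightarrow> (\<forall>i\<in>J. x i = (if i = s then 1 else 0))"

definition roots_sign_coherent :: "'v set \<Rightarrow> bool" where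
  "roots_sign_coherent J \<longleftrightarrow> (\<forall>x. root J x \<longrightarrow> nonneg_on J x \<or> nonneg_on J (- x))"

lemma root_euler: "distinct L \<Longrightarrow> root (set L) x \<longleftrightarrow> euler L x x = 1"
  using euler_self[of L x] by (auto simp: root_def)

lemma cartan_form_uminus [simp]: "cartan_form J (- x) = cartan_form J x"
  by (simp add: cartan_form_def)

lemma root_uminus [simp]: "root J (- x) = root J x"
  by (simp add: root_def)

lemma root_reflect: "finite J \<Longrightarrow> s \<in> J \<Longrightarrow> root J x \<Longrightarrow> root J (reflect J s x)"
  by (simp add: root_def cartan_form_reflect)

lemma pos_rootD: "pos_root J x \<Longrightarrow> i \<in> J \<Longrightarrow> 0 \<le> x i"
  by (simp add: pos_root_def nonneg_on_def)

lemma root_not_both_signs: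
  assumes "root J x" "nonneg_on J x"
  shows "\<not> nonneg_on J (- x)"
proof
  assume "nonneg_on J (- x)"
  then have "x i = 0" if "i \<in> J" for i using assms(2) that by (force simp: nonneg_on_def)
  then show False using assms(1) by (simp add: root_def cartan_form_def)
qed

lemma nonneg_uminus_iff:
  "roots_sign_coherent J \<Longrightarrow> root J x \<Longrightarrow> nonneg_on J (- x) \<longleftrightarrow> \<not> nonneg_on J x"
  using root_not_both_signs unfolding roots_sign_coherent_def by blast

lemma pos_root_supported_at:
  assumes "finite J" "pos_root J x" "s \<in> J" "\<And>i. i \<in> J \<Longrightarrow> i \<noteq> s \<Longrightarrow> x i = 0"
  shows "simple_root J s x"
proof -
  have "(\<Sum>i\<in>J. x i * x i) = (\<Sum>i\<in>J. if i = s then x s * x s else 0)"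
    using assms(4) by (intro sum.cong) auto
  moreover have "(\<Sum>i\<in>J. \<Sum>j\<in>J. wt i j * x i * x j) = 0"
  proof (intro sum.neutral ballI)
    show "wt i j * x i * x j = 0" if "i \<in> J" "j \<in> J" for i j
      using assms(4)[OF that(1)] assms(4)[OF that(2)] by (cases "i = s"; cases "j = s") auto
  qed
  ultimately have "x s * x s = 1"
    using assms(1-3) by (simp add: pos_root_def root_def cartan_form_def)
  moreover have "0 \<le> x s" using assms(2,3) by (rule pos_rootD)
  ultimately have "x s = 1" by (auto simp: zmult_eq_1_iff)
  then show ?thesis using assms(4) by (simp add: simple_root_def)
qed

lemma pos_root_reflect:
  assumes J: "finite J" "roots_sign_coherent J" "s \<in> J" and x: "pos_root J x" "\<not> simple_root J s x"
  shows "pos_root J (reflect J s x)"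
proof -
  have root: "root J (reflect J s x)" using J x by (simp add: pos_root_def root_reflect)
  have "\<not> nonneg_on J (- reflect J s x)"
  proof
    assume neg: "nonneg_on J (- reflect J s x)"
    have "x i = 0" if "i \<in> J" "i \<noteq> s" for i
      using neg pos_rootD[OF x(1) that(1)] that by (force simp: nonneg_on_def reflect_other)
    then have "simple_root J s x" using J x by (intro pos_root_supported_at) auto
    then show False using x(2) by simp
  qed
  then show ?thesis using root nonneg_uminus_iff[OF J(2) root] by (simp add: pos_root_def)
qed

lemma nonneg_reflect_iff:
  assumes J: "finite J" "roots_sign_coherent J" "s \<in> J"
    and x: "root J x" "\<not> simple_root J s x" "\<not> simple_root J s (- x)"
  shows "nonneg_on J (reflect J s x) \<longleftrightarrow> nonneg_on J x"
proof (cases "nonneg_on J x")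
  case True
  then show ?thesis using pos_root_reflect[OF J _ x(2)] x(1) by (simp add: pos_root_def)
next
  case False
  then have "pos_root J (- x)" using x(1) nonneg_uminus_iff[OF J(2)] by (simp add: pos_root_def)
  then have "nonneg_on J (- reflect J s x)"
    using pos_root_reflect[OF J _ x(3)] by (simp add: pos_root_def reflect_uminus)
  then show ?thesis
    using False root_not_both_signs[of J "reflect J s x"] root_reflect[OF J(1,3) x(1)] by blast
qed

lemma simple_root_other: "simple_root J s z \<Longrightarrow> i \<in> J \<Longrightarrow> i \<noteq> s \<Longrightarrow> z i = 0"
  and simple_root_self: "simple_root J s z \<Longrightarrow> s \<in> J \<Longrightarrow> z s = 1"
  and simple_root_nonneg: "simple_root J s z \<Longrightarrow> nonneg_on J z"
  by (auto simp: simple_root_def nonneg_on_def)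

lemma euler_simple_first:
  assumes "distinct (s # L)" "simple_root (set (s # L)) s z"
  shows "euler (s # L) z y = y s" "euler (s # L) x z = - reflect (set (s # L)) s x s"
proof -
  have zero: "z i = 0" if "i \<in> set L" for i using simple_root_other[OF assms(2)] assms(1) that by auto
  have "z s = 1" using simple_root_self[OF assms(2)] by simp
  then show "euler (s # L) z y = y s" using zero by (simp add: euler_zero_left)
  have "euler (s # L) x z = euler L x z - reflect (set (s # L)) s x s"
    using euler_first[of s L x z] assms(1) \<open>z s = 1\<close> by simp
  then show "euler (s # L) x z = - reflect (set (s # L)) s x s"
    using euler_zero_right[of L z x] zero by simp
qed

lemma euler_simple_last:
  assumes "distinct (L @ [s])" "simple_root (set (L @ [s])) s z"
  shows "euler (L @ [s]) x z = x s" "euler (L @ [s]) z y = - reflect (set (L @ [s])) s y s"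
proof -
  have "distinct (s # rev L)" "set (L @ [s]) = set (s # rev L)" using assms(1) by auto
  then show "euler (L @ [s]) x z = x s" "euler (L @ [s]) z y = - reflect (set (L @ [s])) s y s"
    using euler_simple_first[of s "rev L" z] euler_rev[of "s # rev L"] assms(2) by simp_all
qed

section \<open>Coxeter transformations and affine graphs\<close>

definition coxeter :: "'v list \<Rightarrow> ('v \<Rightarrow> int) \<Rightarrow> 'v \<Rightarrow> int" where
  "coxeter L = fold (reflect (set L)) L"

lemma fold_reflect_add_scaled:
  "fold (reflect J) L (\<lambda>i. x i + m * y i) = (\<lambda>i. fold (reflect J) L x i + m * fold (reflect J) L y i)"
  by (induction L arbitrary: x y) (simp_all add: reflect_add_scaled)

lemma coxeter_add_scaled: "coxeter L (\<lambda>i. x i + m * y i) = (\<lambda>i. coxeter L x i + m * coxeter L y i)"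
  by (simp add: coxeter_def fold_reflect_add_scaled)

lemma coxeter_zero: "coxeter L (\<lambda>i. 0) = (\<lambda>i. 0)"
  using coxeter_add_scaled[of L "\<lambda>i. 0" "- 1" "\<lambda>i. 0"] by simp

lemma coxeter_sum: "coxeter L (\<lambda>i. \<Sum>t<(h::nat). f t i) = (\<lambda>i. \<Sum>t<h. coxeter L (f t) i)"
proof (induction h)
  case (Suc h)
  then show ?case
    using coxeter_add_scaled[of L "\<lambda>i. \<Sum>t<h. f t i" 1 "f h"] by simp
qed (simp add: coxeter_zero)

lemma fold_reflect_outside: "i \<notin> set L \<Longrightarrow> fold (reflect J) L x i = x i"
  by (induction L arbitrary: x) (simp_all add: reflect_other)

lemma coxeter_power_outside: "i \<notin> set L \<Longrightarrow> (coxeter L ^^ t) x i = x i"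
  by (induction t) (simp_all add: coxeter_def fold_reflect_outside)

lemma fold_reflect_rev: "fold (reflect J) (rev L) (fold (reflect J) L x) = x"
  by (induction L arbitrary: x) simp_all

lemma coxeter_rev_coxeter: "coxeter (rev L) (coxeter L x) = x"
  by (simp add: coxeter_def fold_reflect_rev)

lemma coxeter_rev_power: "(coxeter (rev L) ^^ r) ((coxeter L ^^ r) x) = x"
proof (induction r arbitrary: x)
  case (Suc r)
  have "(coxeter (rev L) ^^ Suc r) ((coxeter L ^^ Suc r) x)
      = (coxeter (rev L) ^^ r) (coxeter (rev L) (coxeter L ((coxeter L ^^ r) x)))"
    by (simp add: funpow_swap1)
  then show ?case using Suc by (simp add: coxeter_rev_coxeter)
qed simp

subsection \<open>Invariance under flips\<close>

definition flip_closed :: "'v set \<Rightarrow> ('v list \<Rightarrow> ('v \<Rightarrow> int) \<Rightarrow> bool) \<Rightarrow> bool" where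
  "flip_closed J P \<longleftrightarrow> (\<forall>L s L' x. distinct L \<longrightarrow> set L = J \<longrightarrow> flip s L L' \<longrightarrow> P L x \<longrightarrow> P L' (reflect J s x))"

lemma flip_closedD:
  "flip_closed J P \<Longrightarrow> distinct L \<Longrightarrow> set L = J \<Longrightarrow> flip s L L' \<Longrightarrow> P L x \<Longrightarrow> P L' (reflect J s x)"
  unfolding flip_closed_def by blast

lemma flip_closed_rev: "flip_closed J P \<Longrightarrow> flip_closed J (\<lambda>L. P (rev L))"
  unfolding flip_closed_def using flip_rev by (metis distinct_rev set_rev)

lemma flip_closed_coxeter:
  assumes P: "flip_closed (set L) P" and "distinct L" "P L x"
  shows "P L (coxeter L x)"
proof -
  have "P (M @ L') (fold (reflect (set L)) L' x)"
    if "P (L' @ M) x" "distinct (L' @ M)" "set (L' @ M) = set L" for L' M x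
    using that
  proof (induction L' arbitrary: M x)
    case (Cons s L')
    have "flip s (s # (L' @ M)) ((L' @ M) @ [s])" by (auto simp: flip_def)
    then have "P (L' @ (M @ [s])) (reflect (set L) s x)"
      using flip_closedD[OF P, of "s # (L' @ M)"] Cons.prems by simp
    then have "P ((M @ [s]) @ L') (fold (reflect (set L)) L' (reflect (set L) s x))"
      using Cons.prems by (intro Cons.IH) auto
    then show ?case by simp
  qed simp
  from this[of L "[]" x] show ?thesis using assms by (simp add: coxeter_def)
qed

lemma flip_closed_coxeter_power:
  assumes "flip_closed (set L) P" "distinct L" "P L x"
  shows "P L ((coxeter L ^^ t) x)"
  using assms by (induction t) (simp_all add: flip_closed_coxeter)

lemma flip_closed_coxeter_rev_power:
  assumes "flip_closed (set L) P" "distinct L" "P L x"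
  shows "P L ((coxeter (rev L) ^^ t) x)"
  using flip_closed_coxeter_power[of "rev L" "\<lambda>L. P (rev L)"] flip_closed_rev assms by simp

subsection \<open>Periodic orbits\<close>

lemma fold_reflect_fixed:
  assumes "distinct L" "fold (reflect J) L u = u" "s \<in> set L"
  shows "reflect J s u = u"
  using assms
proof (induction L)
  case (Cons t L)
  have "fold (reflect J) L (reflect J t u) t = reflect J t u t"
    using Cons.prems by (intro fold_reflect_outside) auto
  then have "reflect J t u t = u t" using Cons.prems(2) by simp
  then have "reflect J t u = u" by (auto simp: reflect_def fun_eq_iff)
  then show ?case using Cons by auto
qed simp

lemma cartan_form_radical:
  assumes "\<And>s. s \<in> J \<Longrightarrow> (\<Sum>j\<in>J. wt j s * u j) = 2 * u s"
  shows "cartan_form J u = 0"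
proof -
  have "(\<Sum>i\<in>J. \<Sum>j\<in>J. wt i j * u i * u j) = (\<Sum>i\<in>J. u i * (\<Sum>j\<in>J. wt j i * u j))"
    by (simp add: sum_distrib_left wt_sym algebra_simps)
  also have "\<dots> = (\<Sum>i\<in>J. 2 * (u i * u i))"
    by (intro sum.cong) (simp_all add: assms)
  finally show ?thesis by (simp add: cartan_form_def sum_distrib_left)
qed

lemma cartan_form_coxeter_fixed:
  assumes "distinct L" "coxeter L u = u"
  shows "cartan_form (set L) u = 0"
proof (rule cartan_form_radical)
  fix s assume "s \<in> set L"
  then have "reflect (set L) s u = u"
    using assms unfolding coxeter_def by (rule fold_reflect_fixed[rotated 2])
  from fun_cong[OF this, of s] show "(\<Sum>j\<in>set L. wt j s * u j) = 2 * u s"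
    by (simp add: reflect_def)
qed

definition orbit_sum :: "'v list \<Rightarrow> nat \<Rightarrow> ('v \<Rightarrow> int) \<Rightarrow> 'v \<Rightarrow> int" where
  "orbit_sum L h y = (\<lambda>i. \<Sum>t<h. (coxeter L ^^ t) y i)"

lemma coxeter_orbit_sum:
  assumes "(coxeter L ^^ h) y = y"
  shows "coxeter L (orbit_sum L h y) = orbit_sum L h y"
proof -
  have "(\<Sum>t<h. (coxeter L ^^ Suc t) y i) = (\<Sum>t<h. (coxeter L ^^ t) y i)" for i
  proof -
    have "(\<Sum>t<h. (coxeter L ^^ Suc t) y i) + (coxeter L ^^ 0) y i
        = (\<Sum>t<Suc h. (coxeter L ^^ t) y i)"
      by (simp only: sum.lessThan_Suc_shift add.commute)
    then show ?thesis using assms by simp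
  qed
  then show ?thesis unfolding orbit_sum_def by (subst coxeter_sum) simp
qed

lemma cartan_form_orbit_sum:
  "distinct L \<Longrightarrow> (coxeter L ^^ h) y = y \<Longrightarrow> cartan_form (set L) (orbit_sum L h y) = 0"
  by (intro cartan_form_coxeter_fixed coxeter_orbit_sum)

end

lemma nat_sequence_repeats:
  fixes f :: "nat \<Rightarrow> 'a"
  assumes "finite B" "\<And>t. f t \<in> B"
  obtains t h where "0 < h" "f (t + h) = f t"
proof -
  have "\<not> inj f"
    using assms finite_subset[of "range f" B] finite_imageD[of f UNIV] by auto
  then obtain a b where "a < b" "f a = f b" by (metis injI linorder_neqE_nat)
  then show ?thesis using that[of "b - a" a] by simp
qed

lemma funpow_translate:
  fixes T :: "('v \<Rightarrow> int) \<Rightarrow> 'v \<Rightarrow> int"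
  assumes T: "\<And>z c. T (\<lambda>i. z i + c * d i) = (\<lambda>i. T z i + c * d i)"
    and y: "(T ^^ h) y = (\<lambda>i. y i + k * d i)"
  shows "(T ^^ (m * h)) y = (\<lambda>i. y i + int m * k * d i)"
proof (induction m)
  case (Suc m)
  have translate: "(T ^^ r) (\<lambda>i. z i + c * d i) = (\<lambda>i. (T ^^ r) z i + c * d i)" for r c z
    by (induction r) (simp_all add: T)
  have "(T ^^ (Suc m * h)) y = (T ^^ h) (\<lambda>i. y i + int m * k * d i)"
    using Suc by (simp add: funpow_add)
  then show ?case unfolding translate y by (simp add: algebra_simps)
qed simp

lemma nonneg_if_multiples_bounded_below:
  fixes a b :: int
  assumes "\<And>m. 0 \<le> a + int m * b"
  shows "0 \<le> b"
proof (rule ccontr)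
  assume "\<not> 0 \<le> b"
  then have "int (nat (\<bar>a\<bar> + 1)) * b \<le> int (nat (\<bar>a\<bar> + 1)) * (- 1)"
    by (intro mult_left_mono) auto
  then show False using assms[of "nat (\<bar>a\<bar> + 1)"] by simp
qed

locale affine_graph = weighted_graph wt for wt :: "'v \<Rightarrow> 'v \<Rightarrow> int" +
  fixes I :: "'v set" and \<delta> :: "'v \<Rightarrow> int"
  assumes fin: "finite I" and nonempty: "I \<noteq> {}"
    and delta_pos: "i \<in> I \<Longrightarrow> 0 < \<delta> i" and delta_out: "i \<notin> I \<Longrightarrow> \<delta> i = 0"
    and balanced: "i \<in> I \<Longrightarrow> (\<Sum>j\<in>I. wt j i * \<delta> j) = 2 * \<delta> i"
    and connected: "S \<subseteq> I \<Longrightarrow> S \<noteq> {} \<Longrightarrow> (\<And>i j. i \<in> S \<Longrightarrow> j \<in> I - S \<Longrightarrow> wt i j = 0) \<Longrightarrow> S = I"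
begin

subsection \<open>Semidefiniteness\<close>

lemma cartan_form_sum_squares:
  "2 * real_of_int (cartan_form I x) = (\<Sum>i\<in>I. \<Sum>j\<in>I. real_of_int (wt i j * \<delta> i * \<delta> j) *
      (real_of_int (x i) / real_of_int (\<delta> i) - real_of_int (x j) / real_of_int (\<delta> j))\<^sup>2)"
proof -
  define r where "r i = real_of_int (x i)" for i
  define d where "d i = real_of_int (\<delta> i)" for i
  define m where "m i j = real_of_int (wt i j)" for i j
  have d_pos: "0 < d i" if "i \<in> I" for i using delta_pos[OF that] by (simp add: d_def)
  have m_sym: "m i j = m j i" for i j by (simp add: m_def wt_sym)
  have m_balanced: "(\<Sum>j\<in>I. m i j * d j) = 2 * d i" if "i \<in> I" for i
  proof -
    have "(\<Sum>j\<in>I. m i j * d j) = real_of_int (\<Sum>j\<in>I. wt j i * \<delta> j)"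
      by (simp add: m_def d_def wt_sym)
    then show ?thesis using balanced[OF that] by (simp add: d_def)
  qed
  have diagonal: "(\<Sum>i\<in>I. (r i * r i / d i) * (\<Sum>j\<in>I. m i j * d j)) = 2 * (\<Sum>i\<in>I. r i * r i)"
  proof -
    have "(r i * r i / d i) * (\<Sum>j\<in>I. m i j * d j) = 2 * (r i * r i)" if "i \<in> I" for i
      using d_pos[OF that] by (simp add: m_balanced[OF that])
    then show ?thesis unfolding sum_distrib_left[of 2] by (intro sum.cong) auto
  qed
  have "(\<Sum>i\<in>I. \<Sum>j\<in>I. m i j * d i * d j * (r i / d i - r j / d j)\<^sup>2)
      = (\<Sum>i\<in>I. \<Sum>j\<in>I. (r i * r i / d i) * (m i j * d j) + (r j * r j / d j) * (m j i * d i)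
          - 2 * (m i j * r i * r j))"
  proof (intro sum.cong refl)
    fix i j assume "i \<in> I" "j \<in> I"
    then have "d i \<noteq> 0" "d j \<noteq> 0" using d_pos by (metis less_irrefl)+
    then show "m i j * d i * d j * (r i / d i - r j / d j)\<^sup>2
       = (r i * r i / d i) * (m i j * d j) + (r j * r j / d j) * (m j i * d i) - 2 * (m i j * r i * r j)"
      by (simp add: m_sym[of j i] field_simps power2_eq_square)
  qed
  also have "\<dots> = (\<Sum>i\<in>I. (r i * r i / d i) * (\<Sum>j\<in>I. m i j * d j))
       + (\<Sum>j\<in>I. (r j * r j / d j) * (\<Sum>i\<in>I. m j i * d i)) - 2 * (\<Sum>i\<in>I. \<Sum>j\<in>I. m i j * r i * r j)"
    using sum.swap[of "\<lambda>i j. (r j * r j / d j) * (m j i * d i)" I I]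
    by (simp only: sum_subtractf sum.distrib sum_distrib_left)
  finally show ?thesis
    unfolding diagonal by (simp add: cartan_form_def r_def d_def m_def)
qed

lemma square_term_nonneg:
  assumes "i \<in> I" "j \<in> I"
  shows "0 \<le> real_of_int (wt i j * \<delta> i * \<delta> j) * (r::real)\<^sup>2"
  using wt_nonneg[of i j] delta_pos[OF assms(1)] delta_pos[OF assms(2)] by simp

lemma cartan_form_nonneg: "0 \<le> cartan_form I x"
proof -
  have "0 \<le> 2 * real_of_int (cartan_form I x)"
    unfolding cartan_form_sum_squares by (intro sum_nonneg square_term_nonneg)
  then show ?thesis by simp
qed

lemma cartan_form_null_edge:
  assumes null: "cartan_form I x = 0" and ij: "i \<in> I" "j \<in> I" "wt i j \<noteq> 0"
  shows "x i * \<delta> j = x j * \<delta> i"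
proof -
  let ?t = "\<lambda>i j. real_of_int (wt i j * \<delta> i * \<delta> j) *
      (real_of_int (x i) / real_of_int (\<delta> i) - real_of_int (x j) / real_of_int (\<delta> j))\<^sup>2"
  have "(\<Sum>i\<in>I. \<Sum>j\<in>I. ?t i j) = 0" using cartan_form_sum_squares[of x] null by simp
  then have "(\<Sum>j\<in>I. ?t i j) = 0"
    by (rule sum_nonneg_0[OF fin _ _ ij(1), rotated]) (intro sum_nonneg square_term_nonneg)
  then have "?t i j = 0"
    using sum_nonneg_0[OF fin, of "?t i" j] square_term_nonneg[OF ij(1)] ij(2) by blast
  then have "real_of_int (x i) / real_of_int (\<delta> i) = real_of_int (x j) / real_of_int (\<delta> j)"
    using ij delta_pos[OF ij(1)] delta_pos[OF ij(2)] by simp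
  then have "real_of_int (x i * \<delta> j) = real_of_int (x j * \<delta> i)"
    using delta_pos[OF ij(1)] delta_pos[OF ij(2)] by (simp add: field_simps)
  then show ?thesis by (simp only: of_int_eq_iff)
qed

lemma cartan_form_null_proportional:
  assumes null: "cartan_form I x = 0" and ij: "i \<in> I" "j \<in> I"
  shows "x i * \<delta> j = x j * \<delta> i"
proof -
  define S where "S = {k\<in>I. x i * \<delta> k = x k * \<delta> i}"
  have "S = I"
  proof (rule connected)
    show "S \<subseteq> I" "S \<noteq> {}" using ij by (auto simp: S_def)
    fix k l assume kl: "k \<in> S" "l \<in> I - S"
    show "wt k l = 0"
    proof (rule ccontr)
      assume "wt k l \<noteq> 0"
      then have edge: "x k * \<delta> l = x l * \<delta> k" using kl cartan_form_null_edge[OF null] by (auto simp: S_def)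
      have "\<delta> k * (x i * \<delta> l) = (x i * \<delta> k) * \<delta> l" by simp
      also have "\<dots> = (x k * \<delta> l) * \<delta> i" using kl by (simp add: S_def)
      also have "\<dots> = \<delta> k * (x l * \<delta> i)" by (simp add: edge)
      finally have "x i * \<delta> l = x l * \<delta> i" using delta_pos[of k] kl by (simp add: S_def)
      then show False using kl by (simp add: S_def)
    qed
  qed
  then show ?thesis using ij by (auto simp: S_def)
qed

lemma cartan_form_even: "even (cartan_form I x)"
proof -
  obtain L where "distinct L" "set L = I" using finite_distinct_list[OF fin] by blast
  then show ?thesis using euler_self[of L x] by (metis dvd_triv_left)
qed

subsection \<open>Sign-coherence of roots\<close>

lemma cartan_form_disjoint_parts:
  assumes "\<And>i. x i = p i - q i" "\<And>i. p i * q i = 0" "\<And>i. 0 \<le> p i" "\<And>i. 0 \<le> q i"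
  shows "cartan_form I p + cartan_form I q \<le> cartan_form I x"
proof -
  have square: "x i * x i = p i * p i + q i * q i" for i
    using assms(2)[of i] by (simp add: assms(1) algebra_simps)
  have mixed: "wt i j * x i * x j \<le> wt i j * p i * p j + wt i j * q i * q j" for i j
  proof -
    have "wt i j * x i * x j
        = wt i j * p i * p j + wt i j * q i * q j - wt i j * (p i * q j) - wt i j * (q i * p j)"
      by (simp add: assms(1) algebra_simps)
    moreover have "0 \<le> wt i j * (p i * q j)" "0 \<le> wt i j * (q i * p j)"
      using wt_nonneg assms by simp_all
    ultimately show ?thesis by linarith
  qed
  have "(\<Sum>i\<in>I. \<Sum>j\<in>I. wt i j * x i * x j)
     \<le> (\<Sum>i\<in>I. \<Sum>j\<in>I. wt i j * p i * p j + wt i j * q i * q j)"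
    by (intro sum_mono mixed)
  then show ?thesis by (simp add: cartan_form_def square sum.distrib)
qed

lemma null_positive_part_sign:
  assumes null: "cartan_form I (\<lambda>i. max 0 (x i)) = 0"
  shows "nonneg_on I x \<or> nonneg_on I (- x)"
proof (cases "\<exists>i\<in>I. 0 < x i")
  case True
  then obtain i where i: "i \<in> I" "0 < x i" by blast
  have "0 \<le> x j" if j: "j \<in> I" for j
  proof -
    have "max 0 (x i) * \<delta> j = max 0 (x j) * \<delta> i"
      using cartan_form_null_proportional[OF null i(1) j] .
    moreover have "0 < max 0 (x i) * \<delta> j" using i delta_pos[OF j] by simp
    ultimately have "max 0 (x j) \<noteq> 0" by (metis less_irrefl mult_zero_left)
    then show ?thesis by (simp add: max_def split: if_splits)
  qed
  then show ?thesis by (simp add: nonneg_on_def)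
qed (auto simp: nonneg_on_def not_less)

lemma roots_sign_coherent: "roots_sign_coherent I"
  unfolding roots_sign_coherent_def
proof (intro allI impI)
  fix x assume "root I x"
  define p where "p = (\<lambda>i. max 0 (x i))"
  define q where "q = (\<lambda>i. max 0 ((- x) i))"
  have "cartan_form I p + cartan_form I q \<le> cartan_form I x"
    by (rule cartan_form_disjoint_parts) (auto simp: p_def q_def max_def)
  then have "cartan_form I p + cartan_form I q \<le> 2" using \<open>root I x\<close> by (simp add: root_def)
  then have "cartan_form I p = 0 \<or> cartan_form I q = 0"
    using cartan_form_nonneg[of p] cartan_form_nonneg[of q] cartan_form_even[of p] cartan_form_even[of q]
    by (smt (verit) odd_one)
  then show "nonneg_on I x \<or> nonneg_on I (- x)"
    using null_positive_part_sign[of x] null_positive_part_sign[of "- x"]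
    unfolding p_def q_def uminus_uminus_fun by blast
qed

lemma cartan_form_delete:
  assumes "s \<in> I"
  shows "cartan_form (I - {s}) x = cartan_form I (x(s := 0))"
proof -
  obtain L where L: "distinct L" "set L = I - {s}" using finite_distinct_list[of "I - {s}"] fin by blast
  have "euler (s # L) (x(s := 0)) (x(s := 0)) = euler L (x(s := 0)) (x(s := 0))" by simp
  also have "\<dots> = euler L x x" using L by (intro euler_cong) auto
  finally show ?thesis
    using euler_self[of L x] euler_self[of "s # L" "x(s := 0)"] L assms by (simp add: insert_absorb)
qed

lemma root_delete: "s \<in> I \<Longrightarrow> root (I - {s}) x \<longleftrightarrow> root I (x(s := 0))"
  by (simp add: root_def cartan_form_delete)

lemma roots_sign_coherent_delete:
  assumes "s \<in> I"
  shows "roots_sign_coherent (I - {s})"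
  unfolding roots_sign_coherent_def
proof (intro allI impI)
  fix x assume "root (I - {s}) x"
  then have "nonneg_on I (x(s := 0)) \<or> nonneg_on I (- x(s := 0))"
    using roots_sign_coherent assms by (simp add: root_delete roots_sign_coherent_def)
  then show "nonneg_on (I - {s}) x \<or> nonneg_on (I - {s}) (- x)"
    by (auto simp: nonneg_on_def split: if_splits)
qed

subsection \<open>Translation by the null root\<close>

lemma reflect_delta [simp]: "s \<in> I \<Longrightarrow> reflect I s \<delta> = \<delta>"
  by (simp add: reflect_def balanced)

lemma coxeter_delta:
  assumes "set L = I"
  shows "coxeter L \<delta> = \<delta>"
proof -
  have "set M \<subseteq> I \<Longrightarrow> fold (reflect I) M \<delta> = \<delta>" for M by (induction M) simp_all
  then show ?thesis using assms by (simp add: coxeter_def)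
qed

lemma cartan_form_delta [simp]: "cartan_form I \<delta> = 0"
  by (rule cartan_form_radical) (rule balanced)

lemma cartan_form_add_delta: "cartan_form I (\<lambda>i. x i + k * \<delta> i) = cartan_form I x"
proof -
  let ?c = "\<Sum>i\<in>I. x i * \<delta> i"
  have right: "(\<Sum>i\<in>I. \<Sum>j\<in>I. wt i j * x i * \<delta> j) = 2 * ?c"
  proof -
    have "(\<Sum>i\<in>I. \<Sum>j\<in>I. wt i j * x i * \<delta> j) = (\<Sum>i\<in>I. x i * (\<Sum>j\<in>I. wt j i * \<delta> j))"
      by (simp add: sum_distrib_left wt_sym algebra_simps)
    also have "\<dots> = (\<Sum>i\<in>I. 2 * (x i * \<delta> i))"
      by (intro sum.cong) (simp_all add: balanced)
    finally show ?thesis by (simp add: sum_distrib_left)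
  qed
  have "(\<Sum>i\<in>I. \<Sum>j\<in>I. wt i j * \<delta> i * x j) = (\<Sum>j\<in>I. \<Sum>i\<in>I. wt i j * \<delta> i * x j)"
    by (rule sum.swap)
  also have "\<dots> = 2 * ?c"
    unfolding right[symmetric] by (simp add: wt_sym algebra_simps)
  finally have left: "(\<Sum>i\<in>I. \<Sum>j\<in>I. wt i j * \<delta> i * x j) = 2 * ?c" .
  have "cartan_form I (\<lambda>i. x i + k * \<delta> i) = cartan_form I x + k * k * cartan_form I \<delta> + 4 * k * ?c
      - k * (\<Sum>i\<in>I. \<Sum>j\<in>I. wt i j * x i * \<delta> j) - k * (\<Sum>i\<in>I. \<Sum>j\<in>I. wt i j * \<delta> i * x j)"
    by (simp add: cartan_form_def sum.distrib sum_distrib_left algebra_simps)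
  then show ?thesis using left right by simp
qed

lemma euler_delta_delta: "distinct L \<Longrightarrow> set L = I \<Longrightarrow> euler L \<delta> \<delta> = 0"
  using euler_self[of L \<delta>] by simp

lemma euler_delta_right:
  assumes "distinct L" "set L = I"
  shows "euler L x \<delta> = - euler L \<delta> x"
proof -
  have "2 * euler L (\<lambda>i. x i + 1 * \<delta> i) (\<lambda>i. x i + 1 * \<delta> i) = 2 * euler L x x"
    using euler_self[OF assms(1)] assms(2) cartan_form_add_delta[of x 1] by simp
  then show ?thesis
    using euler_delta_delta[OF assms] by (simp only: euler_add_scaled_left euler_add_scaled_right) simp
qed

lemma euler_delta_coxeter_power:
  assumes "distinct L" "set L = I"
  shows "euler L \<delta> ((coxeter L ^^ t) x) = euler L \<delta> x"
proof -
  have "flip_closed I (\<lambda>L' x'. euler L' \<delta> x' = euler L \<delta> x)"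
    unfolding flip_closed_def
  proof (intro allI impI)
    fix L' s L'' x' assume "distinct L'" "set L' = I" "flip s L' L''" "euler L' \<delta> x' = euler L \<delta> x"
    then show "euler L'' \<delta> (reflect I s x') = euler L \<delta> x"
      using euler_flip[of L' s L'' \<delta> x'] flip_mem[of s L' L''] by simp
  qed
  then show ?thesis
    using flip_closed_coxeter_power[of L "\<lambda>L' x'. euler L' \<delta> x' = euler L \<delta> x"] assms by simp
qed

lemma root_between_delta_multiples:
  assumes "root I x"
  obtains k where "\<And>i. i \<in> I \<Longrightarrow> 0 \<le> x i - k * \<delta> i \<and> x i - k * \<delta> i \<le> \<delta> i"
proof -
  have sign: "(\<forall>i\<in>I. 0 \<le> x i - k * \<delta> i) \<or> (\<forall>i\<in>I. x i - k * \<delta> i \<le> 0)" for k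
  proof -
    have "root I (\<lambda>i. x i + (- k) * \<delta> i)"
      using assms cartan_form_add_delta[of x "- k"] by (simp add: root_def)
    then show ?thesis
      using roots_sign_coherent unfolding roots_sign_coherent_def nonneg_on_def by fastforce
  qed
  obtain j where j: "j \<in> I" using nonempty by blast
  define k where "k = x j div \<delta> j"
  have div_bounds: "k * \<delta> j \<le> x j" "x j < (k + 1) * \<delta> j"
    using pos_mod_sign[of "\<delta> j" "x j"] pos_mod_bound[of "\<delta> j" "x j"] div_mult_mod_eq[of "x j" "\<delta> j"]
      delta_pos[OF j] unfolding k_def distrib_right by linarith+
  have upper: "x i - (k + 1) * \<delta> i \<le> 0" if "i \<in> I" for i
    using sign[of "k + 1"] div_bounds(2) j that by force
  show ?thesis
  proof (cases "\<forall>i\<in>I. 0 \<le> x i - k * \<delta> i")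
    case True
    then show ?thesis using upper by (intro that[of k]) (auto simp: algebra_simps)
  next
    case False
    then have "\<forall>i\<in>I. x i - k * \<delta> i \<le> 0" using sign by blast
    moreover have "0 < x j - (k - 1) * \<delta> j" using div_bounds(1) delta_pos[OF j] by (simp add: algebra_simps)
    then have "\<forall>i\<in>I. 0 \<le> x i - (k - 1) * \<delta> i" using sign[of "k - 1"] j by force
    ultimately show ?thesis by (intro that[of "k - 1"]) (auto simp: algebra_simps)
  qed
qed

lemma pos_root_delete_le_delta:
  assumes "s \<in> I" "pos_root (I - {s}) x" "i \<in> I - {s}"
  shows "x i \<le> \<delta> i"
proof -
  have "root I (\<lambda>i. (x(s := 0)) i + (- 1) * \<delta> i)"
    using assms(2) unfolding pos_root_def root_def cartan_form_add_delta cartan_form_delete[OF assms(1)] ..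
  then have "(\<forall>i\<in>I. 0 \<le> (x(s := 0)) i - \<delta> i) \<or> (\<forall>i\<in>I. (x(s := 0)) i - \<delta> i \<le> 0)"
    using roots_sign_coherent unfolding roots_sign_coherent_def nonneg_on_def by fastforce
  then have "\<forall>i\<in>I. (x(s := 0)) i - \<delta> i \<le> 0" using assms(1) delta_pos[OF assms(1)] by force
  then show ?thesis using assms(3) by auto
qed

end

subsection \<open>Flip-closed families of positive roots\<close>

context affine_graph begin

lemma finite_type_periodic:
  assumes s: "s \<in> I" and L: "set L = I - {s}" and pos: "\<And>t. pos_root (I - {s}) ((coxeter L ^^ t) x)"
  obtains t h where "0 < h" "(coxeter L ^^ h) ((coxeter L ^^ t) x) = (coxeter L ^^ t) x"
proof -
  let ?J = "I - {s}" and ?X = "\<lambda>t. (coxeter L ^^ t) x"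
  have "finite (PiE ?J (\<lambda>i. {0..\<delta> i}))" using fin by (intro finite_PiE) auto
  moreover have "restrict (?X t) ?J \<in> PiE ?J (\<lambda>i. {0..\<delta> i})" for t
    using pos_root_delete_le_delta[OF s pos] pos_rootD[OF pos] by auto
  ultimately obtain t h where h: "0 < h" "restrict (?X (t + h)) ?J = restrict (?X t) ?J"
    by (rule nat_sequence_repeats[where f = "\<lambda>t. restrict (?X t) ?J"])
  have "?X (t + h) i = ?X t i" for i
    using fun_cong[OF h(2), of i] L by (cases "i \<in> ?J") (auto simp: coxeter_power_outside)
  then have "?X (h + t) = ?X t" by (simp add: fun_eq_iff add.commute)
  then show ?thesis using that[of h t] h(1) by (simp add: funpow_add)
qed

text \<open>The sum over a periodic orbit of positive roots is nonnegative and isotropic, hence zero where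
  the form is definite and a multiple of \<open>\<delta>\<close> on the whole graph.\<close>

lemma finite_type_no_flip_closed:
  assumes s: "s \<in> I" and L: "distinct L" "set L = I - {s}" and P: "flip_closed (I - {s}) P"
    and pos: "\<And>L x. set L = I - {s} \<Longrightarrow> P L x \<Longrightarrow> pos_root (I - {s}) x"
  shows "\<not> P L x"
proof
  assume "P L x"
  have pos_orbit: "pos_root (I - {s}) ((coxeter L ^^ t) x)" for t
    using flip_closed_coxeter_power[of L P x t] pos L P \<open>P L x\<close> by simp
  obtain t h where h: "0 < h" "(coxeter L ^^ h) ((coxeter L ^^ t) x) = (coxeter L ^^ t) x"
    using finite_type_periodic[OF s L(2) pos_orbit] by blast
  define y where "y = (coxeter L ^^ t) x"
  have "cartan_form I ((orbit_sum L h y)(s := 0)) = 0"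
    using cartan_form_orbit_sum[OF L(1) h(2)] cartan_form_delete[OF s] L(2) by (simp add: y_def)
  then have sum_zero: "orbit_sum L h y i = 0" if "i \<in> I - {s}" for i
    using cartan_form_null_proportional[of "(orbit_sum L h y)(s := 0)" i s] s that delta_pos[OF s] by auto
  have "y i = 0" if i: "i \<in> I - {s}" for i
  proof -
    have "0 \<le> (coxeter L ^^ r) y i" for r
      using pos_rootD[OF pos_orbit[of "r + t"] i] by (simp add: y_def funpow_add)
    then have "(coxeter L ^^ 0) y i = 0"
      using sum_nonneg_0[of "{..<h}" "\<lambda>t. (coxeter L ^^ t) y i" 0] sum_zero[OF i] h(1)
      by (simp add: orbit_sum_def)
    then show ?thesis by simp
  qed
  then have "cartan_form (I - {s}) y = 0" by (simp add: cartan_form_def)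
  then show False using pos_orbit[of t] by (simp add: y_def pos_root_def root_def)
qed

lemma affine_periodic_modulo_delta:
  assumes L: "set L = I" and roots: "\<And>t. root I ((coxeter L ^^ t) x)"
  obtains t h k where "0 < h" "(coxeter L ^^ h) ((coxeter L ^^ t) x) = (\<lambda>i. (coxeter L ^^ t) x i + k * \<delta> i)"
proof -
  let ?X = "\<lambda>t. (coxeter L ^^ t) x"
  have "\<exists>k. \<forall>i\<in>I. 0 \<le> ?X t i - k * \<delta> i \<and> ?X t i - k * \<delta> i \<le> \<delta> i" for t
    by (rule root_between_delta_multiples[OF roots]) blast
  then have "\<exists>K. \<forall>t. \<forall>i\<in>I. 0 \<le> ?X t i - K t * \<delta> i \<and> ?X t i - K t * \<delta> i \<le> \<delta> i"
    by (intro choice allI)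
  then obtain K where K: "0 \<le> ?X t i - K t * \<delta> i \<and> ?X t i - K t * \<delta> i \<le> \<delta> i" if "i \<in> I" for t i
    by blast
  let ?Y = "\<lambda>t. restrict (\<lambda>i. ?X t i - K t * \<delta> i) I"
  have "finite (PiE I (\<lambda>i. {0..\<delta> i}))" using fin by (intro finite_PiE) auto
  moreover have "?Y t \<in> PiE I (\<lambda>i. {0..\<delta> i})" for t using K by auto
  ultimately obtain t h where h: "0 < h" "?Y (t + h) = ?Y t"
    by (rule nat_sequence_repeats[where f = ?Y])
  have "?X (t + h) i = ?X t i + (K (t + h) - K t) * \<delta> i" for i
  proof (cases "i \<in> I")
    case True
    then show ?thesis using fun_cong[OF h(2), of i] by (simp add: algebra_simps)
  next
    case False
    then show ?thesis using L by (simp add: coxeter_power_outside delta_out)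
  qed
  then have "?X (h + t) = (\<lambda>i. ?X t i + (K (t + h) - K t) * \<delta> i)" by (simp add: fun_eq_iff add.commute)
  then show ?thesis using that[of h t] h(1) by (simp add: funpow_add)
qed

lemma affine_period_nonneg:
  assumes L: "set L = I" and shift: "(coxeter L ^^ h) y = (\<lambda>i. y i + k * \<delta> i)"
    and pos: "\<And>t. nonneg_on I ((coxeter L ^^ t) y)"
  shows "0 \<le> k"
proof -
  obtain j where j: "j \<in> I" using nonempty by blast
  have "0 \<le> k * \<delta> j"
  proof (rule nonneg_if_multiples_bounded_below)
    fix m :: nat
    have "(coxeter L ^^ (m * h)) y = (\<lambda>i. y i + int m * k * \<delta> i)"
      using coxeter_add_scaled[of L _ _ \<delta>] coxeter_delta[OF L] by (intro funpow_translate shift) simp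
    then show "0 \<le> y j + int m * (k * \<delta> j)" using pos[of "m * h"] j by (simp add: nonneg_on_def mult.assoc)
  qed
  then show ?thesis using delta_pos[OF j] by (simp add: zero_le_mult_iff)
qed

lemma periodic_orbit_regular:
  assumes L: "distinct L" "set L = I" and h: "0 < h" "(coxeter L ^^ h) y = y"
  shows "euler L \<delta> y = 0"
proof -
  let ?u = "orbit_sum L h y"
  obtain j where j: "j \<in> I" using nonempty by blast
  have null: "cartan_form I ?u = 0" using cartan_form_orbit_sum[OF L(1) h(2)] L(2) by simp
  have "\<delta> j * euler L \<delta> ?u = euler L \<delta> (\<lambda>i. \<delta> j * ?u i)" by (simp add: euler_scale_right)
  also have "\<dots> = euler L \<delta> (\<lambda>i. ?u j * \<delta> i)"
    using cartan_form_null_proportional[OF null _ j] L(2) by (intro euler_cong) (simp_all add: mult.commute)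
  also have "\<dots> = 0" using euler_delta_delta[OF L] by (simp add: euler_scale_right)
  finally have "euler L \<delta> ?u = 0" using delta_pos[OF j] by simp
  moreover have "euler L \<delta> ?u = int h * euler L \<delta> y"
    using L by (simp add: orbit_sum_def euler_sum_right euler_delta_coxeter_power)
  ultimately show ?thesis using h(1) by simp
qed

lemma flip_closed_regular:
  assumes L: "distinct L" "set L = I" and P: "flip_closed I P"
    and pos: "\<And>L x. set L = I \<Longrightarrow> P L x \<Longrightarrow> pos_root I x" and x: "P L x"
  shows "euler L \<delta> x = 0"
proof -
  have P_orbit: "P L ((coxeter L ^^ t) x)" for t
    using flip_closed_coxeter_power[of L P] L P x by simp
  have "root I ((coxeter L ^^ t) x)" for t using pos[OF L(2) P_orbit] by (simp add: pos_root_def)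
  then obtain t h k where h: "0 < h"
    and shift: "(coxeter L ^^ h) ((coxeter L ^^ t) x) = (\<lambda>i. (coxeter L ^^ t) x i + k * \<delta> i)"
    using affine_periodic_modulo_delta[OF L(2)] by metis
  define y where "y = (coxeter L ^^ t) x"
  have Py: "P L y" using P_orbit by (simp add: y_def)
  have "nonneg_on I ((coxeter L ^^ r) y)" for r
    using pos[OF L(2) flip_closed_coxeter_power[of L P y r]] Py L P by (simp add: pos_root_def)
  then have "0 \<le> k" using affine_period_nonneg[OF L(2)] shift by (simp add: y_def)
  moreover have "0 \<le> - k"
  proof (rule affine_period_nonneg[of "rev L"])
    show "nonneg_on I ((coxeter (rev L) ^^ r) y)" for r
      using pos[OF L(2) flip_closed_coxeter_rev_power[of L P y r]] Py L P by (simp add: pos_root_def)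
    have "(coxeter (rev L) ^^ h) (\<lambda>i. z i + c * \<delta> i) = (\<lambda>i. (coxeter (rev L) ^^ h) z i + c * \<delta> i)" for z c
      using L coxeter_add_scaled[of "rev L" _ _ \<delta>] coxeter_delta[of "rev L"] by (induction h) simp_all
    from this[of y k] have "y = (\<lambda>i. (coxeter (rev L) ^^ h) y i + k * \<delta> i)"
      using coxeter_rev_power[of h L y] shift by (simp add: y_def)
    from fun_cong[OF this] show "(coxeter (rev L) ^^ h) y = (\<lambda>i. y i + - k * \<delta> i)"
      by (simp add: fun_eq_iff)
  qed (use L in simp)
  ultimately have "(coxeter L ^^ h) y = y" using shift by (simp add: y_def)
  then have "euler L \<delta> y = 0" using periodic_orbit_regular[OF L h] by blast
  then show ?thesis using euler_delta_coxeter_power[OF L] by (simp add: y_def)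
qed

end

section \<open>Compatible roots\<close>

context weighted_graph begin

text \<open>Reading a positive root as the dimension vector of a brick and a negative root as that of a shifted
  brick, this is the numerical shadow of the absence of nonzero maps in one direction.\<close>

definition hom_free :: "'v list \<Rightarrow> ('v \<Rightarrow> int) \<Rightarrow> ('v \<Rightarrow> int) \<Rightarrow> bool" where
  "hom_free L x y \<longleftrightarrow>
     (if nonneg_on (set L) x = nonneg_on (set L) y then euler L x y \<le> 0
      else nonneg_on (set L) y \<longrightarrow> euler L x y = 0)"

definition compatible :: "'v list \<Rightarrow> ('v \<Rightarrow> int) \<Rightarrow> ('v \<Rightarrow> int) \<Rightarrow> bool" where
  "compatible L x y \<longleftrightarrow> hom_free L x y \<and> hom_free L y x \<and> euler L x y * euler L y x = 0"

lemma compatible_commute: "compatible L x y \<longleftrightarrow> compatible L y x"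
  by (auto simp: compatible_def mult.commute)

lemma hom_free_rev:
  assumes "distinct L" "roots_sign_coherent (set L)" "root (set L) x" "root (set L) y"
  shows "hom_free (rev L) (- x) (- y) \<longleftrightarrow> hom_free L y x"
  using assms by (auto simp: hom_free_def euler_rev nonneg_uminus_iff)

lemma compatible_rev:
  assumes "distinct L" "roots_sign_coherent (set L)" "root (set L) x" "root (set L) y"
  shows "compatible (rev L) (- x) (- y) \<longleftrightarrow> compatible L x y"
  using assms by (auto simp: compatible_def hom_free_rev euler_rev mult.commute)

lemma compatible_flip:
  assumes L: "distinct L" "roots_sign_coherent (set L)" "flip s L L'"
    and x: "root (set L) x" "\<not> simple_root (set L) s x" "\<not> simple_root (set L) s (- x)"
    and y: "root (set L) y" "\<not> simple_root (set L) s y" "\<not> simple_root (set L) s (- y)"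
    and c: "compatible L x y"
  shows "compatible L' (reflect (set L) s x) (reflect (set L) s y)"
proof -
  have "nonneg_on (set L) (reflect (set L) s x) = nonneg_on (set L) x"
    "nonneg_on (set L) (reflect (set L) s y) = nonneg_on (set L) y"
    using nonneg_reflect_iff[OF _ L(2) flip_mem[OF L(3)]] x y by simp_all
  then show ?thesis
    using c L(3) unfolding compatible_def hom_free_def by (simp add: euler_flip[OF L(1,3)])
qed

lemma pos_root_euler_simple_first:
  assumes "distinct (s # L)" "roots_sign_coherent (set (s # L))" "simple_root (set (s # L)) s z"
    "pos_root (set (s # L)) x" "\<not> simple_root (set (s # L)) s x"
  shows "euler (s # L) x z \<le> 0"
  using pos_rootD[OF pos_root_reflect[OF _ assms(2) _ assms(4,5)], of s] euler_simple_first(2)[OF assms(1,3)]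
  by (simp del: euler.simps)

lemma pos_root_euler_simple_last:
  assumes "distinct (L @ [s])" "roots_sign_coherent (set (L @ [s]))" "simple_root (set (L @ [s])) s z"
    "pos_root (set (L @ [s])) x" "\<not> simple_root (set (L @ [s])) s x"
  shows "euler (L @ [s]) z x \<le> 0"
  using pos_rootD[OF pos_root_reflect[OF _ assms(2) _ assms(4,5)], of s] euler_simple_last(2)[OF assms(1,3)]
  by simp

lemma compatible_simple_first:
  assumes L: "distinct (s # M)" "roots_sign_coherent (set (s # M))" and x: "pos_root (set (s # M)) x"
    and z: "simple_root (set (s # M)) s z"
  shows "compatible (s # M) z x \<Longrightarrow> x s = 0"
    "compatible (s # M) z (- x) \<Longrightarrow> reflect (set (s # M)) s x s = 0"
    "compatible (s # M) (- z) x \<Longrightarrow> x s = 0"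
    "compatible (s # M) (- z) (- x) \<Longrightarrow> x s = 0"
proof -
  let ?J = "set (s # M)"
  have products: "euler (s # M) z x = x s" "euler (s # M) x z = - reflect ?J s x s"
    using euler_simple_first[OF L(1) z] by blast+
  have zn: "nonneg_on ?J z" "\<not> nonneg_on ?J (- z)"
    using simple_root_nonneg[OF z] simple_root_self[OF z] by (auto simp: nonneg_on_def)
  have xn: "nonneg_on ?J x" "\<not> nonneg_on ?J (- x)" "0 \<le> x s"
    using x root_not_both_signs pos_rootD[OF x, of s] by (auto simp: pos_root_def)
  note defs = compatible_def hom_free_def
  show "x s = 0" if "compatible (s # M) z x"
    using that zn xn products unfolding defs by (simp del: euler.simps)
  show "reflect ?J s x s = 0" if "compatible (s # M) z (- x)"
    using that zn xn products unfolding defs by (simp del: euler.simps)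
  show "x s = 0" if "compatible (s # M) (- z) x"
    using that zn xn products unfolding defs by (simp del: euler.simps)
  show "x s = 0" if "compatible (s # M) (- z) (- x)"
    using that zn xn products unfolding defs by (simp del: euler.simps)
qed

lemma compatible_simple_last:
  assumes L: "distinct (M @ [s])" "roots_sign_coherent (set (M @ [s]))" and x: "pos_root (set (M @ [s])) x"
    and z: "simple_root (set (M @ [s])) s z" "root (set (M @ [s])) z"
  shows "compatible (M @ [s]) z x \<Longrightarrow> x s = 0"
    "compatible (M @ [s]) z (- x) \<Longrightarrow> x s = 0"
    "compatible (M @ [s]) (- z) x \<Longrightarrow> reflect (set (M @ [s])) s x s = 0"
    "compatible (M @ [s]) (- z) (- x) \<Longrightarrow> x s = 0"
proof -
  let ?L = "M @ [s]"
  have L': "distinct (s # rev M)" "set (s # rev M) = set ?L" "rev ?L = s # rev M" using L(1) by auto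
  have xr: "root (set ?L) x" using x by (simp add: pos_root_def)
  note dual = compatible_rev[OF L, unfolded L'(3)]
  note first = compatible_simple_first[OF L'(1), unfolded L'(2), OF L(2) x z(1)]
  show "x s = 0" if "compatible ?L z x"
    using first(4) dual[OF z(2) xr] that by simp
  show "x s = 0" if "compatible ?L z (- x)"
    using first(3) dual[OF z(2), of "- x"] xr that by simp
  show "reflect (set ?L) s x s = 0" if "compatible ?L (- z) x"
    using first(2) dual[of "- z" x] z(2) xr that by simp
  show "x s = 0" if "compatible ?L (- z) (- x)"
    using first(1) dual[of "- z" "- x"] z(2) xr that by simp
qed

end

context affine_graph begin

lemma regular_not_simple_root:
  assumes L: "distinct L" "set L = I" "flip s L L'" and x: "euler L \<delta> x = 0"
  shows "\<not> simple_root I s x" "\<not> simple_root I s (- x)"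
proof -
  have s: "s \<in> I" using flip_mem[OF L(3)] L(2) by simp
  have "euler L \<delta> z \<noteq> 0" if z: "simple_root I s z" for z
  proof -
    obtain M where "L = s # M \<or> L = M @ [s]" using L(3) by (auto simp: flip_def)
    then show ?thesis
    proof
      assume "L = s # M"
      then show ?thesis
        using euler_simple_first(2)[of s M z \<delta>] L z delta_pos[OF s] s by (simp del: euler.simps)
    next
      assume "L = M @ [s]"
      then show ?thesis using euler_simple_last(1)[of M s z \<delta>] L z delta_pos[OF s] by simp
    qed
  qed
  from this[of x] this[of "- x"] x show "\<not> simple_root I s x" "\<not> simple_root I s (- x)" by auto
qed

lemma flip_closed_without_simple_regular:
  assumes roots: "\<And>L w. distinct L \<Longrightarrow> set L = I \<Longrightarrow> Q L w \<Longrightarrow> root I w"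
    and step: "\<And>L s L' w. distinct L \<Longrightarrow> set L = I \<Longrightarrow> flip s L L' \<Longrightarrow> Q L w \<Longrightarrow>
      Q L' (reflect I s w) \<and> \<not> simple_root I s w \<and> \<not> simple_root I s (- w)"
    and L: "distinct L" "set L = I" and w: "Q L w"
  shows "euler L \<delta> w = 0"
proof -
  define P where "P L' x \<longleftrightarrow> distinct L' \<and> nonneg_on I x \<and> (Q L' x \<or> Q L' (- x))" for L' x
  have "flip_closed I P"
    unfolding flip_closed_def
  proof (intro allI impI)
    fix L' s L'' x assume L': "distinct L'" "set L' = I" "flip s L' L''" and Px: "P L' x"
    have "root I x" using Px roots[OF L'(1,2), of x] roots[OF L'(1,2), of "- x"] by (auto simp: P_def)
    moreover have "Q L'' (reflect I s x) \<or> Q L'' (reflect I s (- x))" "\<not> simple_root I s x"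
      "\<not> simple_root I s (- x)"
      using Px step[OF L', of x] step[OF L', of "- x"] by (auto simp: P_def)
    moreover have "nonneg_on I x" "s \<in> I" using Px flip_mem[OF L'(3)] L'(2) by (auto simp: P_def)
    ultimately show "P L'' (reflect I s x)"
      using nonneg_reflect_iff[OF fin roots_sign_coherent, of s x] flip_distinct[OF L'(3)] L'(1)
      by (simp add: P_def reflect_uminus)
  qed
  moreover have "pos_root I x" if "set L' = I" "P L' x" for L' x
    using that roots[of L' x] roots[of L' "- x"] by (auto simp: P_def pos_root_def)
  ultimately have regular: "P L x \<Longrightarrow> euler L \<delta> x = 0" for x
    using flip_closed_regular[OF L, of P] by blast
  have "nonneg_on I w \<or> nonneg_on I (- w)"
    using roots_sign_coherent roots[OF L w] unfolding roots_sign_coherent_def by blast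
  then have "P L w \<or> P L (- w)" using L(1) w by (auto simp: P_def)
  then show ?thesis using regular[of w] regular[of "- w"] by auto
qed

text \<open>Reflecting repeatedly moves a root that is not orthogonal to \<open>\<delta>\<close>, together with any family
  of roots compatible with it, to a simple root at an end of the enumeration.\<close>

lemma nonregular_root_becomes_simple:
  assumes L: "distinct L" "set L = I" and w: "Q L w" "euler L \<delta> w \<noteq> 0"
    and roots: "\<And>L w. distinct L \<Longrightarrow> set L = I \<Longrightarrow> Q L w \<Longrightarrow> root I w"
    and step: "\<And>L s L' w. distinct L \<Longrightarrow> set L = I \<Longrightarrow> flip s L L' \<Longrightarrow> Q L w \<Longrightarrow>
      \<not> simple_root I s w \<Longrightarrow> \<not> simple_root I s (- w) \<Longrightarrow> Q L' (reflect I s w)"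
  obtains L' s L'' z
    where "distinct L'" "set L' = I" "flip s L' L''" "simple_root I s z" "root I z" "Q L' z \<or> Q L' (- z)"
proof -
  have "\<exists>L' s L'' w. distinct L' \<and> set L' = I \<and> flip s L' L'' \<and> Q L' w \<and>
      (simple_root I s w \<or> simple_root I s (- w))"
  proof (rule ccontr)
    assume none: "\<not> ?thesis"
    have "euler L \<delta> w = 0"
    proof (rule flip_closed_without_simple_regular[of Q, OF roots _ L w(1)])
      fix L s L' w assume L: "distinct L" "set L = I" "flip s L L'" and Qw: "Q L w"
      then have "\<not> simple_root I s w \<and> \<not> simple_root I s (- w)" using none by blast
      then show "Q L' (reflect I s w) \<and> \<not> simple_root I s w \<and> \<not> simple_root I s (- w)"
        using step[OF L Qw] by blast
    qed
    then show False using w(2) by blast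
  qed
  then obtain L' s L'' w where L': "distinct L'" "set L' = I" "flip s L' L''" "Q L' w"
    and simple: "simple_root I s w \<or> simple_root I s (- w)" by blast
  from simple show thesis
  proof
    assume "simple_root I s w"
    then show thesis using that[OF L'(1-3)] roots[OF L'(1,2,4)] L'(4) by blast
  next
    assume "simple_root I s (- w)"
    then show thesis using that[OF L'(1-3), of "- w"] roots[OF L'(1,2,4)] L'(4) by simp
  qed
qed

end

section \<open>Forbidden configurations of roots\<close>

context weighted_graph begin

text \<open>When a mutation replaces a negative root \<open>x\<close> by \<open>x + m k\<close>, the new root is either positive (put \<open>g = - x\<close>,
  \<open>h = x + m k\<close>: the first configuration) or negative (put \<open>h = - (x + m k)\<close>: the second one). The root
  \<open>r\<close> witnesses that compatibility is violated.\<close>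

definition overshoot :: "int \<Rightarrow> 'v list \<Rightarrow> ('v \<Rightarrow> int) \<Rightarrow> ('v \<Rightarrow> int) \<Rightarrow> ('v \<Rightarrow> int) \<Rightarrow> ('v \<Rightarrow> int) \<Rightarrow> bool" where
  "overshoot m L k g h r \<longleftrightarrow> 0 < m \<and> (\<forall>x\<in>{k, g, h, r}. pos_root (set L) x) \<and>
     (\<forall>i\<in>set L. m * k i = g i + h i) \<and> euler L k g = m \<and> euler L g k = 0 \<and>
     euler L r k \<le> 0 \<and> 0 < euler L r h"

definition undershoot :: "int \<Rightarrow> 'v list \<Rightarrow> ('v \<Rightarrow> int) \<Rightarrow> ('v \<Rightarrow> int) \<Rightarrow> ('v \<Rightarrow> int) \<Rightarrow> ('v \<Rightarrow> int) \<Rightarrow> bool" where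
  "undershoot m L k g h r \<longleftrightarrow> 0 < m \<and> (\<forall>x\<in>{k, g, h, r}. pos_root (set L) x) \<and>
     (\<forall>i\<in>set L. g i = h i + m * k i) \<and> euler L k g = m \<and> euler L g k = 0 \<and>
     euler L g r \<le> 0 \<and> 0 < euler L h r"

definition negative_cycle :: "'v list \<Rightarrow> ('v \<Rightarrow> int) \<Rightarrow> ('v \<Rightarrow> int) \<Rightarrow> ('v \<Rightarrow> int) \<Rightarrow> bool" where
  "negative_cycle L x y z \<longleftrightarrow> (\<forall>u\<in>{x, y, z}. pos_root (set L) u) \<and>
     euler L x y < 0 \<and> euler L y z < 0 \<and> euler L z x < 0"

lemma overshootD:
  assumes "overshoot m L k g h r"
  shows "0 < m" "euler L k g = m" "euler L g k = 0" "euler L r k \<le> 0" "0 < euler L r h"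
    "\<And>x. x \<in> {k, g, h, r} \<Longrightarrow> pos_root (set L) x" "\<And>i. i \<in> set L \<Longrightarrow> h i = - g i + m * k i"
    "\<And>x. euler L x h = - euler L x g + m * euler L x k"
proof -
  show relation: "h i = - g i + m * k i" if "i \<in> set L" for i
    using assms that by (simp add: overshoot_def)
  have "euler L x h = euler L x (\<lambda>i. (- g) i + m * k i)" for x
    using relation by (intro euler_cong) simp_all
  then show "euler L x h = - euler L x g + m * euler L x k" for x
    unfolding euler_add_scaled_right euler_uminus_right .
qed (use assms in \<open>unfold overshoot_def, blast\<close>)+

lemma undershootD:
  assumes "undershoot m L k g h r"
  shows "0 < m" "euler L k g = m" "euler L g k = 0" "euler L g r \<le> 0" "0 < euler L h r"
    "\<And>x. x \<in> {k, g, h, r} \<Longrightarrow> pos_root (set L) x" "\<And>i. i \<in> set L \<Longrightarrow> g i = h i + m * k i"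
    "\<And>x. euler L g x = euler L h x + m * euler L k x"
proof -
  show relation: "g i = h i + m * k i" if "i \<in> set L" for i
    using assms that by (simp add: undershoot_def)
  have "euler L g x = euler L (\<lambda>i. h i + m * k i) x" for x
    using relation by (intro euler_cong) simp_all
  then show "euler L g x = euler L h x + m * euler L k x" for x
    unfolding euler_add_scaled_left .
qed (use assms in \<open>unfold undershoot_def, blast\<close>)+

subsection \<open>No simple roots at the ends\<close>

lemma pos_root_dominated_by_simple:
  assumes "finite J" "s \<in> J" "simple_root J s x" "pos_root J y" "0 < m"
    and "\<And>i. i \<in> J \<Longrightarrow> i \<noteq> s \<Longrightarrow> 0 \<le> m * x i - y i"
  shows "simple_root J s y"
proof (rule pos_root_supported_at)
  show "y i = 0" if "i \<in> J" "i \<noteq> s" for i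
    using assms(6)[OF that] simple_root_other[OF assms(3) that] pos_rootD[OF assms(4) that(1)] by simp
qed (use assms in auto)

lemma overshoot_not_simple_first:
  assumes L: "distinct (s # M)" "roots_sign_coherent (set (s # M))" and config: "overshoot m (s # M) k g h r"
    and x: "x \<in> {k, g, h, r}"
  shows "\<not> simple_root (set (s # M)) s x"
proof -
  let ?J = "set (s # M)"
  note configD = overshootD[OF config]
  have nonneg: "0 \<le> u i" if "u \<in> {k, g, h, r}" "i \<in> ?J" for u i
    using pos_rootD[OF configD(6)[OF that(1)] that(2)] .
  note left = euler_simple_first(1)[OF L(1)] and right = pos_root_euler_simple_first[OF L]
  have r: "\<not> simple_root ?J s r"
  proof
    assume "simple_root ?J s r"
    then have "k s \<le> 0" "0 < h s" using configD(4,5) by (simp_all only: left)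
    then have "m * k s \<le> 0" using configD(1) by (simp add: mult_le_0_iff)
    then show False using configD(7)[of s] nonneg[of g s] \<open>0 < h s\<close> by simp
  qed
  have h: "\<not> simple_root ?J s h"
    using right[of h r] configD(5) configD(6)[of r] r by (auto simp del: euler.simps)
  have k: "\<not> simple_root ?J s k"
  proof
    assume k: "simple_root ?J s k"
    have "simple_root ?J s h"
      by (rule pos_root_dominated_by_simple[OF _ _ k _ configD(1)]) (use configD(6,7) nonneg[of g] in auto)
    then show False using h by blast
  qed
  have "\<not> simple_root ?J s g"
    using right[of g k] configD(1,2) configD(6)[of k] k by (auto simp del: euler.simps)
  then show ?thesis using r h k x by blast
qed

lemma overshoot_not_simple_last:
  assumes L: "distinct (M @ [s])" "roots_sign_coherent (set (M @ [s]))"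
    and config: "overshoot m (M @ [s]) k g h r"
    and x: "x \<in> {k, g, h, r}"
  shows "\<not> simple_root (set (M @ [s])) s x"
proof -
  let ?L = "M @ [s]" and ?J = "set (M @ [s])"
  note configD = overshootD[OF config]
  have nonneg: "0 \<le> u i" if "u \<in> {k, g, h, r}" "i \<in> ?J" for u i
    using pos_rootD[OF configD(6)[OF that(1)] that(2)] .
  note right = euler_simple_last(1)[OF L(1)] and left = pos_root_euler_simple_last[OF L]
  have g: "\<not> simple_root ?J s g"
  proof
    assume "simple_root ?J s g"
    then have "0 \<le> euler ?L r g" using nonneg[of r s] by (simp add: right)
    moreover have "m * euler ?L r k \<le> 0" using configD(1,4) by (simp add: mult_le_0_iff)
    ultimately show False using configD(5) configD(8)[of r] by simp
  qed
  have h: "\<not> simple_root ?J s h"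
  proof
    assume "simple_root ?J s h"
    then have "0 \<le> euler ?L g h" using nonneg[of g s] by (simp add: right)
    moreover have "euler ?L g g = 1" using configD(6)[of g] root_euler[OF L(1)] by (simp add: pos_root_def)
    ultimately show False using configD(3) configD(8)[of g] by simp
  qed
  have k: "\<not> simple_root ?J s k"
  proof
    assume k: "simple_root ?J s k"
    have "simple_root ?J s h"
      by (rule pos_root_dominated_by_simple[OF _ _ k _ configD(1)]) (use configD(6,7) nonneg[of g] in auto)
    then show False using h by blast
  qed
  have "\<not> simple_root ?J s r" using left[of r h] configD(5) configD(6)[of h] h by auto
  then show ?thesis using g h k x by blast
qed

lemma undershoot_not_simple_first:
  assumes L: "distinct (s # M)" "roots_sign_coherent (set (s # M))" and config: "undershoot m (s # M) k g h r"
    and x: "x \<in> {k, g, h, r}"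
  shows "\<not> simple_root (set (s # M)) s x"
proof -
  let ?L = "s # M" and ?J = "set (s # M)"
  note configD = undershootD[OF config]
  have nonneg: "0 \<le> u i" if "u \<in> {k, g, h, r}" "i \<in> ?J" for u i
    using pos_rootD[OF configD(6)[OF that(1)] that(2)] .
  note left = euler_simple_first(1)[OF L(1)] and right = pos_root_euler_simple_first[OF L]
  have k: "\<not> simple_root ?J s k"
  proof
    assume "simple_root ?J s k"
    then have "0 \<le> m * euler ?L k r" using nonneg[of r s] configD(1) by (simp only: left) simp
    then show False using configD(4,5) configD(8)[of r] by linarith
  qed
  have g: "\<not> simple_root ?J s g"
  proof
    assume g: "simple_root ?J s g"
    have "simple_root ?J s k"
    proof (rule pos_root_dominated_by_simple[OF _ _ g _ zero_less_one])
      fix i assume i: "i \<in> ?J" "i \<noteq> s"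
      have "m * k i \<le> 0" using configD(7)[OF i(1)] simple_root_other[OF g i] nonneg[of h, OF _ i(1)] by simp
      then have "k i = 0" using configD(1) nonneg[of k, OF _ i(1)] by (simp add: mult_le_0_iff)
      then show "0 \<le> 1 * g i - k i" using nonneg[of g, OF _ i(1)] by simp
    qed (use configD(6) in auto)
    then show False using k by blast
  qed
  have h: "\<not> simple_root ?J s h"
  proof
    assume "simple_root ?J s h"
    then have "0 \<le> euler ?L h k" using nonneg[of k s] by (simp only: left) simp
    moreover have "euler ?L k k = 1"
      using configD(6)[of k] root_euler[OF L(1)] by (simp add: pos_root_def del: euler.simps)
    ultimately show False using configD(1,3) configD(8)[of k] by simp
  qed
  have "\<not> simple_root ?J s r" using right[of r h] configD(5) configD(6)[of h] h by (auto simp del: euler.simps)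
  then show ?thesis using g h k x by blast
qed

lemma undershoot_not_simple_last:
  assumes L: "distinct (M @ [s])" "roots_sign_coherent (set (M @ [s]))"
    and config: "undershoot m (M @ [s]) k g h r"
    and x: "x \<in> {k, g, h, r}"
  shows "\<not> simple_root (set (M @ [s])) s x"
proof -
  let ?L = "M @ [s]" and ?J = "set (M @ [s])"
  note configD = undershootD[OF config]
  have nonneg: "0 \<le> u i" if "u \<in> {k, g, h, r}" "i \<in> ?J" for u i
    using pos_rootD[OF configD(6)[OF that(1)] that(2)] .
  note right = euler_simple_last(1)[OF L(1)] and left = pos_root_euler_simple_last[OF L]
  have r: "\<not> simple_root ?J s r"
  proof
    assume "simple_root ?J s r"
    then have "g s \<le> 0" "0 < h s" using configD(4,5) by (simp_all add: right)
    moreover have "0 \<le> m * k s" using nonneg[of k s] configD(1) by simp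
    ultimately show False using configD(7)[of s] by simp
  qed
  have h: "\<not> simple_root ?J s h" using left[of h r] configD(5) configD(6)[of r] r by auto
  have k: "\<not> simple_root ?J s k"
  proof
    assume k: "simple_root ?J s k"
    then have "g s = 0" using configD(3) by (simp add: right)
    moreover have "0 < m * k s" using simple_root_self[OF k] configD(1) by simp
    ultimately show False using configD(7)[of s] nonneg[of h s] by simp
  qed
  have "\<not> simple_root ?J s g"
  proof
    assume g: "simple_root ?J s g"
    have "simple_root ?J s k"
    proof (rule pos_root_dominated_by_simple[OF _ _ g _ zero_less_one])
      fix i assume i: "i \<in> ?J" "i \<noteq> s"
      have "m * k i \<le> 0" using configD(7)[OF i(1)] simple_root_other[OF g i] nonneg[of h, OF _ i(1)] by simp
      then have "k i = 0" using configD(1) nonneg[of k, OF _ i(1)] by (simp add: mult_le_0_iff)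
      then show "0 \<le> 1 * g i - k i" using nonneg[of g, OF _ i(1)] by simp
    qed (use configD(6) in auto)
    then show False using k by blast
  qed
  then show ?thesis using r h k x by blast
qed

lemma negative_cycle_not_simple:
  assumes L: "distinct L" "flip s L L'" and config: "negative_cycle L x y z" and u: "u \<in> {x, y, z}"
  shows "\<not> simple_root (set L) s u"
proof -
  have nonneg: "0 \<le> x s" "0 \<le> y s" "0 \<le> z s"
    using config flip_mem[OF L(2)] unfolding negative_cycle_def by (auto dest: pos_rootD)
  have neg: "euler L x y < 0" "euler L y z < 0" "euler L z x < 0"
    using config by (auto simp: negative_cycle_def)
  obtain M where "L = s # M \<or> L = M @ [s]" using L(2) by (auto simp: flip_def)
  then show ?thesis
  proof
    assume "L = s # M"
    then show ?thesis using u nonneg neg euler_simple_first(1)[of s M] L(1) by (auto simp del: euler.simps)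
  next
    assume "L = M @ [s]"
    then show ?thesis using u nonneg neg euler_simple_last(1)[of M s] L(1) by force
  qed
qed

subsection \<open>Invariance under flips\<close>

lemma overshoot_not_simple:
  assumes "distinct L" "roots_sign_coherent (set L)" "flip s L L'" "overshoot m L k g h r" "x \<in> {k, g, h, r}"
  shows "\<not> simple_root (set L) s x"
  using assms overshoot_not_simple_first[of s _ m k g h r x] overshoot_not_simple_last[of _ s m k g h r x]
  unfolding flip_def by blast

lemma undershoot_not_simple:
  assumes "distinct L" "roots_sign_coherent (set L)" "flip s L L'" "undershoot m L k g h r" "x \<in> {k, g, h, r}"
  shows "\<not> simple_root (set L) s x"
  using assms undershoot_not_simple_first[of s _ m k g h r x] undershoot_not_simple_last[of _ s m k g h r x]
  unfolding flip_def by blast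

lemma overshoot_flip:
  assumes L: "distinct L" "roots_sign_coherent (set L)" "flip s L L'" and config: "overshoot m L k g h r"
  defines "\<rho> \<equiv> reflect (set L) s"
  shows "overshoot m L' (\<rho> k) (\<rho> g) (\<rho> h) (\<rho> r)"
proof -
  note configD = overshootD[OF config]
  have euler_eq: "euler L' (\<rho> x) (\<rho> y) = euler L x y" for x y unfolding \<rho>_def by (rule euler_flip[OF L(1,3)])
  have pos: "pos_root (set L) (\<rho> x)" if "x \<in> {k, g, h, r}" for x
    unfolding \<rho>_def using overshoot_not_simple[OF L config that] configD(6)[OF that] flip_mem[OF L(3)]
    by (intro pos_root_reflect L(2)) auto
  have "\<rho> h i = (- \<rho> g) i + m * \<rho> k i" if "i \<in> set L" for i
    unfolding \<rho>_def reflect_uminus[symmetric] using that configD(7) flip_mem[OF L(3)]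
    by (intro reflect_eq_add_scaled) auto
  then show ?thesis using configD(1-5) pos L(3) by (simp add: overshoot_def euler_eq)
qed

lemma undershoot_flip:
  assumes L: "distinct L" "roots_sign_coherent (set L)" "flip s L L'" and config: "undershoot m L k g h r"
  defines "\<rho> \<equiv> reflect (set L) s"
  shows "undershoot m L' (\<rho> k) (\<rho> g) (\<rho> h) (\<rho> r)"
proof -
  note configD = undershootD[OF config]
  have euler_eq: "euler L' (\<rho> x) (\<rho> y) = euler L x y" for x y unfolding \<rho>_def by (rule euler_flip[OF L(1,3)])
  have pos: "pos_root (set L) (\<rho> x)" if "x \<in> {k, g, h, r}" for x
    unfolding \<rho>_def using undershoot_not_simple[OF L config that] configD(6)[OF that] flip_mem[OF L(3)]
    by (intro pos_root_reflect L(2)) auto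
  have "\<rho> g i = \<rho> h i + m * \<rho> k i" if "i \<in> set L" for i
    unfolding \<rho>_def using that configD(7) flip_mem[OF L(3)] by (intro reflect_eq_add_scaled) auto
  then show ?thesis using configD(1-5) pos L(3) by (simp add: undershoot_def euler_eq)
qed

lemma negative_cycle_flip:
  assumes L: "distinct L" "roots_sign_coherent (set L)" "flip s L L'" and config: "negative_cycle L x y z"
  defines "\<rho> \<equiv> reflect (set L) s"
  shows "negative_cycle L' (\<rho> x) (\<rho> y) (\<rho> z)"
proof -
  have euler_eq: "euler L' (\<rho> x) (\<rho> y) = euler L x y" for x y unfolding \<rho>_def by (rule euler_flip[OF L(1,3)])
  have "pos_root (set L) (\<rho> u)" if "u \<in> {x, y, z}" for u
    unfolding \<rho>_def using negative_cycle_not_simple[OF L(1,3) config that] config that flip_mem[OF L(3)]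
    by (intro pos_root_reflect L(2)) (auto simp: negative_cycle_def)
  then show ?thesis using config L(3) by (simp add: negative_cycle_def euler_eq)
qed

lemma flip_closed_overshoot:
  "roots_sign_coherent J \<Longrightarrow> flip_closed J (\<lambda>L x. \<exists>k g h r. overshoot m L k g h r \<and> x \<in> {k, g, h, r})"
  unfolding flip_closed_def by (blast intro: overshoot_flip)

lemma flip_closed_undershoot:
  "roots_sign_coherent J \<Longrightarrow> flip_closed J (\<lambda>L x. \<exists>k g h r. undershoot m L k g h r \<and> x \<in> {k, g, h, r})"
  unfolding flip_closed_def by (blast intro: undershoot_flip)

lemma flip_closed_negative_cycle:
  "roots_sign_coherent J \<Longrightarrow> flip_closed J (\<lambda>L u. \<exists>x y z. negative_cycle L x y z \<and> u \<in> {x, y, z})"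
  unfolding flip_closed_def by (blast intro: negative_cycle_flip)

subsection \<open>Deleting an end\<close>

lemma pos_root_subset:
  assumes "distinct L" "distinct M" "set M \<subseteq> set L" "euler L x x = euler M x x" "pos_root (set L) x"
  shows "pos_root (set M) x"
  using assms root_euler[OF assms(1)] root_euler[OF assms(2)] by (auto simp: pos_root_def nonneg_on_def)

lemma overshoot_subset:
  assumes config: "overshoot m L k g h r" and L: "distinct L" "distinct M" "set M \<subseteq> set L"
    and euler_eq: "\<And>x y. x \<in> {k, g, h, r} \<Longrightarrow> y \<in> {k, g, h} \<or> x = r \<and> y = r \<Longrightarrow> euler L x y = euler M x y"
  shows "overshoot m M k g h r"
proof -
  note configD = overshootD[OF config]
  have "pos_root (set M) x" if "x \<in> {k, g, h, r}" for x
    by (rule pos_root_subset[OF L euler_eq configD(6)]) (use that in auto)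
  then show ?thesis using configD(1-5,7) L(3) euler_eq[of k g] euler_eq[of g k] euler_eq[of r k] euler_eq[of r h]
    by (auto simp: overshoot_def)
qed

lemma undershoot_subset:
  assumes config: "undershoot m L k g h r" and L: "distinct L" "distinct M" "set M \<subseteq> set L"
    and euler_eq: "\<And>x y. x \<in> {k, g, h, r} \<Longrightarrow> y \<in> {k, g, h, r} \<Longrightarrow> euler L x y = euler M x y"
  shows "undershoot m M k g h r"
proof -
  note configD = undershootD[OF config]
  have "pos_root (set M) x" if "x \<in> {k, g, h, r}" for x
    using pos_root_subset[OF L euler_eq[OF that that] configD(6)[OF that]] .
  then show ?thesis using configD(1-5,7) L(3) euler_eq[of k g] euler_eq[of g k] euler_eq[of g r] euler_eq[of h r]
    by (auto simp: undershoot_def)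
qed

lemma negative_cycle_subset:
  assumes config: "negative_cycle L x y z" and L: "distinct L" "distinct M" "set M \<subseteq> set L"
    and euler_eq: "\<And>u v. u \<in> {x, y, z} \<Longrightarrow> v \<in> {x, y, z} \<Longrightarrow> euler L u v = euler M u v"
  shows "negative_cycle M x y z"
proof -
  have "pos_root (set M) u" if "u \<in> {x, y, z}" for u
    using pos_root_subset[OF L euler_eq[OF that that]] config that by (auto simp: negative_cycle_def)
  then show ?thesis using config euler_eq[of x y] euler_eq[of y z] euler_eq[of z x]
    by (simp add: negative_cycle_def)
qed

lemma nonneg_sum_scaled_eq_0:
  fixes a b m :: int
  assumes "0 \<le> a" "0 \<le> b" "0 < m" "a + m * b = 0"
  shows "a = 0" "b = 0"
proof -
  have "0 \<le> m * b" using assms(2,3) by simp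
  then have "a = 0" "m * b = 0" using assms(1,4) by linarith+
  then show "a = 0" "b = 0" using assms(3) by simp_all
qed

lemma overshoot_delete_first:
  assumes L: "distinct (s # M)" "roots_sign_coherent (set (s # M))" and z: "simple_root (set (s # M)) s z"
    and w: "w = z \<or> w = - z" and config: "overshoot m (s # M) k g h r"
    and k: "compatible (s # M) w k" and r: "compatible (s # M) w r \<or> compatible (s # M) w (- r)"
  shows "overshoot m M k g h r"
proof -
  let ?J = "set (s # M)"
  note configD = overshootD[OF config]
  have pos: "pos_root ?J k" "pos_root ?J r" "0 \<le> g s" "0 \<le> h s" using configD(6) by (auto intro: pos_rootD)
  note simple = compatible_simple_first[OF L _ z]
  have ks: "k s = 0" using w k simple(1,3)[OF pos(1)] by blast
  then have "g s + h s = 0" using configD(7)[of s] by simp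
  then have gh: "g s = 0" "h s = 0" using pos(3,4) by linarith+
  have rs: "reflect ?J s r s * r s = 0" using w r simple[OF pos(2)] by auto
  show ?thesis
  proof (rule overshoot_subset[OF config])
    fix x y assume "x \<in> {k, g, h, r}" "y \<in> {k, g, h} \<or> x = r \<and> y = r"
    then have "reflect ?J s x s * y s = 0" using ks gh rs by auto
    then show "euler (s # M) x y = euler M x y" using euler_first[of s M x y] L(1) by simp
  qed (use L(1) in auto)
qed

lemma overshoot_delete_last:
  assumes L: "distinct (M @ [s])" "roots_sign_coherent (set (M @ [s]))"
    and z: "simple_root (set (M @ [s])) s z" "root (set (M @ [s])) z"
    and w: "w = z \<or> w = - z" and config: "overshoot m (M @ [s]) k g h r"
    and k: "compatible (M @ [s]) w k" and r: "compatible (M @ [s]) w r \<or> compatible (M @ [s]) w (- r)"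
  shows "overshoot m M k g h r"
proof (rule overshoot_subset[OF config])
  let ?J = "set (M @ [s])" and ?\<rho> = "reflect (set (M @ [s])) s"
  note configD = overshootD[OF config]
  have pos: "pos_root ?J k" "pos_root ?J r" "0 \<le> g s" "0 \<le> h s" using configD(6) by (auto intro: pos_rootD)
  note simple = compatible_simple_last[OF L _ z]
  fix x y assume xy: "x \<in> {k, g, h, r}" "y \<in> {k, g, h} \<or> x = r \<and> y = r"
  from w have "x s * ?\<rho> y s = 0"
  proof
    assume wz: "w = z"
    then have "k s = 0" "r s = 0" using k r simple(1)[OF pos(1)] simple(1,2)[OF pos(2)] by auto
    moreover from \<open>k s = 0\<close> have "g s = 0" "h s = 0" using configD(7)[of s] pos(3,4) by auto
    ultimately show ?thesis using xy by auto
  next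
    assume wz: "w = - z"
    then have "?\<rho> k s = 0" using k simple(3)[OF pos(1)] by blast
    have "?\<rho> h s = (- ?\<rho> g) s + m * ?\<rho> k s"
      unfolding reflect_uminus[symmetric] using configD(7) by (intro reflect_eq_add_scaled) auto
    moreover have "0 \<le> ?\<rho> u s" if "u \<in> {k, g, h, r}" for u
      using pos_root_reflect[OF _ L(2) _ configD(6)[OF that] overshoot_not_simple_last[OF L config that]]
      by (intro pos_rootD) auto
    from this[of g] this[of h] have "0 \<le> ?\<rho> g s" "0 \<le> ?\<rho> h s" by simp_all
    ultimately have "?\<rho> k s = 0" "?\<rho> g s = 0" "?\<rho> h s = 0" using \<open>?\<rho> k s = 0\<close> by simp_all
    moreover have "r s * ?\<rho> r s = 0" using wz r simple(3,4)[OF pos(2)] by auto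
    ultimately show ?thesis using xy by auto
  qed
  then show "euler (M @ [s]) x y = euler M x y" using euler_last[OF L(1), of x y] by simp
qed (use L(1) in auto)

lemma overshoot_delete:
  assumes ends: "L = s # M \<or> L = M @ [s]" and L: "distinct L" "roots_sign_coherent (set L)"
    and z: "simple_root (set L) s z" "root (set L) z" and w: "w = z \<or> w = - z"
    and config: "overshoot m L k g h r" and compat: "compatible L w k" "compatible L w r \<or> compatible L w (- r)"
  shows "overshoot m M k g h r"
  using ends
proof
  assume eq: "L = s # M"
  show ?thesis using L z(1) w config compat unfolding eq by (rule overshoot_delete_first)
next
  assume eq: "L = M @ [s]"
  show ?thesis using L z w config compat unfolding eq by (rule overshoot_delete_last)
qed

lemma undershoot_delete_first:
  assumes L: "distinct (s # M)" "roots_sign_coherent (set (s # M))" and z: "simple_root (set (s # M)) s z"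
    and w: "w = z \<or> w = - z" and config: "undershoot m (s # M) k g h r"
    and g: "compatible (s # M) w (- g)" and r: "compatible (s # M) w (- r)"
  shows "undershoot m M k g h r"
proof (rule undershoot_subset[OF config])
  let ?J = "set (s # M)" and ?\<rho> = "reflect (set (s # M)) s"
  note configD = undershootD[OF config]
  have pos: "pos_root ?J g" "pos_root ?J r" "0 \<le> k s" "0 \<le> h s" using configD(6) by (auto intro: pos_rootD)
  note simple = compatible_simple_first[OF L _ z]
  fix x y assume xy: "x \<in> {k, g, h, r}" "y \<in> {k, g, h, r}"
  from w have "?\<rho> x s * y s = 0"
  proof
    assume wz: "w = z"
    then have gr: "?\<rho> g s = 0" "?\<rho> r s = 0" using g r simple(2)[OF pos(1)] simple(2)[OF pos(2)] by auto
    have "?\<rho> g s = ?\<rho> h s + m * ?\<rho> k s" using configD(7) by (intro reflect_eq_add_scaled) auto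
    moreover have "0 \<le> ?\<rho> u s" if "u \<in> {k, g, h, r}" for u
      using pos_root_reflect[OF _ L(2) _ configD(6)[OF that] undershoot_not_simple_first[OF L config that]]
      by (intro pos_rootD) auto
    from this[of h] this[of k] have "0 \<le> ?\<rho> h s" "0 \<le> ?\<rho> k s" by simp_all
    ultimately have "?\<rho> h s = 0" "?\<rho> k s = 0"
      using nonneg_sum_scaled_eq_0[of "?\<rho> h s" "?\<rho> k s" m] configD(1) gr(1) by simp_all
    then show ?thesis using xy gr by auto
  next
    assume wz: "w = - z"
    then have gr: "g s = 0" "r s = 0" using g r simple(4)[OF pos(1)] simple(4)[OF pos(2)] by auto
    then have "h s = 0" "k s = 0"
      using nonneg_sum_scaled_eq_0[of "h s" "k s" m] pos(3,4) configD(1) configD(7)[of s] by simp_all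
    then show ?thesis using xy gr by auto
  qed
  then show "euler (s # M) x y = euler M x y" using euler_first[of s M x y] L(1) by simp
qed (use L(1) in auto)

lemma undershoot_delete_last:
  assumes L: "distinct (M @ [s])" "roots_sign_coherent (set (M @ [s]))"
    and z: "simple_root (set (M @ [s])) s z" "root (set (M @ [s])) z"
    and w: "w = z \<or> w = - z" and config: "undershoot m (M @ [s]) k g h r"
    and g: "compatible (M @ [s]) w (- g)" and r: "compatible (M @ [s]) w (- r)"
  shows "undershoot m M k g h r"
proof (rule undershoot_subset[OF config])
  note configD = undershootD[OF config]
  have pos: "pos_root (set (M @ [s])) g" "pos_root (set (M @ [s])) r" "0 \<le> k s" "0 \<le> h s"
    using configD(6) by (auto intro: pos_rootD)
  note simple = compatible_simple_last[OF L _ z]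
  have gr: "g s = 0" "r s = 0" using w g r simple(2,4)[OF pos(1)] simple(2,4)[OF pos(2)] by auto
  then have "h s = 0" "k s = 0"
    using nonneg_sum_scaled_eq_0[of "h s" "k s" m] pos(3,4) configD(1) configD(7)[of s] by simp_all
  then show "euler (M @ [s]) x y = euler M x y" if "x \<in> {k, g, h, r}" for x y
    using that gr euler_last[OF L(1), of x y] by auto
qed (use L(1) in auto)

lemma undershoot_delete:
  assumes ends: "L = s # M \<or> L = M @ [s]" and L: "distinct L" "roots_sign_coherent (set L)"
    and z: "simple_root (set L) s z" "root (set L) z" and w: "w = z \<or> w = - z"
    and config: "undershoot m L k g h r" and compat: "compatible L w (- g)" "compatible L w (- r)"
  shows "undershoot m M k g h r"
  using ends
proof
  assume eq: "L = s # M"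
  show ?thesis using L z(1) w config compat unfolding eq by (rule undershoot_delete_first)
next
  assume eq: "L = M @ [s]"
  show ?thesis using L z w config compat unfolding eq by (rule undershoot_delete_last)
qed

lemma negative_cycle_delete_first:
  assumes L: "distinct (s # M)" "roots_sign_coherent (set (s # M))" and z: "simple_root (set (s # M)) s z'"
    and w: "w = z' \<or> w = - z'" and config: "negative_cycle (s # M) x y z"
    and compat: "\<And>u. u \<in> {x, y, z} \<Longrightarrow> compatible (s # M) w u"
  shows "negative_cycle M x y z"
proof (rule negative_cycle_subset[OF config])
  have "v s = 0" if v: "v \<in> {x, y, z}" for v
  proof -
    have "pos_root (set (s # M)) v" using config v by (auto simp: negative_cycle_def)
    then show ?thesis using w compat[OF v] compatible_simple_first(1,3)[OF L _ z] by auto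
  qed
  then show "euler (s # M) u v = euler M u v" if "v \<in> {x, y, z}" for u v
    using that L(1) euler_first[of s M u v] by simp
qed (use L(1) in auto)

lemma negative_cycle_delete_last:
  assumes L: "distinct (M @ [s])" "roots_sign_coherent (set (M @ [s]))"
    and z: "simple_root (set (M @ [s])) s z'" "root (set (M @ [s])) z'"
    and w: "w = z' \<or> w = - z'" and config: "negative_cycle (M @ [s]) x y z"
    and compat: "\<And>u. u \<in> {x, y, z} \<Longrightarrow> compatible (M @ [s]) w u"
  shows "negative_cycle M x y z"
proof (rule negative_cycle_subset[OF config])
  fix u v assume uv: "u \<in> {x, y, z}" "v \<in> {x, y, z}"
  then have "pos_root (set (M @ [s])) u" "pos_root (set (M @ [s])) v"
    using config by (auto simp: negative_cycle_def)
  then have "u s * reflect (set (M @ [s])) s v s = 0"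
    using w compat[OF uv(1)] compat[OF uv(2)] compatible_simple_last(1,3)[OF L _ z] by auto
  then show "euler (M @ [s]) u v = euler M u v" using euler_last[OF L(1), of u v] by simp
qed (use L(1) in auto)

lemma negative_cycle_delete:
  assumes ends: "L = s # M \<or> L = M @ [s]" and L: "distinct L" "roots_sign_coherent (set L)"
    and z: "simple_root (set L) s z'" "root (set L) z'" and w: "w = z' \<or> w = - z'"
    and config: "negative_cycle L x y z" and compat: "\<And>u. u \<in> {x, y, z} \<Longrightarrow> compatible L w u"
  shows "negative_cycle M x y z"
  using ends
proof
  assume eq: "L = s # M"
  show ?thesis using L z(1) w config compat unfolding eq by (rule negative_cycle_delete_first)
next
  assume eq: "L = M @ [s]"
  show ?thesis using L z w config compat unfolding eq by (rule negative_cycle_delete_last)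
qed

end

subsection \<open>Exclusion in the presence of a nonregular root\<close>

context affine_graph begin

lemma finite_type_no_overshoot:
  assumes "s \<in> I" "distinct M" "set M = I - {s}"
  shows "\<not> overshoot m M k g h r"
proof -
  have "\<not> (\<exists>k' g h r. overshoot m M k' g h r \<and> k \<in> {k', g, h, r})"
    using flip_closed_overshoot[OF roots_sign_coherent_delete[OF assms(1)]]
    by (rule finite_type_no_flip_closed[OF assms])
       (metis overshootD(6))
  then show ?thesis by blast
qed

lemma finite_type_no_undershoot:
  assumes "s \<in> I" "distinct M" "set M = I - {s}"
  shows "\<not> undershoot m M k g h r"
proof -
  have "\<not> (\<exists>k' g h r. undershoot m M k' g h r \<and> k \<in> {k', g, h, r})"
    using flip_closed_undershoot[OF roots_sign_coherent_delete[OF assms(1)]]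
    by (rule finite_type_no_flip_closed[OF assms])
       (metis undershootD(6))
  then show ?thesis by blast
qed

lemma finite_type_no_negative_cycle:
  assumes "s \<in> I" "distinct M" "set M = I - {s}"
  shows "\<not> negative_cycle M x y z"
proof -
  have "\<not> (\<exists>x' y z. negative_cycle M x' y z \<and> x \<in> {x', y, z})"
    using flip_closed_negative_cycle[OF roots_sign_coherent_delete[OF assms(1)]]
    by (rule finite_type_no_flip_closed[OF assms])
       (metis negative_cycle_def)
  then show ?thesis by blast
qed

lemma overshoot_regular:
  assumes "distinct L" "set L = I" "overshoot m L k g h r" "x \<in> {k, g, h, r}"
  shows "euler L \<delta> x = 0"
proof (rule flip_closed_regular[OF assms(1,2) flip_closed_overshoot[OF roots_sign_coherent]])
  show "\<exists>k g h r. overshoot m L k g h r \<and> x \<in> {k, g, h, r}" using assms(3,4) by blast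
qed (metis overshootD(6))

lemma undershoot_regular:
  assumes "distinct L" "set L = I" "undershoot m L k g h r" "x \<in> {k, g, h, r}"
  shows "euler L \<delta> x = 0"
proof (rule flip_closed_regular[OF assms(1,2) flip_closed_undershoot[OF roots_sign_coherent]])
  show "\<exists>k g h r. undershoot m L k g h r \<and> x \<in> {k, g, h, r}" using assms(3,4) by blast
qed (metis undershootD(6))

lemma negative_cycle_regular:
  assumes "distinct L" "set L = I" "negative_cycle L x y z" "u \<in> {x, y, z}"
  shows "euler L \<delta> u = 0"
proof (rule flip_closed_regular[OF assms(1,2) flip_closed_negative_cycle[OF roots_sign_coherent]])
  show "\<exists>x y z. negative_cycle L x y z \<and> u \<in> {x, y, z}" using assms(3,4) by blast
qed (metis negative_cycle_def)

lemma compatible_flip_regular: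
  assumes L: "distinct L" "set L = I" "flip s L L'"
    and w: "root I w" "\<not> simple_root I s w" "\<not> simple_root I s (- w)"
    and x: "root I x" "euler L \<delta> x = 0" and config: "compatible L w x"
  shows "compatible L' (reflect I s w) (reflect I s x)"
  using compatible_flip[OF L(1) _ L(3), of w x] roots_sign_coherent w x(1) config
    regular_not_simple_root[OF L x(2)] unfolding L(2) by blast

lemma no_overshoot:
  assumes L: "distinct L" "set L = I" and config: "overshoot m L k g h r" and w: "root I w" "euler L \<delta> w \<noteq> 0"
    and k: "w = k \<or> compatible L w k"
    and r: "w = r \<or> w = - r \<or> compatible L w r \<or> compatible L w (- r)"
  shows False
proof -
  define Q where "Q L w \<longleftrightarrow> root I w \<and> (\<exists>k g h r. overshoot m L k g h r \<and> compatible L w k \<and>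
    (compatible L w r \<or> compatible L w (- r)))" for L w
  have "w \<noteq> k" "w \<noteq> r" "w \<noteq> - r"
    using w(2) overshoot_regular[OF L config, of k] overshoot_regular[OF L config, of r] by auto
  then have "Q L w" using config w(1) k r unfolding Q_def by blast
  then obtain L s L' z where L: "distinct L" "set L = I" "flip s L L'"
    and z: "simple_root I s z" "root I z" "Q L z \<or> Q L (- z)"
  proof (rule nonregular_root_becomes_simple[OF L _ w(2), of Q])
    show "root I w" if "Q L w" for L w using that by (simp add: Q_def)
    fix L s L' w assume L: "distinct L" "set L = I" "flip s L L'" and Q: "Q L w"
      and w: "\<not> simple_root I s w" "\<not> simple_root I s (- w)"
    obtain k g h r where config: "overshoot m L k g h r" and wk: "compatible L w k"
      and wr: "compatible L w r \<or> compatible L w (- r)" using Q unfolding Q_def by blast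
    have kr: "root I k" "euler L \<delta> k = 0" "root I r" "euler L \<delta> r = 0"
      using overshootD(6)[OF config] overshoot_regular[OF L(1,2) config] L(2) by (auto simp: pos_root_def)
    have "root I w" using Q by (simp add: Q_def)
    note flip = compatible_flip_regular[OF L this w]
    have "compatible L' (reflect I s w) (reflect I s r) \<or> compatible L' (reflect I s w) (- reflect I s r)"
      using wr flip[of r] flip[of "- r"] kr(3,4) by (auto simp: reflect_uminus)
    moreover have "overshoot m L' (reflect I s k) (reflect I s g) (reflect I s h) (reflect I s r)"
      using overshoot_flip[OF L(1) _ L(3) config] roots_sign_coherent L(2) by simp
    moreover have "s \<in> I" using flip_mem[OF L(3)] L(2) by simp
    ultimately show "Q L' (reflect I s w)"
      using flip[OF kr(1,2) wk] \<open>root I w\<close> root_reflect[OF fin] unfolding Q_def by blast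
  qed (rule that)
  obtain w k g h r where w: "w = z \<or> w = - z" and config: "overshoot m L k g h r"
    and kr: "compatible L w k" "compatible L w r \<or> compatible L w (- r)" using z(3) unfolding Q_def by blast
  obtain M where M: "L = s # M \<or> L = M @ [s]" using L(3) by (auto simp: flip_def)
  then have "overshoot m M k g h r"
    by (rule overshoot_delete[OF _ L(1) _ _ _ w config kr, unfolded L(2), OF _ roots_sign_coherent z(1,2)])
  moreover have "s \<in> I" "distinct M" "set M = I - {s}" using M L by auto
  ultimately show False using finite_type_no_overshoot[of s M m k g h r] by blast
qed

lemma no_undershoot:
  assumes L: "distinct L" "set L = I" and config: "undershoot m L k g h r" and w: "root I w" "euler L \<delta> w \<noteq> 0"
    and g: "w = - g \<or> compatible L w (- g)" and r: "w = - r \<or> compatible L w (- r)"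
  shows False
proof -
  define Q where "Q L w \<longleftrightarrow> root I w \<and> (\<exists>k g h r. undershoot m L k g h r \<and> compatible L w (- g) \<and>
    compatible L w (- r))" for L w
  have "w \<noteq> - g" "w \<noteq> - r"
    using w(2) undershoot_regular[OF L config, of g] undershoot_regular[OF L config, of r] by auto
  then have "Q L w" using config w(1) g r unfolding Q_def by blast
  then obtain L s L' z where L: "distinct L" "set L = I" "flip s L L'"
    and z: "simple_root I s z" "root I z" "Q L z \<or> Q L (- z)"
  proof (rule nonregular_root_becomes_simple[OF L _ w(2), of Q])
    show "root I w" if "Q L w" for L w using that by (simp add: Q_def)
    fix L s L' w assume L: "distinct L" "set L = I" "flip s L L'" and Q: "Q L w"
      and w: "\<not> simple_root I s w" "\<not> simple_root I s (- w)"
    obtain k g h r where config: "undershoot m L k g h r" and wg: "compatible L w (- g)"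
      and wr: "compatible L w (- r)"
      using Q unfolding Q_def by blast
    have gr: "root I (- g)" "euler L \<delta> (- g) = 0" "root I (- r)" "euler L \<delta> (- r) = 0"
      using undershootD(6)[OF config] undershoot_regular[OF L(1,2) config] L(2) by (auto simp: pos_root_def)
    have "root I w" using Q by (simp add: Q_def)
    note flip = compatible_flip_regular[OF L this w]
    have "undershoot m L' (reflect I s k) (reflect I s g) (reflect I s h) (reflect I s r)"
      using undershoot_flip[OF L(1) _ L(3) config] roots_sign_coherent L(2) by simp
    moreover have "s \<in> I" using flip_mem[OF L(3)] L(2) by simp
    ultimately show "Q L' (reflect I s w)"
      using flip[OF gr(1,2) wg] flip[OF gr(3,4) wr] \<open>root I w\<close> root_reflect[OF fin]
      unfolding Q_def reflect_uminus by blast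
  qed (rule that)
  obtain w k g h r where w: "w = z \<or> w = - z" and config: "undershoot m L k g h r"
    and gr: "compatible L w (- g)" "compatible L w (- r)" using z(3) unfolding Q_def by blast
  obtain M where M: "L = s # M \<or> L = M @ [s]" using L(3) by (auto simp: flip_def)
  then have "undershoot m M k g h r"
    by (rule undershoot_delete[OF _ L(1) _ _ _ w config gr, unfolded L(2), OF _ roots_sign_coherent z(1,2)])
  moreover have "s \<in> I" "distinct M" "set M = I - {s}" using M L by auto
  ultimately show False using finite_type_no_undershoot[of s M m k g h r] by blast
qed

lemma no_negative_cycle:
  assumes L: "distinct L" "set L = I" and config: "negative_cycle L x y z" and w: "root I w" "euler L \<delta> w \<noteq> 0"
    and compat: "\<And>u. u \<in> {x, y, z} \<Longrightarrow> w = u \<or> compatible L w u"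
  shows False
proof -
  define Q where "Q L w \<longleftrightarrow> root I w \<and> (\<exists>x y z. negative_cycle L x y z \<and> (\<forall>u\<in>{x, y, z}. compatible L w u))"
    for L w
  have "w \<notin> {x, y, z}" using w(2) negative_cycle_regular[OF L config] by blast
  then have "Q L w" using config w(1) compat unfolding Q_def by blast
  then obtain L s L' z' where L: "distinct L" "set L = I" "flip s L L'"
    and z': "simple_root I s z'" "root I z'" "Q L z' \<or> Q L (- z')"
  proof (rule nonregular_root_becomes_simple[OF L _ w(2), of Q])
    show "root I w" if "Q L w" for L w using that by (simp add: Q_def)
    fix L s L' w assume L: "distinct L" "set L = I" "flip s L L'" and Q: "Q L w"
      and w: "\<not> simple_root I s w" "\<not> simple_root I s (- w)"
    obtain x y z where config: "negative_cycle L x y z" and wu: "\<And>u. u \<in> {x, y, z} \<Longrightarrow> compatible L w u"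
      using Q unfolding Q_def by blast
    have "root I w" using Q by (simp add: Q_def)
    have "compatible L' (reflect I s w) (reflect I s u)" if "u \<in> {x, y, z}" for u
      using compatible_flip_regular[OF L \<open>root I w\<close> w _
          negative_cycle_regular[OF L(1,2) config that] wu[OF that]]
        config that L(2) by (auto simp: negative_cycle_def pos_root_def)
    moreover have "negative_cycle L' (reflect I s x) (reflect I s y) (reflect I s z)"
      using negative_cycle_flip[OF L(1) _ L(3) config] roots_sign_coherent L(2) by simp
    moreover have "s \<in> I" using flip_mem[OF L(3)] L(2) by simp
    ultimately show "Q L' (reflect I s w)"
      using \<open>root I w\<close> root_reflect[OF fin] unfolding Q_def by blast
  qed (rule that)
  obtain w x y z where w: "w = z' \<or> w = - z'" and config: "negative_cycle L x y z"
    and compat: "\<And>u. u \<in> {x, y, z} \<Longrightarrow> compatible L w u" using z'(3) unfolding Q_def by blast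
  obtain M where M: "L = s # M \<or> L = M @ [s]" using L(3) by (auto simp: flip_def)
  then have "negative_cycle M x y z"
    by (rule negative_cycle_delete[OF _ L(1) _ _ _ w config compat, unfolded L(2),
          OF _ roots_sign_coherent z'(1,2)])
  moreover have "s \<in> I" "distinct M" "set M = I - {s}" using M L by auto
  ultimately show False using finite_type_no_negative_cycle[of s M x y z] by blast
qed

end

section \<open>Mutation of compatible families\<close>

locale oriented_affine_graph = affine_graph wt I \<delta> for wt :: "'v \<Rightarrow> 'v \<Rightarrow> int" and I \<delta> +
  fixes L :: "'v list"
  assumes distinct_L: "distinct L" and set_L: "set L = I"
begin

abbreviation E :: "('v \<Rightarrow> int) \<Rightarrow> ('v \<Rightarrow> int) \<Rightarrow> int" where
  "E \<equiv> euler L"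

definition compatible_family :: "('v \<Rightarrow> 'v \<Rightarrow> int) \<Rightarrow> bool" where
  "compatible_family c \<longleftrightarrow> (\<forall>i\<in>I. root I (c i)) \<and>
     (\<forall>i\<in>I. \<forall>j\<in>I. i \<noteq> j \<longrightarrow> compatible L (c i) (c j)) \<and> (\<exists>l\<in>I. E \<delta> (c l) \<noteq> 0)"

lemma compatible_familyD:
  assumes "compatible_family c"
  shows "i \<in> I \<Longrightarrow> root I (c i)" "i \<in> I \<Longrightarrow> E (c i) (c i) = 1"
    "i \<in> I \<Longrightarrow> j \<in> I \<Longrightarrow> i \<noteq> j \<Longrightarrow> compatible L (c i) (c j)"
    "i \<in> I \<Longrightarrow> j \<in> I \<Longrightarrow> i \<noteq> j \<Longrightarrow> E (c i) (c j) * E (c j) (c i) = 0"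
  using assms root_euler[OF distinct_L] set_L by (auto simp: compatible_family_def compatible_def)

subsection \<open>Pushing along a positive root\<close>

definition push :: "('v \<Rightarrow> int) \<Rightarrow> ('v \<Rightarrow> int) \<Rightarrow> 'v \<Rightarrow> int" where
  "push \<kappa> x = (\<lambda>v. x v + max 0 (- E \<kappa> x) * \<kappa> v)"

lemma push_fixed: "0 \<le> E \<kappa> x \<Longrightarrow> push \<kappa> x = x"
  by (simp add: push_def)

lemma euler_push:
  assumes "E \<kappa> \<kappa> = 1"
  shows "E (push \<kappa> x) (push \<kappa> y)
    = E x y + max 0 (- E \<kappa> y) * E x \<kappa> + max 0 (- E \<kappa> x) * max 0 (E \<kappa> y)"
proof -
  have "E (push \<kappa> x) (push \<kappa> y)
      = E x y + max 0 (- E \<kappa> y) * E x \<kappa> + max 0 (- E \<kappa> x) * (E \<kappa> y + max 0 (- E \<kappa> y))"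
    unfolding push_def euler_add_scaled_left euler_add_scaled_right by (simp add: assms algebra_simps)
  also have "E \<kappa> y + max 0 (- E \<kappa> y) = max 0 (E \<kappa> y)" by simp
  finally show ?thesis .
qed

lemma euler_push_right: "E x (push \<kappa> y) = E x y + max 0 (- E \<kappa> y) * E x \<kappa>"
  and euler_push_left: "E (push \<kappa> x) y = E x y + max 0 (- E \<kappa> x) * E \<kappa> y"
  by (simp_all add: push_def euler_add_scaled_right euler_add_scaled_left)

context
  fixes c :: "'v \<Rightarrow> 'v \<Rightarrow> int" and k :: 'v
  assumes family: "compatible_family c" and k: "k \<in> I" "nonneg_on I (c k)"
begin

abbreviation pushed :: "'v \<Rightarrow> 'v \<Rightarrow> int" where
  "pushed i \<equiv> push (c k) (c i)"

lemma pos_root_pivot: "pos_root I (c k)" "E (c k) (c k) = 1"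
  using compatible_familyD(1,2)[OF family k(1)] k(2) by (simp_all add: pos_root_def)

lemma pivot_sign_rules:
  assumes "i \<in> I" "i \<noteq> k"
  shows "nonneg_on I (c i) \<Longrightarrow> E (c k) (c i) \<le> 0" "nonneg_on I (c i) \<Longrightarrow> E (c i) (c k) \<le> 0"
    "\<not> nonneg_on I (c i) \<Longrightarrow> E (c i) (c k) = 0" "E (c k) (c i) < 0 \<Longrightarrow> E (c i) (c k) = 0"
  using compatible_familyD(3,4)[OF family assms(1) k(1) assms(2)] k(2)
  by (auto simp: compatible_def hom_free_def set_L)

lemma nonneg_pushed: "nonneg_on I (c i) \<Longrightarrow> nonneg_on I (pushed i)"
  using k(2) by (simp add: push_def nonneg_on_def)

lemma pushed_crosses: "\<not> nonneg_on I (c i) \<Longrightarrow> nonneg_on I (pushed i) \<Longrightarrow> E (c k) (c i) < 0"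
  using push_fixed[of "c k" "c i"] by fastforce

lemma root_pushed:
  assumes "i \<in> I" "i \<noteq> k"
  shows "root I (pushed i)"
proof -
  have "max 0 (- E (c k) (c i)) * E (c i) (c k) = 0"
    using pivot_sign_rules(4)[OF assms] by (cases "E (c k) (c i) < 0") simp_all
  moreover have "max 0 (- E (c k) (c i)) * max 0 (E (c k) (c i)) = 0" by (simp add: max_def)
  ultimately have "E (pushed i) (pushed i) = 1"
    using compatible_familyD(2)[OF family assms(1)] unfolding euler_push[OF pos_root_pivot(2)] by linarith
  then show ?thesis using root_euler[OF distinct_L] set_L by simp
qed

lemma nonregular_member:
  obtains w where "root I w" "E \<delta> w \<noteq> 0" "\<And>a. a \<in> I \<Longrightarrow> w = c a \<or> compatible L w (c a)"
proof -
  obtain l where l: "l \<in> I" "E \<delta> (c l) \<noteq> 0" using family by (auto simp: compatible_family_def)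
  moreover have "c l = c a \<or> compatible L (c l) (c a)" if "a \<in> I" for a
    using compatible_familyD(3)[OF family l(1) that] by blast
  ultimately show ?thesis using that compatible_familyD(1)[OF family] by blast
qed

lemma crossing_root_bound:
  assumes i: "i \<in> I" "i \<noteq> k" "\<not> nonneg_on I (c i)" "nonneg_on I (pushed i)"
    and r: "j \<in> I" "r = c j \<or> r = - c j" "nonneg_on I r" "E r (c k) \<le> 0"
  shows "E r (pushed i) \<le> 0"
proof (rule ccontr)
  assume not: "\<not> ?thesis"
  define m where "m = - E (c k) (c i)"
  have neg: "0 < m" using pushed_crosses[OF i(3,4)] by (simp add: m_def)
  have "root I r" using r(2) compatible_familyD(1)[OF family r(1)] by auto
  moreover have "pos_root I (- c i)"
    using i(3) compatible_familyD(1)[OF family i(1)] nonneg_uminus_iff[OF roots_sign_coherent]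
    by (simp add: pos_root_def)
  moreover have "m * c k v = - c i v + pushed i v" for v
    using neg by (simp add: m_def push_def max_def)
  moreover have "E (c k) (- c i) = m" "E (- c i) (c k) = 0"
    using neg pivot_sign_rules(4)[OF i(1,2)] by (simp_all add: m_def)
  ultimately have config: "overshoot m L (c k) (- c i) (pushed i) r"
    using not r(3,4) neg i(4) root_pushed[OF i(1,2)] pos_root_pivot(1)
    by (simp add: overshoot_def set_L pos_root_def)
  obtain w where w: "root I w" "E \<delta> w \<noteq> 0" "\<And>a. a \<in> I \<Longrightarrow> w = c a \<or> compatible L w (c a)"
    using nonregular_member by blast
  show False
    by (rule no_overshoot[OF distinct_L set_L config w(1,2) w(3)[OF k(1)]]) (use w(3)[OF r(1)] r(2) in auto)
qed

lemma noncrossing_root_bound: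
  assumes i: "i \<in> I" "i \<noteq> k" "\<not> nonneg_on I (c i)" "\<not> nonneg_on I (pushed i)" "E (c k) (c i) < 0"
    and j: "j \<in> I" "\<not> nonneg_on I (c j)" "E (c i) (c j) \<le> 0"
  shows "E (pushed i) (c j) \<le> 0"
proof (rule ccontr)
  assume not: "\<not> ?thesis"
  define m where "m = - E (c k) (c i)"
  have m: "0 < m" using i(5) by (simp add: m_def)
  have "pos_root I (- x)" if "root I x" "\<not> nonneg_on I x" for x
    using that nonneg_uminus_iff[OF roots_sign_coherent] by (simp add: pos_root_def)
  then have "pos_root I (- c i)" "pos_root I (- pushed i)" "pos_root I (- c j)"
    using i j root_pushed compatible_familyD(1)[OF family] by simp_all
  moreover have "- c i v = - pushed i v + m * c k v" for v
    using m by (simp add: m_def push_def max_def)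
  moreover have "E (c k) (- c i) = m" "E (- c i) (c k) = 0"
    using m pivot_sign_rules(4)[OF i(1,2)] by (simp_all add: m_def)
  ultimately have config: "undershoot m L (c k) (- c i) (- pushed i) (- c j)"
    using not j(3) m pos_root_pivot(1) by (simp add: undershoot_def set_L)
  obtain w where w: "root I w" "E \<delta> w \<noteq> 0" "\<And>a. a \<in> I \<Longrightarrow> w = c a \<or> compatible L w (c a)"
    using nonregular_member by blast
  show False
    by (rule no_undershoot[OF distinct_L set_L config w(1,2)]) (use w(3)[OF i(1)] w(3)[OF j(1)] in auto)
qed

lemma family_no_negative_cycle:
  assumes "i \<in> I" "j \<in> I" "nonneg_on I (c i)" "nonneg_on I (c j)"
    and "E (c i) (c j) < 0" "E (c j) (c k) < 0" "E (c k) (c i) < 0"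
  shows False
proof -
  have config: "negative_cycle L (c i) (c j) (c k)"
    using assms compatible_familyD(1)[OF family] k by (simp add: negative_cycle_def pos_root_def set_L)
  obtain w where w: "root I w" "E \<delta> w \<noteq> 0" "\<And>a. a \<in> I \<Longrightarrow> w = c a \<or> compatible L w (c a)"
    using nonregular_member by blast
  show False
    by (rule no_negative_cycle[OF distinct_L set_L config w(1,2)]) (use w(3) assms(1,2) k(1) in auto)
qed

lemma family_same_sign:
  assumes "i \<in> I" "j \<in> I" "i \<noteq> j"
  shows "nonneg_on I (c i) = nonneg_on I (c j) \<Longrightarrow> E (c i) (c j) \<le> 0"
    and family_neg_pos: "\<not> nonneg_on I (c i) \<Longrightarrow> nonneg_on I (c j) \<Longrightarrow> E (c i) (c j) = 0"
  using compatible_familyD(3)[OF family assms] by (auto simp: compatible_def hom_free_def set_L)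

lemma pivot_nonpos_of_nonneg_pushed:
  "i \<in> I \<Longrightarrow> i \<noteq> k \<Longrightarrow> nonneg_on I (pushed i) \<Longrightarrow> E (c k) (c i) \<le> 0"
  using pivot_sign_rules(1)[of i] pushed_crosses[of i] by fastforce

lemma euler_pushed_right:
  assumes "E (c k) (c j) \<le> 0"
  shows "E (pushed i) (pushed j) = E (c i) (pushed j)"
  using assms unfolding euler_push[OF pos_root_pivot(2)] by (simp add: euler_push_right)

lemma euler_pushed_neg:
  assumes "i \<in> I" "i \<noteq> k" "\<not> nonneg_on I (c i)" "E (c k) (c j) \<le> 0"
  shows "E (pushed i) (pushed j) = E (c i) (c j)"
  using assms(4) pivot_sign_rules(3)[OF assms(1-3)] unfolding euler_push[OF pos_root_pivot(2)] by simp

lemma euler_pushed_pos_pos: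
  assumes ij: "i \<in> I" "j \<in> I" "i \<noteq> k" "j \<noteq> k" "i \<noteq> j" and pos: "nonneg_on I (pushed i)" "nonneg_on I (pushed j)"
  shows "E (pushed i) (pushed j) \<le> 0"
proof -
  note nonpos = pivot_nonpos_of_nonneg_pushed[OF ij(2,4) pos(2)]
  show ?thesis
  proof (cases "nonneg_on I (c i)")
    case i: True
    note ik = pivot_sign_rules(2)[OF ij(1,3) i]
    show ?thesis
    proof (cases "nonneg_on I (c j)")
      case True
      then have "E (c i) (c j) \<le> 0" "max 0 (- E (c k) (c j)) * E (c i) (c k) \<le> 0"
        using i ik family_same_sign[OF ij(1,2,5)] by (auto intro: mult_nonneg_nonpos)
      then show ?thesis unfolding euler_pushed_right[OF nonpos] by (simp add: euler_push_right)
    next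
      case False
      then show ?thesis
        using crossing_root_bound[OF ij(2,4) False pos(2) ij(1)] i ik
        unfolding euler_pushed_right[OF nonpos] by simp
    qed
  next
    case False
    then show ?thesis
      using family_same_sign[OF ij(1,2,5)] family_neg_pos[OF ij(1,2,5)]
      unfolding euler_pushed_neg[OF ij(1,3) False nonpos] by (cases "nonneg_on I (c j)") auto
  qed
qed

lemma euler_pushed_neg_pos:
  assumes ij: "i \<in> I" "j \<in> I" "i \<noteq> k" "j \<noteq> k" "i \<noteq> j"
    and signs: "\<not> nonneg_on I (pushed i)" "nonneg_on I (pushed j)"
  shows "E (pushed i) (pushed j) = 0"
proof -
  have i: "\<not> nonneg_on I (c i)" using signs(1) nonneg_pushed by blast
  note ik = pivot_sign_rules(3)[OF ij(1,3) i]
  have "E (c i) (c j) = 0"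
  proof (cases "nonneg_on I (c j)")
    case True
    then show ?thesis using family_neg_pos[OF ij(1,2,5)] i by simp
  next
    case False
    have "nonneg_on I (- c i)"
      using i nonneg_uminus_iff[OF roots_sign_coherent] compatible_familyD(1)[OF family ij(1)] by simp
    then have "E (- c i) (pushed j) \<le> 0"
      using crossing_root_bound[OF ij(2,4) False signs(2) ij(1), of "- c i"] ik by simp
    then have "0 \<le> E (c i) (c j)" using ik by (simp add: euler_push_right)
    then show ?thesis using family_same_sign[OF ij(1,2,5)] i False by simp
  qed
  then show ?thesis
    using euler_pushed_neg[OF ij(1,3) i pivot_nonpos_of_nonneg_pushed[OF ij(2,4) signs(2)]] by simp
qed

lemma euler_pushed_neg_neg:
  assumes ij: "i \<in> I" "j \<in> I" "i \<noteq> k" "j \<noteq> k" "i \<noteq> j"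
    and signs: "\<not> nonneg_on I (pushed i)" "\<not> nonneg_on I (pushed j)"
  shows "E (pushed i) (pushed j) \<le> 0"
proof -
  have neg: "\<not> nonneg_on I (c i)" "\<not> nonneg_on I (c j)" using signs nonneg_pushed by blast+
  then have le: "E (c i) (c j) \<le> 0" using family_same_sign[OF ij(1,2,5)] by simp
  show ?thesis
  proof (cases "E (c k) (c i) < 0 \<and> 0 < E (c k) (c j)")
    case True
    then show ?thesis
      using noncrossing_root_bound[OF ij(1,3) neg(1) signs(1) _ ij(2) neg(2) le] push_fixed[of "c k" "c j"]
      by simp
  next
    case False
    then have "max 0 (- E (c k) (c i)) * max 0 (E (c k) (c j)) = 0" by auto
    then show ?thesis
      using le pivot_sign_rules(3)[OF ij(1,3) neg(1)] unfolding euler_push[OF pos_root_pivot(2)] by auto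
  qed
qed

lemma hom_free_pushed:
  assumes "i \<in> I" "j \<in> I" "i \<noteq> k" "j \<noteq> k" "i \<noteq> j"
  shows "hom_free L (pushed i) (pushed j)"
  using euler_pushed_pos_pos[OF assms] euler_pushed_neg_pos[OF assms] euler_pushed_neg_neg[OF assms]
  by (auto simp: hom_free_def set_L)

lemma euler_pushed_product_unmoved_pos:
  assumes ij: "i \<in> I" "j \<in> I" "i \<noteq> k" "j \<noteq> k" "i \<noteq> j" and sign: "E (c k) (c i) < 0" "0 \<le> E (c k) (c j)"
    and j: "nonneg_on I (c j)"
  shows "E (pushed i) (c j) * E (c j) (pushed i) = 0"
proof -
  have kj: "E (c k) (c j) = 0" using pivot_sign_rules(1)[OF ij(2,4) j] sign(2) by simp
  show ?thesis
  proof (cases "E (c i) (c j) = 0")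
    case True
    then show ?thesis using kj by (simp add: euler_push_left)
  next
    case False
    then have i: "nonneg_on I (c i)" "E (c i) (c j) < 0"
      using family_neg_pos[OF ij(1,2,5)] family_same_sign[OF ij(1,2,5)] j by fastforce+
    then have "E (c j) (c k) = 0"
      using family_no_negative_cycle[OF ij(1,2) i(1) j i(2) _ sign(1)] pivot_sign_rules(2)[OF ij(2,4) j]
      by force
    then show ?thesis using compatible_familyD(4)[OF family ij(1,2,5)] False by (simp add: euler_push_right)
  qed
qed

lemma euler_pushed_product_unmoved:
  assumes ij: "i \<in> I" "j \<in> I" "i \<noteq> k" "j \<noteq> k" "i \<noteq> j" and sign: "E (c k) (c i) < 0" "0 \<le> E (c k) (c j)"
  shows "E (pushed i) (c j) * E (c j) (pushed i) = 0"
proof (cases "nonneg_on I (c j)")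
  case True
  then show ?thesis by (rule euler_pushed_product_unmoved_pos[OF ij sign])
next
  case j: False
  have jk: "E (c j) (pushed i) = E (c j) (c i)"
    using pivot_sign_rules(3)[OF ij(2,4) j] by (simp add: euler_push_right)
  have fixed: "pushed j = c j" using sign(2) by (rule push_fixed)
  consider "nonneg_on I (c i)" | "nonneg_on I (pushed i)" | "\<not> nonneg_on I (c i)" "\<not> nonneg_on I (pushed i)"
    by blast
  then show ?thesis
  proof cases
    case 1
    then show ?thesis using jk family_neg_pos[OF ij(2,1) ij(5)[symmetric]] j by simp
  next
    case 2
    then show ?thesis using euler_pushed_neg_pos[OF ij(2,1,4,3) ij(5)[symmetric]] j unfolding fixed by simp
  next
    case 3
    then have "E (pushed i) (c j) \<le> 0" using euler_pushed_neg_neg[OF ij] j unfolding fixed by simp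
    moreover have "E (c k) (c i) * E (c k) (c j) \<le> 0" using sign by (intro mult_nonpos_nonneg) auto
    ultimately have "E (c i) (c j) = 0 \<Longrightarrow> E (pushed i) (c j) = 0" using sign(1) by (simp add: euler_push_left)
    then show ?thesis using compatible_familyD(4)[OF family ij(1,2,5)] jk by auto
  qed
qed

lemma euler_pushed_product:
  assumes ij: "i \<in> I" "j \<in> I" "i \<noteq> k" "j \<noteq> k" "i \<noteq> j"
  shows "E (pushed i) (pushed j) * E (pushed j) (pushed i) = 0"
proof -
  have prod: "E (c i) (c j) * E (c j) (c i) = 0" by (rule compatible_familyD(4)[OF family ij(1,2,5)])
  consider (fixed) "0 \<le> E (c k) (c i)" "0 \<le> E (c k) (c j)" | (i) "E (c k) (c i) < 0" "0 \<le> E (c k) (c j)"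
    | (j) "E (c k) (c j) < 0" "0 \<le> E (c k) (c i)" | (both) "E (c k) (c i) < 0" "E (c k) (c j) < 0"
    by linarith
  then show ?thesis
  proof cases
    case fixed
    then show ?thesis using prod by (simp add: push_fixed)
  next
    case i
    then show ?thesis using euler_pushed_product_unmoved[OF ij] by (simp add: push_fixed)
  next
    case j
    then show ?thesis
      using euler_pushed_product_unmoved[OF ij(2,1,4,3) ij(5)[symmetric]] by (simp add: push_fixed mult.commute)
  next
    case both
    then have "E (c i) (c k) = 0" "E (c j) (c k) = 0"
      using pivot_sign_rules(4)[OF ij(1,3)] pivot_sign_rules(4)[OF ij(2,4)] by simp_all
    then show ?thesis using prod both by (simp add: euler_push[OF pos_root_pivot(2)])
  qed
qed

lemma compatible_uminus_pivot_pushed: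
  assumes i: "i \<in> I" "i \<noteq> k"
  shows "compatible L (- c k) (pushed i)"
proof -
  let ?a = "E (c k) (c i)" and ?b = "E (c i) (c k)"
  note rules = pivot_sign_rules[OF i]
  have left: "E (- c k) (pushed i) = - max 0 ?a" and right: "E (pushed i) (- c k) = - (?b + max 0 (- ?a))"
    by (simp_all add: euler_push_left euler_push_right pos_root_pivot(2))
  have pivot: "\<not> nonneg_on I (- c k)"
    using root_not_both_signs pos_root_pivot(1) by (auto simp: pos_root_def)
  have "?a \<le> 0" if "nonneg_on I (pushed i)" using that rules(1) pushed_crosses[of i] by fastforce
  then have "hom_free L (- c k) (pushed i)" using pivot unfolding hom_free_def set_L left by auto
  moreover have "?b = 0" if "\<not> nonneg_on I (pushed i)" using that rules(3) nonneg_pushed[of i] by blast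
  then have "hom_free L (pushed i) (- c k)" using pivot unfolding hom_free_def set_L right by auto
  moreover have "max 0 ?a * (?b + max 0 (- ?a)) = 0"
    using rules(1,3) by (cases "?a \<le> 0") (auto simp: max_def)
  ultimately show ?thesis
    unfolding compatible_def left right by (simp only: mult_minus_left mult_minus_right) simp
qed

lemma pushed_compatible:
  assumes "i \<in> I" "j \<in> I" "i \<noteq> k" "j \<noteq> k" "i \<noteq> j"
  shows "compatible L (pushed i) (pushed j)"
  using hom_free_pushed[OF assms] hom_free_pushed[OF assms(2,1,4,3) assms(5)[symmetric]]
    euler_pushed_product[OF assms] by (simp add: compatible_def)

end

end

definition mutate :: "'v \<Rightarrow> ('v \<Rightarrow> 'v \<Rightarrow> int) \<Rightarrow> 'v \<Rightarrow> 'v \<Rightarrow> int" where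
  "mutate k B i j = (if k \<in> {i, j} then - B i j
     else B i j + (\<bar>B i k\<bar> * B k j + B i k * \<bar>B k j\<bar>) div 2)"

lemma mutation_term:
  fixes x y :: int
  shows "(\<bar>x\<bar> * y + x * \<bar>y\<bar>) div 2 = x * max 0 y + max 0 (- x) * y"
proof -
  have "\<bar>x\<bar> * y + x * \<bar>y\<bar> = 2 * (x * max 0 y + max 0 (- x) * y)"
    by (cases "0 \<le> x"; cases "0 \<le> y") (auto simp: max_def)
  then show ?thesis by simp
qed

lemma mutate_mutate [simp]: "mutate k (mutate k B) i j = B i j"
proof (cases "k \<in> {i, j}")
  case False
  have "x * max 0 y + max 0 (- x) * y + ((- x) * max 0 (- y) + max 0 (- (- x)) * (- y)) = 0" for x y :: int
    by (simp add: max_def)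
  from this[of "B i k" "B k j"] show ?thesis
    using False unfolding mutate_def mutation_term by simp
qed (auto simp: mutate_def)

lemma mutate_cong:
  assumes "\<And>i j. i \<in> I \<Longrightarrow> j \<in> I \<Longrightarrow> B i j = B' i j" "i \<in> I" "j \<in> I" "k \<in> I"
  shows "mutate k B i j = mutate k B' i j"
  using assms by (simp add: mutate_def)

subsection \<open>Mutation of families\<close>

context oriented_affine_graph begin

definition exchange :: "('v \<Rightarrow> 'v \<Rightarrow> int) \<Rightarrow> 'v \<Rightarrow> 'v \<Rightarrow> int" where
  "exchange c i j = E (c i) (c j) - E (c j) (c i)"

definition gram :: "('v \<Rightarrow> 'v \<Rightarrow> int) \<Rightarrow> 'v \<Rightarrow> 'v \<Rightarrow> int" where
  "gram c i j = E (c i) (c j) + E (c j) (c i)"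

definition mutate_family :: "int \<Rightarrow> 'v \<Rightarrow> ('v \<Rightarrow> 'v \<Rightarrow> int) \<Rightarrow> 'v \<Rightarrow> 'v \<Rightarrow> int" where
  "mutate_family \<epsilon> k c i =
     (if i = k then - c k else (\<lambda>v. c i v + max 0 (\<epsilon> * exchange c i k) * c k v))"

lemma mutate_family_shear:
  "mutate_family \<epsilon> k c i = (\<lambda>v. c i v + (if i = k then - 2 else max 0 (\<epsilon> * exchange c i k)) * c k v)"
  by (auto simp: mutate_family_def)

lemma exchange_skew: "exchange c i j = - exchange c j i"
  and gram_sym: "gram c i j = gram c j i"
  by (simp_all add: exchange_def gram_def)

lemma exchange_mutate_family:
  assumes k: "E (c k) (c k) = 1" and \<epsilon>: "\<epsilon> = 1 \<or> \<epsilon> = - 1"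
  shows "exchange (mutate_family \<epsilon> k c) i j = mutate k (exchange c) i j"
proof -
  define p where "p i = (if i = k then - 2 else max 0 (\<epsilon> * exchange c i k))" for i
  have "mutate_family \<epsilon> k c = (\<lambda>i v. c i v + p i * c k v)"
    by (simp add: mutate_family_shear p_def fun_eq_iff)
  then have "exchange (mutate_family \<epsilon> k c) i j = exchange c i j + p j * exchange c i k + p i * exchange c k j"
    by (simp add: exchange_def euler_add_scaled_left euler_add_scaled_right algebra_simps)
  also have "\<dots> = mutate k (exchange c) i j"
  proof (cases "k \<in> {i, j}")
    case True
    then show ?thesis using exchange_skew[of c k k] by (auto simp: mutate_def p_def)
  next
    case False
    then have "p i = max 0 (\<epsilon> * exchange c i k)" "p j = max 0 (- \<epsilon> * exchange c k j)"
      using exchange_skew[of c j k] by (auto simp: p_def)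
    then show ?thesis using False \<epsilon> by (auto simp: mutate_def mutation_term max_def algebra_simps)
  qed
  finally show ?thesis .
qed

lemma mutate_family_nonregular:
  assumes "compatible_family c" "k \<in> I"
  shows "\<exists>l\<in>I. E \<delta> (mutate_family \<epsilon> k c l) \<noteq> 0"
proof (rule ccontr)
  assume "\<not> ?thesis"
  then have zero: "E \<delta> (c i) + (if i = k then - 2 else max 0 (\<epsilon> * exchange c i k)) * E \<delta> (c k) = 0"
    if "i \<in> I" for i
    using that unfolding mutate_family_shear euler_add_scaled_right by blast
  from zero[OF assms(2)] have "E \<delta> (c k) = 0" by simp
  then have "E \<delta> (c i) = 0" if "i \<in> I" for i using zero[OF that] by simp
  then show False using assms(1) by (auto simp: compatible_family_def)
qed

lemma exchange_positive_pivot: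
  assumes c: "compatible_family c" "k \<in> I" "nonneg_on I (c k)" and i: "i \<in> I" "i \<noteq> k"
  shows "max 0 (exchange c i k) = max 0 (- E (c k) (c i))"
    "0 < exchange c i k \<Longrightarrow> gram c i k = - exchange c i k"
  using pivot_sign_rules[OF c i]
  by (cases "nonneg_on I (c i)"; cases "E (c k) (c i) < 0"; simp add: exchange_def gram_def)+

lemma compatible_family_mutate_positive:
  assumes c: "compatible_family c" "k \<in> I" "nonneg_on I (c k)"
  shows "compatible_family (mutate_family 1 k c)"
  unfolding compatible_family_def
proof (intro conjI ballI impI)
  have pushed: "mutate_family 1 k c i = push (c k) (c i)" if "i \<in> I" "i \<noteq> k" for i
    using that exchange_positive_pivot(1)[OF c that] by (simp add: mutate_family_def push_def)
  show "\<exists>l\<in>I. E \<delta> (mutate_family 1 k c l) \<noteq> 0" by (rule mutate_family_nonregular[OF c(1,2)])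
  show "root I (mutate_family 1 k c i)" if "i \<in> I" for i
    using that root_pushed[OF c that] compatible_familyD(1)[OF c(1)] pushed[OF that]
    by (cases "i = k") (simp_all add: mutate_family_def)
  show "compatible L (mutate_family 1 k c i) (mutate_family 1 k c j)" if ij: "i \<in> I" "j \<in> I" "i \<noteq> j" for i j
  proof -
    consider "i = k" "j \<noteq> k" | "i \<noteq> k" "j = k" | "i \<noteq> k" "j \<noteq> k" using ij(3) by blast
    then show ?thesis
    proof cases
      case 1
      then show ?thesis
        using compatible_uminus_pivot_pushed[OF c ij(2)] pushed[OF ij(2)] by (simp add: mutate_family_def)
    next
      case 2
      then show ?thesis
        using compatible_uminus_pivot_pushed[OF c ij(1)] pushed[OF ij(1)]
        by (simp add: mutate_family_def compatible_commute)
    next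
      case 3
      then show ?thesis using pushed_compatible[OF c ij(1,2) _ _ ij(3)] pushed ij by simp
    qed
  qed
qed

end

context oriented_affine_graph begin

interpretation dual: oriented_affine_graph wt I \<delta> "rev L"
  by unfold_locales (simp_all add: distinct_L set_L)

lemma dual_compatible_family: "dual.compatible_family (\<lambda>i. - c i) \<longleftrightarrow> compatible_family c"
proof -
  have "compatible (rev L) (- c i) (- c j) \<longleftrightarrow> compatible L (c i) (c j)" if "root I (c i)" "root I (c j)" for i j
    using compatible_rev[OF distinct_L, unfolded set_L, OF roots_sign_coherent that] .
  moreover have "euler (rev L) \<delta> (- c l) = E \<delta> (c l)" for l
    using euler_delta_right[OF distinct_L set_L] by (simp add: euler_rev distinct_L)
  ultimately show ?thesis
    unfolding compatible_family_def dual.compatible_family_def by auto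
qed

lemma dual_gram: "dual.gram (\<lambda>i. - c i) i j = gram c i j"
  and dual_exchange: "dual.exchange (\<lambda>i. - c i) i j = - exchange c i j"
  by (simp_all add: gram_def dual.gram_def exchange_def dual.exchange_def euler_rev distinct_L)

lemma dual_mutate_family: "dual.mutate_family \<epsilon> k (\<lambda>i. - c i) i = - mutate_family (- \<epsilon>) k c i"
  by (simp add: mutate_family_def dual.mutate_family_def dual_exchange fun_eq_iff)

lemma compatible_family_mutate:
  assumes c: "compatible_family c" and k: "k \<in> I"
  obtains \<epsilon> where "\<epsilon> = 1 \<or> \<epsilon> = - 1" "compatible_family (mutate_family \<epsilon> k c)"
    "\<And>i. i \<in> I - {k} \<Longrightarrow> 0 < \<epsilon> * exchange c i k \<Longrightarrow> gram c i k = - \<epsilon> * exchange c i k"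
proof (cases "nonneg_on I (c k)")
  case True
  then show ?thesis
    using that[of 1] compatible_family_mutate_positive[OF c k] exchange_positive_pivot(2)[OF c k] by auto
next
  case False
  then have dual_k: "nonneg_on I (- c k)"
    using nonneg_uminus_iff[OF roots_sign_coherent] compatible_familyD(1)[OF c k] by simp
  have dual_c: "dual.compatible_family (\<lambda>i. - c i)" using c by (simp add: dual_compatible_family)
  have "dual.compatible_family (\<lambda>i. - mutate_family (- 1) k c i)"
    using dual.compatible_family_mutate_positive[OF dual_c k dual_k]
    unfolding dual_mutate_family[abs_def] by simp
  then have "compatible_family (mutate_family (- 1) k c)" by (simp add: dual_compatible_family)
  moreover have "gram c i k = exchange c i k" if "i \<in> I - {k}" "exchange c i k < 0" for i
    using dual.exchange_positive_pivot(2)[OF dual_c k dual_k, of i] that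
    unfolding dual_gram dual_exchange by simp
  ultimately show ?thesis using that[of "- 1"] by simp
qed

end

subsection \<open>Lattice bases\<close>

definition lattice_basis :: "'v set \<Rightarrow> ('v \<Rightarrow> 'v \<Rightarrow> int) \<Rightarrow> bool" where
  "lattice_basis I c \<longleftrightarrow>
     (\<forall>x. (\<forall>v\<in>I. (\<Sum>i\<in>I. x i * c i v) = 0) \<longrightarrow> (\<forall>i\<in>I. x i = 0)) \<and>
     (\<forall>y. \<exists>x. \<forall>v\<in>I. (\<Sum>i\<in>I. x i * c i v) = y v)"

lemma lattice_basis_independent:
  assumes "lattice_basis I c" "\<And>v. v \<in> I \<Longrightarrow> (\<Sum>i\<in>I. x i * c i v) = 0" "i \<in> I"
  shows "x i = 0"
  using assms(2,3) assms(1)[unfolded lattice_basis_def, THEN conjunct1, rule_format, of x i] by simp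

lemma lattice_basis_spans:
  assumes "lattice_basis I c"
  obtains x where "\<And>v. v \<in> I \<Longrightarrow> (\<Sum>i\<in>I. x i * c i v) = y v"
  using assms unfolding lattice_basis_def by blast

lemma lattice_basis_unit:
  fixes I :: "'v set"
  assumes "finite I"
  shows "lattice_basis I (\<lambda>i v. if v = i then 1 else 0)"
proof -
  have "(\<Sum>i\<in>I. x i * (if v = i then 1 else 0)) = x v" if "v \<in> I" for x :: "'v \<Rightarrow> int" and v
    using that assms by (simp add: if_distrib[of "times _"] cong: if_cong)
  then show ?thesis unfolding lattice_basis_def by auto
qed

text \<open>With \<open>p k = - 2\<close> the map \<open>c\<^sub>i \<mapsto> c\<^sub>i + p\<^sub>i c\<^sub>k\<close> negates \<open>c\<^sub>k\<close>.\<close>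

lemma lattice_basis_shear:
  fixes c :: "'v \<Rightarrow> 'v \<Rightarrow> int"
  assumes c: "lattice_basis I c" and I: "finite I" "k \<in> I" and p: "p k = - 2"
  shows "lattice_basis I (\<lambda>i v. c i v + p i * c k v)"
proof -
  define shift where "shift x = x(k := x k + (\<Sum>i\<in>I. x i * p i))" for x :: "'v \<Rightarrow> int"
  have expand: "(\<Sum>i\<in>I. x i * (c i v + p i * c k v)) = (\<Sum>i\<in>I. shift x i * c i v)" for x v
  proof -
    have "(\<Sum>i\<in>I. shift x i * c i v)
        = (\<Sum>i\<in>I. x i * c i v + (if i = k then (\<Sum>i\<in>I. x i * p i) * c k v else 0))"
      by (intro sum.cong) (auto simp: shift_def algebra_simps)
    also have "\<dots> = (\<Sum>i\<in>I. x i * c i v) + (\<Sum>i\<in>I. x i * p i) * c k v"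
      using I by (simp add: sum.distrib)
    finally show ?thesis by (simp add: algebra_simps sum.distrib sum_distrib_left)
  qed
  have split: "(\<Sum>i\<in>I. x i * p i) = - 2 * x k + (\<Sum>i\<in>I - {k}. x i * p i)" for x
    using I p by (simp add: sum.remove)
  show ?thesis
    unfolding lattice_basis_def expand
  proof (intro conjI allI impI ballI)
    fix x i assume null: "\<forall>v\<in>I. (\<Sum>i\<in>I. shift x i * c i v) = 0" and i: "i \<in> I"
    have zero: "shift x i = 0" if "i \<in> I" for i
      using lattice_basis_independent[OF c, of "shift x" i] null that by blast
    have other: "x i = 0" if "i \<in> I - {k}" for i using zero[of i] that by (simp add: shift_def)
    then have "x k = 0" using zero[OF I(2)] split[of x] by (simp add: shift_def)
    then show "x i = 0" using other i by (cases "i = k") auto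
  next
    fix y :: "'v \<Rightarrow> int"
    obtain z where z: "\<And>v. v \<in> I \<Longrightarrow> (\<Sum>i\<in>I. z i * c i v) = y v"
      using lattice_basis_spans[OF c] by blast
    define x where "x = z(k := (\<Sum>i\<in>I - {k}. z i * p i) - z k)"
    have "(\<Sum>i\<in>I - {k}. x i * p i) = (\<Sum>i\<in>I - {k}. z i * p i)"
      by (intro sum.cong) (auto simp: x_def)
    then have "shift x = z" using split[of x] by (auto simp: shift_def x_def fun_eq_iff)
    then show "\<exists>x. \<forall>v\<in>I. (\<Sum>i\<in>I. shift x i * c i v) = y v" using z by (intro exI[of _ x]) simp
  qed
qed

lemma lattice_basis_permute:
  fixes c :: "'v \<Rightarrow> 'v \<Rightarrow> int"
  assumes c: "lattice_basis I c" and g: "bij_betw g I I"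
  shows "lattice_basis I (\<lambda>i. c (g i))"
proof -
  define h where "h = inv_into I g"
  have hg: "h (g i) = i" if "i \<in> I" for i using g that by (simp add: h_def bij_betw_def)
  have gh: "h i \<in> I" "g (h i) = i" if "i \<in> I" for i
    using g that unfolding h_def by (auto simp: bij_betw_def intro: inv_into_into f_inv_into_f)
  have gI: "g i \<in> I" if "i \<in> I" for i using g that by (auto simp: bij_betw_def)
  have reindex: "(\<Sum>i\<in>I. x i * c (g i) v) = (\<Sum>i\<in>I. x (h i) * c i v)" for x v
    using sum.reindex_bij_betw[OF g, of "\<lambda>i. x (h i) * c i v"] by (simp add: hg)
  show ?thesis
    unfolding lattice_basis_def reindex
  proof (intro conjI allI impI ballI)
    fix x i assume "\<forall>v\<in>I. (\<Sum>i\<in>I. x (h i) * c i v) = 0" and i: "i \<in> I"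
    then have "x (h (g i)) = 0" using lattice_basis_independent[OF c, of "\<lambda>i. x (h i)" "g i"] gI by blast
    then show "x i = 0" using hg[OF i] by simp
  next
    fix y :: "'v \<Rightarrow> int"
    obtain x where x: "\<And>v. v \<in> I \<Longrightarrow> (\<Sum>i\<in>I. x i * c i v) = y v"
      using lattice_basis_spans[OF c] by blast
    have "(\<Sum>i\<in>I. x (g (h i)) * c i v) = (\<Sum>i\<in>I. x i * c i v)" for v
      by (intro sum.cong) (simp_all add: gh)
    then show "\<exists>x. \<forall>v\<in>I. (\<Sum>i\<in>I. x (h i) * c i v) = y v"
      using x by (intro exI[of _ "\<lambda>i. x (g i)"]) simp
  qed
qed

section \<open>Quasi-Cartan companions\<close>

definition quasi_cartan_companion :: "'v set \<Rightarrow> ('v \<Rightarrow> 'v \<Rightarrow> int) \<Rightarrow> ('v \<Rightarrow> 'v \<Rightarrow> int) \<Rightarrow> bool" where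
  "quasi_cartan_companion I B A \<longleftrightarrow> (\<forall>i\<in>I. \<forall>j\<in>I. B i j = - B j i \<and> A i j = A j i \<and>
     (if i = j then A i j = 2 else \<bar>A i j\<bar> = \<bar>B i j\<bar>))"

definition oriented_square :: "('v \<Rightarrow> 'v \<Rightarrow> int) \<Rightarrow> 'v \<Rightarrow> 'v \<Rightarrow> 'v \<Rightarrow> 'v \<Rightarrow> bool" where
  "oriented_square B i j k l \<longleftrightarrow> i \<noteq> k \<and> j \<noteq> l \<and> B i k = 0 \<and> B j l = 0 \<and>
     0 < B i j \<and> 0 < B j k \<and> 0 < B k l \<and> 0 < B l i"

definition admissible_companion :: "'v set \<Rightarrow> ('v \<Rightarrow> 'v \<Rightarrow> int) \<Rightarrow> ('v \<Rightarrow> 'v \<Rightarrow> int) \<Rightarrow> bool" where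
  "admissible_companion I B A \<longleftrightarrow> quasi_cartan_companion I B A \<and>
     (\<forall>i\<in>I. \<forall>j\<in>I. \<forall>l\<in>I. i \<noteq> l \<and> 0 < B i j \<and> 0 < B j l \<longrightarrow>
        (0 < B i l \<longrightarrow> A i j * A j l * A i l < 0) \<and> (B i l < 0 \<longrightarrow> 0 < A i j * A j l * A i l)) \<and>
     (\<forall>i\<in>I. \<forall>j\<in>I. \<forall>k\<in>I. \<forall>l\<in>I. oriented_square B i j k l \<longrightarrow> A i j * A j k * A k l * A l i < 0)"

lemma quasi_cartan_companionD:
  assumes "quasi_cartan_companion I B A" "i \<in> I" "j \<in> I"
  shows "B i j = - B j i" "A i j = A j i" "i \<noteq> j \<Longrightarrow> \<bar>A i j\<bar> = \<bar>B i j\<bar>" "A i i = 2" "B i i = 0"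
    "i \<noteq> j \<Longrightarrow> A i j = 0 \<longleftrightarrow> B i j = 0"
proof -
  have all: "B i j = - B j i \<and> A i j = A j i \<and> (if i = j then A i j = 2 else \<bar>A i j\<bar> = \<bar>B i j\<bar>)"
    if "i \<in> I" "j \<in> I" for i j
    using assms(1) that unfolding quasi_cartan_companion_def by blast
  show "B i j = - B j i" "A i j = A j i" using all[OF assms(2,3)] by blast+
  show "A i i = 2" "B i i = 0" using all[OF assms(2,2)] by simp_all
  show abs: "\<bar>A i j\<bar> = \<bar>B i j\<bar>" if "i \<noteq> j" using all[OF assms(2,3)] that by presburger
  show "A i j = 0 \<longleftrightarrow> B i j = 0" if "i \<noteq> j" using abs[OF that] by (metis abs_eq_0)
qed

lemma admissible_companionD:
  assumes "admissible_companion I B A"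
  shows "quasi_cartan_companion I B A"
    "i \<in> I \<Longrightarrow> j \<in> I \<Longrightarrow> l \<in> I \<Longrightarrow> i \<noteq> l \<Longrightarrow> 0 < B i j \<Longrightarrow> 0 < B j l \<Longrightarrow> 0 < B i l \<Longrightarrow> A i j * A j l * A i l < 0"
    "i \<in> I \<Longrightarrow> j \<in> I \<Longrightarrow> l \<in> I \<Longrightarrow> i \<noteq> l \<Longrightarrow> 0 < B i j \<Longrightarrow> 0 < B j l \<Longrightarrow> B i l < 0 \<Longrightarrow> 0 < A i j * A j l * A i l"
    "i \<in> I \<Longrightarrow> j \<in> I \<Longrightarrow> k \<in> I \<Longrightarrow> l \<in> I \<Longrightarrow> oriented_square B i j k l \<Longrightarrow> A i j * A j k * A k l * A l i < 0"
  using assms unfolding admissible_companion_def by blast+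

definition quadratic_form :: "'v set \<Rightarrow> ('v \<Rightarrow> 'v \<Rightarrow> int) \<Rightarrow> ('v \<Rightarrow> int) \<Rightarrow> int" where
  "quadratic_form I A x = (\<Sum>i\<in>I. \<Sum>j\<in>I. x i * x j * A i j)"

definition semidefinite_corank_one :: "'v set \<Rightarrow> ('v \<Rightarrow> 'v \<Rightarrow> int) \<Rightarrow> bool" where
  "semidefinite_corank_one I A \<longleftrightarrow> (\<forall>x. 0 \<le> quadratic_form I A x) \<and>
     (\<exists>\<xi>. (\<exists>i\<in>I. \<xi> i \<noteq> 0) \<and> (\<forall>i\<in>I. (\<Sum>j\<in>I. A i j * \<xi> j) = 0) \<and>
        (\<forall>x. quadratic_form I A x = 0 \<longrightarrow> (\<forall>i\<in>I. \<forall>j\<in>I. x i * \<xi> j = x j * \<xi> i)))"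

subsection \<open>Simultaneous sign changes\<close>

definition signs_on :: "'v set \<Rightarrow> ('v \<Rightarrow> int) \<Rightarrow> bool" where
  "signs_on I D \<longleftrightarrow> (\<forall>i\<in>I. D i = 1 \<or> D i = - 1)"

definition sign_conjugate :: "('v \<Rightarrow> int) \<Rightarrow> ('v \<Rightarrow> 'v \<Rightarrow> int) \<Rightarrow> 'v \<Rightarrow> 'v \<Rightarrow> int" where
  "sign_conjugate D A i j = D i * D j * A i j"

lemma signs_onD: "signs_on I D \<Longrightarrow> i \<in> I \<Longrightarrow> D i = 1 \<or> D i = - 1"
  by (simp add: signs_on_def)

lemma signs_on_square: "signs_on I D \<Longrightarrow> i \<in> I \<Longrightarrow> D i * D i = 1"
  by (auto simp: signs_on_def)

lemma signs_on_cancel: "signs_on I D \<Longrightarrow> i \<in> I \<Longrightarrow> D i * (D i * a) = a"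
  by (auto simp: signs_on_def)

lemma sign_conjugate_triangle:
  assumes "signs_on I D" "i \<in> I" "j \<in> I" "l \<in> I"
  shows "sign_conjugate D A i j * sign_conjugate D A j l * sign_conjugate D A i l = A i j * A j l * A i l"
proof -
  have "sign_conjugate D A i j * sign_conjugate D A j l * sign_conjugate D A i l
      = (D i * D i) * (D j * D j) * (D l * D l) * (A i j * A j l * A i l)"
    unfolding sign_conjugate_def by (simp only: mult_ac)
  then show ?thesis using assms by (simp add: signs_on_square)
qed

lemma sign_conjugate_square:
  assumes "signs_on I D" "i \<in> I" "j \<in> I" "k \<in> I" "l \<in> I"
  shows "sign_conjugate D A i j * sign_conjugate D A j k * sign_conjugate D A k l * sign_conjugate D A l i
    = A i j * A j k * A k l * A l i"
proof -
  have "sign_conjugate D A i j * sign_conjugate D A j k * sign_conjugate D A k l * sign_conjugate D A l i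
      = (D i * D i) * (D j * D j) * (D k * D k) * (D l * D l) * (A i j * A j k * A k l * A l i)"
    unfolding sign_conjugate_def by (simp only: mult_ac)
  then show ?thesis using assms by (simp add: signs_on_square)
qed

lemma quasi_cartan_companion_sign_conjugate:
  assumes A: "quasi_cartan_companion I B A" and D: "signs_on I D"
  shows "quasi_cartan_companion I B (sign_conjugate D A)"
  unfolding quasi_cartan_companion_def
proof (intro ballI conjI)
  fix i j assume ij: "i \<in> I" "j \<in> I"
  note A = quasi_cartan_companionD[OF A ij]
  show "B i j = - B j i" by (rule A(1))
  show "sign_conjugate D A i j = sign_conjugate D A j i"
    using A(2) by (simp add: sign_conjugate_def mult.commute)
  have "\<bar>D i\<bar> = 1" "\<bar>D j\<bar> = 1" using D ij by (auto simp: signs_on_def)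
  then show "if i = j then sign_conjugate D A i j = 2 else \<bar>sign_conjugate D A i j\<bar> = \<bar>B i j\<bar>"
    using A(3,4) signs_on_square[OF D ij(1)]
    by (cases "i = j") (simp_all add: sign_conjugate_def abs_mult)
qed

lemma admissible_companion_sign_conjugate:
  assumes A: "admissible_companion I B A" and D: "signs_on I D"
  shows "admissible_companion I B (sign_conjugate D A)"
  using A quasi_cartan_companion_sign_conjugate[OF _ D]
  by (simp add: admissible_companion_def sign_conjugate_triangle[OF D] sign_conjugate_square[OF D])

lemma semidefinite_corank_one_sign_conjugate:
  assumes A: "semidefinite_corank_one I A" and D: "signs_on I D"
  shows "semidefinite_corank_one I (sign_conjugate D A)"
proof -
  have form: "quadratic_form I (sign_conjugate D A) x = quadratic_form I A (\<lambda>i. D i * x i)" for x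
    unfolding quadratic_form_def sign_conjugate_def by (intro sum.cong refl) (simp only: mult_ac)
  obtain \<xi> where nz: "\<exists>i\<in>I. \<xi> i \<noteq> 0" and null: "\<And>i. i \<in> I \<Longrightarrow> (\<Sum>j\<in>I. A i j * \<xi> j) = 0"
    and proportional: "\<And>x i j. quadratic_form I A x = 0 \<Longrightarrow> i \<in> I \<Longrightarrow> j \<in> I \<Longrightarrow> x i * \<xi> j = x j * \<xi> i"
    using A unfolding semidefinite_corank_one_def by blast
  have "(\<Sum>j\<in>I. sign_conjugate D A i j * (D j * \<xi> j)) = 0" if "i \<in> I" for i
  proof -
    have "(\<Sum>j\<in>I. sign_conjugate D A i j * (D j * \<xi> j)) = (\<Sum>j\<in>I. D i * (A i j * (D j * (D j * \<xi> j))))"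
      unfolding sign_conjugate_def by (intro sum.cong refl) (simp only: mult_ac)
    also have "\<dots> = D i * (\<Sum>j\<in>I. A i j * \<xi> j)"
      by (simp add: signs_on_cancel[OF D] sum_distrib_left)
    finally show ?thesis using null[OF that] by simp
  qed
  moreover have "x i * (D j * \<xi> j) = x j * (D i * \<xi> i)"
    if x: "quadratic_form I (sign_conjugate D A) x = 0" and ij: "i \<in> I" "j \<in> I" for x i j
  proof -
    have "D i * (x i * \<xi> j) = D j * (x j * \<xi> i)"
      using proportional[OF x[unfolded form] ij] by (simp add: mult.assoc)
    then have "D i * D j * (D i * (x i * \<xi> j)) = D i * D j * (D j * (x j * \<xi> i))" by simp
    moreover have "D i * D j * (D i * (x i * \<xi> j)) = D i * (D i * (x i * (D j * \<xi> j)))"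
      "D i * D j * (D j * (x j * \<xi> i)) = D j * (D j * (x j * (D i * \<xi> i)))"
      by (simp_all only: mult_ac)
    ultimately show ?thesis unfolding signs_on_cancel[OF D ij(1)] signs_on_cancel[OF D ij(2)] by simp
  qed
  moreover have "\<exists>i\<in>I. D i * \<xi> i \<noteq> 0" using nz D by (force simp: signs_on_def)
  ultimately show ?thesis
    using A unfolding semidefinite_corank_one_def form by (intro conjI exI[of _ "\<lambda>i. D i * \<xi> i"]) blast+
qed

subsection \<open>Companions from compatible families\<close>

definition companion_mutation ::
  "'v set \<Rightarrow> 'v \<Rightarrow> int \<Rightarrow> ('v \<Rightarrow> 'v \<Rightarrow> int) \<Rightarrow> ('v \<Rightarrow> 'v \<Rightarrow> int) \<Rightarrow> ('v \<Rightarrow> 'v \<Rightarrow> int) \<Rightarrow> bool" where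
  "companion_mutation I k \<epsilon> B A A' \<longleftrightarrow> (\<epsilon> = 1 \<or> \<epsilon> = - 1) \<and>
     (\<forall>i\<in>I - {k}. A' i k = \<epsilon> * sgn (B i k) * A i k) \<and>
     (\<forall>i\<in>I - {k}. \<forall>j\<in>I - {k}. A' i j = (if B i k * B j k < 0 then A i j - A i k * A k j else A i j))"

lemma companion_mutationD:
  assumes "companion_mutation I k \<epsilon> B A A'"
  shows "\<epsilon> = 1 \<or> \<epsilon> = - 1" "i \<in> I - {k} \<Longrightarrow> A' i k = \<epsilon> * sgn (B i k) * A i k"
    "i \<in> I - {k} \<Longrightarrow> j \<in> I - {k} \<Longrightarrow> A' i j = (if B i k * B j k < 0 then A i j - A i k * A k j else A i j)"
  using assms unfolding companion_mutation_def by blast+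

lemma gram_mutation_entry:
  fixes b s b' s' :: int
  assumes "0 < b \<Longrightarrow> s = - b" "b = 0 \<Longrightarrow> s = 0" "0 < b' \<Longrightarrow> s' = - b'" "b' = 0 \<Longrightarrow> s' = 0"
  shows "max 0 b' * s + max 0 b * s' + 2 * (max 0 b * max 0 b') = (if b * b' < 0 then - (s * s') else 0)"
  by (cases b "0 :: int" rule: linorder_cases; cases b' "0 :: int" rule: linorder_cases)
     (use assms in \<open>auto simp: mult_less_0_iff\<close>)

context oriented_affine_graph begin

definition root_companion :: "('v \<Rightarrow> 'v \<Rightarrow> int) \<Rightarrow> ('v \<Rightarrow> 'v \<Rightarrow> int) \<Rightarrow> bool" where
  "root_companion B A \<longleftrightarrow> (\<exists>c. compatible_family c \<and> lattice_basis I c \<and>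
     (\<forall>i\<in>I. \<forall>j\<in>I. B i j = exchange c i j \<and> A i j = gram c i j))"

lemma root_companionE:
  assumes "root_companion B A"
  obtains c where "compatible_family c" "lattice_basis I c"
    "\<And>i j. i \<in> I \<Longrightarrow> j \<in> I \<Longrightarrow> B i j = exchange c i j" "\<And>i j. i \<in> I \<Longrightarrow> j \<in> I \<Longrightarrow> A i j = gram c i j"
  using assms unfolding root_companion_def by blast

lemma root_companion_cong:
  "(\<And>i j. i \<in> I \<Longrightarrow> j \<in> I \<Longrightarrow> B' i j = B i j) \<Longrightarrow> root_companion B' A \<longleftrightarrow> root_companion B A"
  unfolding root_companion_def by simp

lemma root_companion_quasi_cartan:
  assumes "root_companion B A"
  shows "quasi_cartan_companion I B A"
proof -
  obtain c where c: "compatible_family c"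
    and B: "\<And>i j. i \<in> I \<Longrightarrow> j \<in> I \<Longrightarrow> B i j = exchange c i j"
    and A: "\<And>i j. i \<in> I \<Longrightarrow> j \<in> I \<Longrightarrow> A i j = gram c i j"
    using root_companionE[OF assms] by metis
  show ?thesis
    unfolding quasi_cartan_companion_def
  proof (intro ballI conjI)
    fix i j assume ij: "i \<in> I" "j \<in> I"
    show "B i j = - B j i" unfolding B[OF ij] B[OF ij(2,1)] by (rule exchange_skew)
    show "A i j = A j i" unfolding A[OF ij] A[OF ij(2,1)] by (rule gram_sym)
    show "if i = j then A i j = 2 else \<bar>A i j\<bar> = \<bar>B i j\<bar>"
      using compatible_familyD(2)[OF c ij(1)] compatible_familyD(4)[OF c ij] ij
      by (auto simp: A B gram_def exchange_def)
  qed
qed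

lemma companion_mutation_gram:
  assumes k: "E (c k) (c k) = 1" and \<epsilon>: "\<epsilon> = 1 \<or> \<epsilon> = - 1"
    and pivot: "\<And>i. i \<in> I - {k} \<Longrightarrow> 0 < \<epsilon> * exchange c i k \<Longrightarrow> gram c i k = - \<epsilon> * exchange c i k"
    and zero: "\<And>i. i \<in> I - {k} \<Longrightarrow> exchange c i k = 0 \<Longrightarrow> gram c i k = 0"
  shows "companion_mutation I k \<epsilon> (exchange c) (gram c) (gram (mutate_family \<epsilon> k c))"
proof -
  let ?c = "mutate_family \<epsilon> k c"
  define p where "p i = (if i = k then - 2 else max 0 (\<epsilon> * exchange c i k))" for i
  have "?c = (\<lambda>i v. c i v + p i * c k v)" by (simp add: mutate_family_shear p_def fun_eq_iff)
  then have gram: "gram ?c i j = gram c i j + p j * gram c i k + p i * gram c j k + 2 * (p i * p j)" for i j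
    by (simp add: gram_def euler_add_scaled_left euler_add_scaled_right k algebra_simps)
  show ?thesis
    unfolding companion_mutation_def
  proof (intro conjI ballI \<epsilon>)
    fix i assume i: "i \<in> I - {k}"
    have "gram ?c i k = - gram c i k - 2 * max 0 (\<epsilon> * exchange c i k)"
      using i k by (simp add: gram p_def gram_def[of c k k])
    also have "\<dots> = \<epsilon> * sgn (exchange c i k) * gram c i k"
      using \<epsilon> pivot[OF i] zero[OF i] by (auto simp: max_def sgn_if mult_less_0_iff)
    finally show "gram ?c i k = \<epsilon> * sgn (exchange c i k) * gram c i k" .
    fix j assume j: "j \<in> I - {k}"
    let ?b = "\<epsilon> * exchange c i k" and ?b' = "\<epsilon> * exchange c j k"
    have "max 0 ?b' * gram c i k + max 0 ?b * gram c j k + 2 * (max 0 ?b * max 0 ?b')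
        = (if ?b * ?b' < 0 then - (gram c i k * gram c j k) else 0)"
      by (rule gram_mutation_entry) (use pivot[OF i] pivot[OF j] zero[OF i] zero[OF j] \<epsilon> in auto)
    moreover have "?b * ?b' = exchange c i k * exchange c j k" using \<epsilon> by auto
    moreover have "p i = max 0 ?b" "p j = max 0 ?b'" using i j by (simp_all add: p_def)
    ultimately have "gram ?c i j
        = gram c i j + (if exchange c i k * exchange c j k < 0 then - (gram c i k * gram c j k) else 0)"
      by (simp add: gram)
    then show "gram ?c i j
        = (if exchange c i k * exchange c j k < 0 then gram c i j - gram c i k * gram c k j else gram c i j)"
      using gram_sym[of c j k] by simp
  qed
qed

lemma root_companion_mutate:
  assumes BA: "root_companion B A" and k: "k \<in> I"
  obtains A' \<epsilon> where "root_companion (mutate k B) A'" "companion_mutation I k \<epsilon> B A A'"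
proof -
  obtain c where c: "compatible_family c" "lattice_basis I c"
    and B: "\<And>i j. i \<in> I \<Longrightarrow> j \<in> I \<Longrightarrow> B i j = exchange c i j"
    and A: "\<And>i j. i \<in> I \<Longrightarrow> j \<in> I \<Longrightarrow> A i j = gram c i j"
    using root_companionE[OF BA] by metis
  obtain \<epsilon> where \<epsilon>: "\<epsilon> = 1 \<or> \<epsilon> = - 1" and c': "compatible_family (mutate_family \<epsilon> k c)"
    and pivot: "\<And>i. i \<in> I - {k} \<Longrightarrow> 0 < \<epsilon> * exchange c i k \<Longrightarrow> gram c i k = - \<epsilon> * exchange c i k"
    using compatible_family_mutate[OF c(1) k] by blast
  let ?c = "mutate_family \<epsilon> k c"
  note kk = compatible_familyD(2)[OF c(1) k]
  have "gram c i k = 0" if "i \<in> I - {k}" "exchange c i k = 0" for i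
    using quasi_cartan_companionD(6)[OF root_companion_quasi_cartan[OF BA], of i k] that k A B by auto
  then have "companion_mutation I k \<epsilon> (exchange c) (gram c) (gram ?c)"
    by (intro companion_mutation_gram[OF kk \<epsilon> pivot])
  then have "companion_mutation I k \<epsilon> B A (gram ?c)"
    using k by (simp add: companion_mutation_def A B)
  moreover have "lattice_basis I ?c"
    unfolding mutate_family_shear by (rule lattice_basis_shear[OF c(2) fin k]) simp
  moreover have "mutate k B i j = exchange ?c i j" if "i \<in> I" "j \<in> I" for i j
    using exchange_mutate_family[of c k, OF kk \<epsilon>] mutate_cong[of I B "exchange c", OF B that k] by simp
  ultimately show ?thesis
    using that[of "gram ?c" \<epsilon>] c' unfolding root_companion_def by blast
qed

lemma root_companion_permute:
  assumes BA: "root_companion B A" and g: "bij_betw g I I"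
    and inv: "\<And>i j. i \<in> I \<Longrightarrow> j \<in> I \<Longrightarrow> B (g i) (g j) = B i j"
  shows "root_companion B (\<lambda>i j. A (g i) (g j))"
proof -
  obtain c where c: "compatible_family c" "lattice_basis I c"
    and B: "\<And>i j. i \<in> I \<Longrightarrow> j \<in> I \<Longrightarrow> B i j = exchange c i j"
    and A: "\<And>i j. i \<in> I \<Longrightarrow> j \<in> I \<Longrightarrow> A i j = gram c i j"
    using root_companionE[OF BA] by metis
  have gI: "g i \<in> I" if "i \<in> I" for i using g that by (auto simp: bij_betw_def)
  have "compatible_family (\<lambda>i. c (g i))"
    unfolding compatible_family_def
  proof (intro conjI ballI impI)
    show "compatible L (c (g i)) (c (g j))" if "i \<in> I" "j \<in> I" "i \<noteq> j" for i j
      using compatible_familyD(3)[OF c(1) gI gI] g that by (auto simp: bij_betw_def inj_on_def)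
    obtain l where "l \<in> g ` I" "E \<delta> (c l) \<noteq> 0"
      using c(1) g by (auto simp: compatible_family_def bij_betw_def)
    then show "\<exists>l\<in>I. E \<delta> (c (g l)) \<noteq> 0" by blast
  qed (use compatible_familyD(1)[OF c(1)] gI in blast)
  moreover have "B i j = exchange (\<lambda>i. c (g i)) i j" "A (g i) (g j) = gram (\<lambda>i. c (g i)) i j"
    if "i \<in> I" "j \<in> I" for i j
    using inv[OF that] B[OF gI[OF that(1)] gI[OF that(2)]] A[OF gI[OF that(1)] gI[OF that(2)]]
    by (simp_all add: exchange_def gram_def)
  ultimately show ?thesis
    using lattice_basis_permute[OF c(2) g] unfolding root_companion_def by blast
qed

subsection \<open>Admissibility and corank\<close>

lemma root_companion_triangle:
  assumes BA: "root_companion B A"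
    and ijl: "i \<in> I" "j \<in> I" "l \<in> I" "i \<noteq> l" "0 < B i j" "0 < B j l"
  shows "0 < B i l \<Longrightarrow> A i j * A j l * A i l < 0" "B i l < 0 \<Longrightarrow> 0 < A i j * A j l * A i l"
proof -
  note companionD = quasi_cartan_companionD[OF root_companion_quasi_cartan[OF BA]]
  have ne: "i \<noteq> j" "j \<noteq> l" using ijl companionD(5)[OF ijl(2,2)] by auto
  obtain A' \<epsilon> where A': "root_companion (mutate j B) A'" and step: "companion_mutation I j \<epsilon> B A A'"
    using root_companion_mutate[OF BA ijl(2)] by blast
  have "B l j < 0" using companionD(1)[OF ijl(2,3)] ijl(6) by simp
  then have "A' i l = A i l - A i j * A j l"
    using companion_mutationD(3)[OF step, of i l] ne ijl by (simp add: mult_less_0_iff)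
  moreover have "mutate j B i l = B i l + B i j * B j l"
    using ne ijl unfolding mutate_def mutation_term by simp
  ultimately have "\<bar>A i l - A i j * A j l\<bar> = \<bar>B i l + B i j * B j l\<bar>"
    using quasi_cartan_companionD(3)[OF root_companion_quasi_cartan[OF A'] ijl(1,3,4)] by simp
  moreover have "\<bar>A i l\<bar> = \<bar>B i l\<bar>" "\<bar>A i j * A j l\<bar> = B i j * B j l"
    using companionD(3)[OF ijl(1,3,4)] companionD(3)[OF ijl(1,2) ne(1)] companionD(3)[OF ijl(2,3) ne(2)]
      ijl(5,6)
    by (simp_all add: abs_mult)
  moreover have "0 < B i j * B j l" using ijl(5,6) by simp
  ultimately have "0 < B i l \<Longrightarrow> 0 < A i j * A j l \<and> A i l < 0 \<or> A i j * A j l < 0 \<and> 0 < A i l"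
    "B i l < 0 \<Longrightarrow> 0 < A i j * A j l \<and> 0 < A i l \<or> A i j * A j l < 0 \<and> A i l < 0"
    by arith+
  then show "0 < B i l \<Longrightarrow> A i j * A j l * A i l < 0" "B i l < 0 \<Longrightarrow> 0 < A i j * A j l * A i l"
    by (auto intro: mult_pos_neg mult_neg_pos mult_neg_neg)
qed

text \<open>Mutating at one corner of an oriented square turns the remaining three corners into a triangle.\<close>

lemma root_companion_square:
  assumes BA: "root_companion B A" and I: "i \<in> I" "j \<in> I" "k \<in> I" "l \<in> I"
    and square: "oriented_square B i j k l"
  shows "A i j * A j k * A k l * A l i < 0"
proof -
  note companionD = quasi_cartan_companionD[OF root_companion_quasi_cartan[OF BA]]
  have sq: "i \<noteq> k" "j \<noteq> l" "B i k = 0" "B j l = 0" "0 < B i j" "0 < B j k" "0 < B k l" "0 < B l i"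
    using square by (simp_all add: oriented_square_def)
  have ne: "i \<noteq> j" "j \<noteq> k" "k \<noteq> l" "l \<noteq> i" using sq(5-8) companionD(5) I by fastforce+
  have rev: "B k i = 0" "B l j = 0" "B j i = - B i j" "B l k = - B k l" "A l j = 0" "A l k = A k l"
    using companionD(1)[OF I(3,1)] companionD(1)[OF I(4,2)] companionD(1)[OF I(2,1)]
      companionD(1)[OF I(4,3)] companionD(6)[OF I(4,2)] companionD(2)[OF I(4,3)] sq
    by auto
  obtain A' \<epsilon> where A': "root_companion (mutate i B) A'" and step: "companion_mutation I i \<epsilon> B A A'"
    using root_companion_mutate[OF BA I(1)] by blast
  have "mutate i B l j = B l i * B i j" "mutate i B j k = B j k" "mutate i B l k = - B k l"
    using ne sq rev unfolding mutate_def mutation_term by auto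
  then have "0 < mutate i B l j" "0 < mutate i B j k" "mutate i B l k < 0" using sq by simp_all
  then have "0 < A' l j * A' j k * A' l k"
    using root_companion_triangle(2)[OF A' I(4,2,3)] ne by blast
  moreover have "B l i * B j i < 0" using sq rev by (simp add: mult_less_0_iff)
  then have "A' l j = - (A l i * A i j)"
    using companion_mutationD(3)[OF step, of l j] I ne rev by simp
  moreover have "A' j k = A j k" "A' l k = A l k"
    using companion_mutationD(3)[OF step, of j k] companion_mutationD(3)[OF step, of l k] I ne sq rev by auto
  ultimately have "0 < - (A l i * A i j) * A j k * A k l" using rev by simp
  also have "- (A l i * A i j) * A j k * A k l = - (A i j * A j k * A k l * A l i)" by (simp add: algebra_simps)
  finally show ?thesis by linarith
qed

lemma root_companion_admissible: "root_companion B A \<Longrightarrow> admissible_companion I B A"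
  using root_companion_quasi_cartan root_companion_triangle root_companion_square
  unfolding admissible_companion_def by blast

lemma quadratic_form_gram:
  assumes A: "\<And>i j. i \<in> I \<Longrightarrow> j \<in> I \<Longrightarrow> A i j = gram c i j"
  shows "quadratic_form I A x = cartan_form I (\<lambda>v. \<Sum>i\<in>I. x i * c i v)"
proof -
  let ?S = "\<lambda>v. \<Sum>i\<in>I. x i * c i v"
  have "E ?S ?S = (\<Sum>i\<in>I. \<Sum>j\<in>I. x i * (x j * E (c i) (c j)))"
    using fin by (simp add: euler_sum_left euler_sum_right euler_scale_left euler_scale_right sum_distrib_left)
  moreover from this have "E ?S ?S = (\<Sum>i\<in>I. \<Sum>j\<in>I. x j * (x i * E (c j) (c i)))"
    by (subst sum.swap) simp
  moreover have "quadratic_form I A x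
      = (\<Sum>i\<in>I. \<Sum>j\<in>I. x i * (x j * E (c i) (c j))) + (\<Sum>i\<in>I. \<Sum>j\<in>I. x j * (x i * E (c j) (c i)))"
    by (simp add: quadratic_form_def A gram_def algebra_simps sum.distrib)
  ultimately show ?thesis using euler_self[OF distinct_L, of ?S] set_L by simp
qed

lemma gram_rows:
  assumes "\<And>i j. i \<in> I \<Longrightarrow> j \<in> I \<Longrightarrow> A i j = gram c i j" "i \<in> I"
  shows "(\<Sum>j\<in>I. A i j * x j) = E (c i) (\<lambda>v. \<Sum>j\<in>I. x j * c j v) + E (\<lambda>v. \<Sum>j\<in>I. x j * c j v) (c i)"
  using assms fin by (simp add: gram_def euler_sum_left euler_sum_right euler_scale_left euler_scale_right
      algebra_simps sum.distrib)

lemma root_companion_corank_one: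
  assumes "root_companion B A"
  shows "semidefinite_corank_one I A"
proof -
  obtain c where c: "lattice_basis I c" and A: "\<And>i j. i \<in> I \<Longrightarrow> j \<in> I \<Longrightarrow> A i j = gram c i j"
    using root_companionE[OF assms] by metis
  define S where "S x = (\<lambda>v. \<Sum>i\<in>I. x i * c i v)" for x
  have form: "quadratic_form I A x = cartan_form I (S x)" for x
    unfolding S_def using A by (rule quadratic_form_gram)
  obtain \<xi> where \<xi>: "S \<xi> v = \<delta> v" if "v \<in> I" for v
    using lattice_basis_spans[OF c, of \<delta>] unfolding S_def by blast
  obtain v0 where v0: "v0 \<in> I" using nonempty by blast
  have "\<exists>i\<in>I. \<xi> i \<noteq> 0"
  proof (rule ccontr)
    assume "\<not> ?thesis"
    then have "S \<xi> v0 = 0" by (simp add: S_def)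
    then show False using \<xi>[OF v0] delta_pos[OF v0] by simp
  qed
  moreover have "(\<Sum>j\<in>I. A i j * \<xi> j) = 0" if "i \<in> I" for i
  proof -
    have "(\<Sum>j\<in>I. A i j * \<xi> j) = E (c i) (S \<xi>) + E (S \<xi>) (c i)" unfolding S_def by (rule gram_rows[OF A that])
    also have "\<dots> = E (c i) \<delta> + E \<delta> (c i)"
      using set_L \<xi> euler_cong[of L "c i" "c i" "S \<xi>" \<delta>] euler_cong[of L "S \<xi>" \<delta> "c i" "c i"] by simp
    finally show ?thesis using euler_delta_right[OF distinct_L set_L] by simp
  qed
  moreover have "x i * \<xi> j = x j * \<xi> i" if x: "quadratic_form I A x = 0" and ij: "i \<in> I" "j \<in> I" for x i j
  proof -
    have "S x v * \<delta> v0 - S x v0 * S \<xi> v = 0" if "v \<in> I" for v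
      using cartan_form_null_proportional[OF x[unfolded form] that v0] \<xi>[OF that] by simp
    moreover have "(\<Sum>i\<in>I. (x i * d - a * \<xi> i) * c i v) = S x v * d - a * S \<xi> v" for a d v
      by (simp add: S_def algebra_simps sum_subtractf sum_distrib_left)
    ultimately have "(\<Sum>i\<in>I. (x i * \<delta> v0 - S x v0 * \<xi> i) * c i v) = 0" if "v \<in> I" for v
      using that by simp
    then have scaled: "x i * \<delta> v0 = S x v0 * \<xi> i" if "i \<in> I" for i
      using lattice_basis_independent[OF c, of "\<lambda>i. x i * \<delta> v0 - S x v0 * \<xi> i" i] that by simp
    have "\<delta> v0 * (x i * \<xi> j) = (x i * \<delta> v0) * \<xi> j" by simp
    also have "\<dots> = (x j * \<delta> v0) * \<xi> i" unfolding scaled[OF ij(1)] scaled[OF ij(2)] by simp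
    also have "\<dots> = \<delta> v0 * (x j * \<xi> i)" by simp
    finally show ?thesis using delta_pos[OF v0] by simp
  qed
  ultimately show ?thesis
    unfolding semidefinite_corank_one_def form using cartan_form_nonneg by blast
qed

end

subsection \<open>Uniqueness up to signs\<close>

definition sign_equivalent :: "'v set \<Rightarrow> ('v \<Rightarrow> 'v \<Rightarrow> int) \<Rightarrow> ('v \<Rightarrow> 'v \<Rightarrow> int) \<Rightarrow> bool" where
  "sign_equivalent I A A' \<longleftrightarrow> (\<exists>D. signs_on I D \<and> (\<forall>i\<in>I. \<forall>j\<in>I. A' i j = sign_conjugate D A i j))"

lemma sign_equivalent_companion_mutation:
  assumes A1: "quasi_cartan_companion I B A1" "companion_mutation I k e1 B A1 A1'"
    and A2: "quasi_cartan_companion I B A2" "companion_mutation I k e2 B A2 A2'"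
    and k: "k \<in> I" and equiv: "sign_equivalent I A1' A2'"
  shows "sign_equivalent I A1 A2"
proof -
  note Q1 = quasi_cartan_companionD[OF A1(1)] and Q2 = quasi_cartan_companionD[OF A2(1)]
  note M1 = companion_mutationD[OF A1(2)] and M2 = companion_mutationD[OF A2(2)]
  obtain D where D: "signs_on I D" and A': "\<And>i j. i \<in> I \<Longrightarrow> j \<in> I \<Longrightarrow> A2' i j = D i * D j * A1' i j"
    using equiv unfolding sign_equivalent_def sign_conjugate_def by blast
  define D' where "D' = D(k := e1 * e2 * D k)"
  have D': "signs_on I D'" using D k M1(1) M2(1) by (auto simp: signs_on_def D'_def)
  have column: "A2 i k = D' i * D' k * A1 i k" if i: "i \<in> I - {k}" for i
  proof (cases "B i k = 0")
    case True
    then show ?thesis using Q1(6)[of i k] Q2(6)[of i k] i k by simp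
  next
    case False
    have "e2 * sgn (B i k) * A2 i k = D i * D k * (e1 * sgn (B i k) * A1 i k)"
      using A'[of i k] M1(2)[OF i] M2(2)[OF i] i k by simp
    then have "sgn (B i k) * (e2 * A2 i k) = sgn (B i k) * (e1 * (D i * D k * A1 i k))"
      by (simp add: algebra_simps)
    then have "e2 * A2 i k = e1 * (D i * D k * A1 i k)" using False by (simp add: sgn_0_0)
    then have "A2 i k = e1 * e2 * (D i * D k * A1 i k)" using M1(1) M2(1) by auto
    then show ?thesis using i by (simp add: D'_def mult_ac)
  qed
  have row: "A2 k i = D' k * D' i * A1 k i" if i: "i \<in> I - {k}" for i
    using column[OF i] Q1(2)[of i k] Q2(2)[of i k] i k by (simp add: mult_ac)
  have other: "A2 i j = D' i * D' j * A1 i j" if ij: "i \<in> I - {k}" "j \<in> I - {k}" for i j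
  proof -
    have "A2' i j = D' i * D' j * A1' i j" using A'[of i j] ij by (simp add: D'_def)
    moreover have "A2 i k * A2 k j = D' i * D' j * ((D' k * D' k) * (A1 i k * A1 k j))"
      unfolding column[OF ij(1)] row[OF ij(2)] by (simp only: mult_ac)
    then have "A2 i k * A2 k j = D' i * D' j * (A1 i k * A1 k j)"
      by (simp add: signs_on_square[OF D' k])
    ultimately show ?thesis unfolding M1(3)[OF ij] M2(3)[OF ij] by (auto simp: algebra_simps split: if_splits)
  qed
  have "A2 i j = sign_conjugate D' A1 i j" if "i \<in> I" "j \<in> I" for i j
    using column[of i] row[of j] other[of i j] that Q1(4)[OF k k] Q2(4)[OF k k] signs_on_square[OF D' k]
    by (cases "i = k"; cases "j = k") (simp_all add: sign_conjugate_def)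
  then show ?thesis using D' unfolding sign_equivalent_def by blast
qed

context oriented_affine_graph begin

definition sign_rigid :: "('v \<Rightarrow> 'v \<Rightarrow> int) \<Rightarrow> bool" where
  "sign_rigid B \<longleftrightarrow> (\<forall>A A'. root_companion B A \<longrightarrow> root_companion B A' \<longrightarrow> sign_equivalent I A A')"

lemma sign_rigid_cong:
  "(\<And>i j. i \<in> I \<Longrightarrow> j \<in> I \<Longrightarrow> B' i j = B i j) \<Longrightarrow> sign_rigid B' \<longleftrightarrow> sign_rigid B"
  using root_companion_cong[of B' B] unfolding sign_rigid_def by simp

lemma sign_rigid_mutate:
  assumes B: "sign_rigid B" and k: "k \<in> I"
  shows "sign_rigid (mutate k B)"
  unfolding sign_rigid_def
proof (intro allI impI)
  have unmutate: "\<exists>A' \<epsilon>. root_companion B A' \<and> companion_mutation I k \<epsilon> (mutate k B) A A'"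
    if A: "root_companion (mutate k B) A" for A
  proof -
    obtain A' \<epsilon> where "root_companion (mutate k (mutate k B)) A'" "companion_mutation I k \<epsilon> (mutate k B) A A'"
      using root_companion_mutate[OF A k] by blast
    moreover have "root_companion (mutate k (mutate k B)) A' \<longleftrightarrow> root_companion B A'"
      by (rule root_companion_cong) simp
    ultimately show ?thesis by blast
  qed
  fix A1 A2 assume A: "root_companion (mutate k B) A1" "root_companion (mutate k B) A2"
  obtain A1' e1 where A1': "root_companion B A1'" "companion_mutation I k e1 (mutate k B) A1 A1'"
    using unmutate[OF A(1)] by blast
  obtain A2' e2 where A2': "root_companion B A2'" "companion_mutation I k e2 (mutate k B) A2 A2'"
    using unmutate[OF A(2)] by blast
  have "sign_equivalent I A1' A2'" using B A1'(1) A2'(1) unfolding sign_rigid_def by blast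
  then show "sign_equivalent I A1 A2"
    by (rule sign_equivalent_companion_mutation[OF root_companion_quasi_cartan[OF A(1)] A1'(2)
          root_companion_quasi_cartan[OF A(2)] A2'(2) k])
qed

lemma automorphism_signs:
  assumes "sign_rigid B" "root_companion B A" "bij_betw g I I"
    and "\<And>i j. i \<in> I \<Longrightarrow> j \<in> I \<Longrightarrow> B (g i) (g j) = B i j"
  obtains D where "signs_on I D" "\<And>i j. i \<in> I \<Longrightarrow> j \<in> I \<Longrightarrow> A (g i) (g j) = D i * D j * A i j"
proof -
  have "sign_equivalent I A (\<lambda>i j. A (g i) (g j))"
    using root_companion_permute[OF assms(2-4)] assms(1,2) unfolding sign_rigid_def by blast
  then show ?thesis using that unfolding sign_equivalent_def sign_conjugate_def by blast
qed

end

subsection \<open>Automorphisms\<close>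

definition connected_matrix :: "'v set \<Rightarrow> ('v \<Rightarrow> 'v \<Rightarrow> int) \<Rightarrow> bool" where
  "connected_matrix I B \<longleftrightarrow> (\<forall>S. S \<subseteq> I \<longrightarrow> S \<noteq> {} \<longrightarrow> (\<forall>i\<in>S. \<forall>j\<in>I - S. B i j = 0) \<longrightarrow> S = I)"

lemma connected_matrixD:
  "connected_matrix I B \<Longrightarrow> S \<subseteq> I \<Longrightarrow> S \<noteq> {} \<Longrightarrow> (\<And>i j. i \<in> S \<Longrightarrow> j \<in> I - S \<Longrightarrow> B i j = 0) \<Longrightarrow> S = I"
  unfolding connected_matrix_def by blast

lemma connected_matrix_cong:
  assumes "\<And>i j. i \<in> I \<Longrightarrow> j \<in> I \<Longrightarrow> B' i j = B i j" "connected_matrix I B"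
  shows "connected_matrix I B'"
  unfolding connected_matrix_def
proof (intro allI impI)
  fix S assume S: "S \<subseteq> I" "S \<noteq> {}" "\<forall>i\<in>S. \<forall>j\<in>I - S. B' i j = 0"
  then show "S = I" using assms(1) by (intro connected_matrixD[OF assms(2) S(1,2)]) (metis DiffD1 subsetD)
qed

lemma connected_matrix_mutate:
  assumes B: "connected_matrix I B" and k: "k \<in> I"
  shows "connected_matrix I (mutate k B)"
  unfolding connected_matrix_def
proof (intro allI impI)
  have separated: "mutate k C i j = 0"
    if "\<And>i j. i \<in> S \<Longrightarrow> j \<in> I - S \<Longrightarrow> C i j = 0" "i \<in> S" "j \<in> I - S" for C S i j
    using that(1)[OF that(2,3)] that(1)[OF _ that(3), of k] that(1)[OF that(2), of k] k
    by (cases "k \<in> S") (simp_all add: mutate_def)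
  fix S assume S: "S \<subseteq> I" "S \<noteq> {}" "\<forall>i\<in>S. \<forall>j\<in>I - S. mutate k B i j = 0"
  have "B i j = 0" if "i \<in> S" "j \<in> I - S" for i j
    using separated[of S "mutate k B" i j] S(3) that by simp
  then show "S = I" by (rule connected_matrixD[OF B S(1,2)])
qed

definition foldable :: "'v set \<Rightarrow> ('v \<Rightarrow> 'v \<Rightarrow> int) \<Rightarrow> 'v \<Rightarrow> 'v \<Rightarrow> bool" where
  "foldable I B i i' \<longleftrightarrow> B i i' = 0 \<and> (\<forall>j\<in>I. 0 \<le> B i j * B i' j)"

text \<open>If \<open>i \<rightarrow> j \<rightarrow> g i\<close> for an involutive automorphism \<open>g\<close>, then also \<open>g i \<rightarrow> g j \<rightarrow> i\<close>.\<close>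

lemma involution_foldable:
  assumes skew: "\<And>i j. i \<in> I \<Longrightarrow> j \<in> I \<Longrightarrow> B i j = - B j i"
    and g: "\<And>i. i \<in> I \<Longrightarrow> g i \<in> I" "\<And>i. i \<in> I \<Longrightarrow> g (g i) = i"
    and inv: "\<And>i j. i \<in> I \<Longrightarrow> j \<in> I \<Longrightarrow> B (g i) (g j) = B i j"
    and no_square: "\<And>i j. i \<in> I \<Longrightarrow> j \<in> I \<Longrightarrow> \<not> oriented_square B i j (g i) (g j)" and i: "i \<in> I"
  shows "foldable I B i (g i)"
proof -
  have zero: "B i (g i) = 0" if "i \<in> I" for i
    using inv[OF that g(1)[OF that]] g(2)[OF that] skew[OF that g(1)[OF that]] by simp
  have no_path: "\<not> (0 < B i j \<and> B (g i) j < 0)" if ij: "i \<in> I" "j \<in> I" for i j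
  proof
    assume path: "0 < B i j \<and> B (g i) j < 0"
    then have "0 < B j (g i)" using skew[OF g(1)[OF ij(1)] ij(2)] by simp
    moreover have "0 < B (g i) (g j)" "0 < B (g j) i"
      using inv[OF ij] inv[OF ij(2) g(1)[OF ij(1)]] g(2)[OF ij(1)] path \<open>0 < B j (g i)\<close> by simp_all
    moreover have "i \<noteq> g i" "j \<noteq> g j" using path \<open>0 < B (g i) (g j)\<close> by auto
    ultimately have "oriented_square B i j (g i) (g j)"
      using path zero ij by (simp add: oriented_square_def)
    then show False using no_square[OF ij] by blast
  qed
  have "0 \<le> B i j * B (g i) j" if j: "j \<in> I" for j
    using no_path[OF i j] no_path[OF g(1)[OF i] j] g(2)[OF i] by (simp add: zero_le_mult_iff) linarith
  then show ?thesis using zero[OF i] by (simp add: foldable_def)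
qed

context oriented_affine_graph begin

lemma sign_rigid_involution_signs:
  assumes BA: "root_companion B A" "sign_rigid B" "connected_matrix I B"
    and g: "\<And>i. i \<in> I \<Longrightarrow> g i \<in> I" "\<And>i. i \<in> I \<Longrightarrow> g (g i) = i" and f: "f \<in> I" "g f = f"
    and inv: "\<And>i j. i \<in> I \<Longrightarrow> j \<in> I \<Longrightarrow> B (g i) (g j) = B i j"
  obtains D where "signs_on I D" "\<And>i j. i \<in> I \<Longrightarrow> j \<in> I \<Longrightarrow> A (g i) (g j) = D i * D j * A i j"
    "\<And>i. i \<in> I \<Longrightarrow> D (g i) = D i"
proof -
  have "bij_betw g I I" using g by (intro bij_betw_byWitness[where f' = g]) auto
  then obtain D where D: "signs_on I D"
    and A: "\<And>i j. i \<in> I \<Longrightarrow> j \<in> I \<Longrightarrow> A (g i) (g j) = D i * D j * A i j"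
    using automorphism_signs[OF BA(2,1) _ inv] by blast
  define S where "S = {i\<in>I. D (g i) = D i}"
  have "S = I"
  proof (rule connected_matrixD[OF BA(3)])
    show "S \<subseteq> I" "S \<noteq> {}" using f by (auto simp: S_def)
    fix x y assume xy: "x \<in> S" "y \<in> I - S"
    then have I: "x \<in> I" "y \<in> I" "g x \<in> I" "g y \<in> I" using g by (auto simp: S_def)
    have "A x y = D (g x) * D (g y) * (D x * D y * A x y)"
      using A[OF I(3,4)] A[OF I(1,2)] g I by simp
    moreover have "D (g x) * D (g y) * (D x * D y * a) = - a" for a
      using xy signs_onD[OF D I(1)] signs_onD[OF D I(2)] signs_onD[OF D I(4)] by (auto simp: S_def)
    ultimately have "A x y = 0" by simp
    then show "B x y = 0"
      using quasi_cartan_companionD(6)[OF root_companion_quasi_cartan[OF BA(1)] I(1,2)] xy by auto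
  qed
  then show ?thesis using that[OF D A] by (auto simp: S_def)
qed

lemma sign_rigid_involution_no_square:
  assumes BA: "root_companion B A" "sign_rigid B" "connected_matrix I B"
    and g: "\<And>i. i \<in> I \<Longrightarrow> g i \<in> I" "\<And>i. i \<in> I \<Longrightarrow> g (g i) = i" and f: "f \<in> I" "g f = f"
    and inv: "\<And>i j. i \<in> I \<Longrightarrow> j \<in> I \<Longrightarrow> B (g i) (g j) = B i j"
    and ij: "i \<in> I" "j \<in> I"
  shows "\<not> oriented_square B i j (g i) (g j)"
proof
  assume "oriented_square B i j (g i) (g j)"
  then have neg: "A i j * A j (g i) * A (g i) (g j) * A (g j) i < 0"
    using root_companion_square[OF BA(1)] ij g(1) by blast
  obtain D where D: "signs_on I D" and A: "\<And>i j. i \<in> I \<Longrightarrow> j \<in> I \<Longrightarrow> A (g i) (g j) = D i * D j * A i j"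
    and Dg: "\<And>i. i \<in> I \<Longrightarrow> D (g i) = D i"
    using sign_rigid_involution_signs[OF BA g f inv] by blast
  have "A (g j) i = D j * D i * A j (g i)"
    using A[OF ij(2) g(1)[OF ij(1)]] g(2)[OF ij(1)] Dg[OF ij(1)] by simp
  then have "A i j * A j (g i) * A (g i) (g j) * A (g j) i
      = (D i * D i) * (D j * D j) * ((A i j * A i j) * (A j (g i) * A j (g i)))"
    unfolding A[OF ij] by (simp only: mult_ac)
  also have "\<dots> = (A i j * A i j) * (A j (g i) * A j (g i))"
    by (simp add: signs_on_square[OF D ij(1)] signs_on_square[OF D ij(2)])
  also have "0 \<le> \<dots>" by (intro mult_nonneg_nonneg zero_le_square)
  finally show False using neg by simp
qed

end

section \<open>Quivers of affine type\<close>

lemma topological_order: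
  assumes "finite S" "finite r" "acyclic r"
  obtains L where "distinct L" "set L = S" "sorted_wrt (\<lambda>u v. (v, u) \<notin> r) L"
proof -
  have wf: "wf r" using assms by (intro finite_acyclic_wf)
  have "\<exists>L. distinct L \<and> set L = S \<and> sorted_wrt (\<lambda>u v. (v, u) \<notin> r) L"
    using assms(1)
  proof (induction S rule: finite_psubset_induct)
    case (psubset S)
    show ?case
    proof (cases "S = {}")
      case False
      then obtain s where s: "s \<in> S" "\<And>y. (y, s) \<in> r \<Longrightarrow> y \<notin> S"
        using wfE_min[OF wf, of _ S] by blast
      then obtain L where L: "distinct L" "set L = S - {s}" "sorted_wrt (\<lambda>u v. (v, u) \<notin> r) L"
        using psubset.IH[of "S - {s}"] by blast
      have "sorted_wrt (\<lambda>u v. (v, u) \<notin> r) (s # L)" using s(2) L(2,3) by auto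
      moreover have "distinct (s # L)" "set (s # L) = S" using L(1,2) s(1) by auto
      ultimately show ?thesis by blast
    qed simp
  qed
  then show ?thesis using that by blast
qed

definition graph_weight :: "nat set set \<Rightarrow> nat \<Rightarrow> nat \<Rightarrow> int" where
  "graph_weight X i j = (if i \<noteq> j \<and> {i, j} \<in> X then 1 else 0)"

lemma weighted_graph_graph_weight: "weighted_graph (graph_weight X)"
  by unfold_locales (auto simp: graph_weight_def insert_commute)

lemma adj_skew: "adj Q i j = - adj Q j i"
  and adj_self [simp]: "adj Q i i = 0"
  by (simp_all add: adj_def)

lemma count_underlying_graph:
  assumes "has_underlying_graph Q X" "finite X" "i \<noteq> j"
  shows "int (count Q (i, j)) + int (count Q (j, i)) = graph_weight X i j"
proof -
  let ?f = "\<lambda>(i::nat, j). {i, j}"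
  have fibre: "?f -` {{i, j}} = {(i, j), (j, i)}"
  proof (rule Set.set_eqI)
    show "e \<in> ?f -` {{i, j}} \<longleftrightarrow> e \<in> {(i, j), (j, i)}" for e
      by (cases e) (simp add: doubleton_eq_iff)
  qed
  have "count (image_mset ?f Q) {i, j} = (\<Sum>e\<in>{(i, j), (j, i)} \<inter> set_mset Q. count Q e)"
    by (simp only: count_image_mset fibre)
  also have "\<dots> = (\<Sum>e\<in>{(i, j), (j, i)}. count Q e)"
    by (rule sum.mono_neutral_left) (auto simp: not_in_iff)
  finally have "count (image_mset ?f Q) {i, j} = count Q (i, j) + count Q (j, i)" using assms(3) by simp
  then have "count Q (i, j) + count Q (j, i) = (if {i, j} \<in> X then 1 else 0)"
    using assms(1,2) by (simp add: has_underlying_graph_def count_mset_set')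
  then have "int (count Q (i, j) + count Q (j, i)) = (if {i, j} \<in> X then 1 else 0)" by simp
  then show ?thesis using assms(3) by (simp add: graph_weight_def)
qed

subsection \<open>Mutation equivalence\<close>

lemma is_mutation_adj:
  "is_mutation N k Q Q' \<Longrightarrow> i \<in> {1..N} \<Longrightarrow> j \<in> {1..N} \<Longrightarrow> adj Q' i j = mutate k (adj Q) i j"
  by (simp add: is_mutation_def mutated_adj_def mutate_def)

lemma is_mutation_sym:
  assumes Q: "is_mutation N k Q Q'"
  shows "is_mutation N k Q' Q"
proof -
  have k: "k \<in> {1..N}" using Q by (simp add: is_mutation_def)
  have "mutated_adj k Q' i j = adj Q i j" if "i \<in> {1..N}" "j \<in> {1..N}" for i j
  proof -
    have "mutated_adj k Q' i j = mutate k (adj Q') i j" by (simp add: mutated_adj_def mutate_def)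
    also have "\<dots> = mutate k (mutate k (adj Q)) i j"
      using is_mutation_adj[OF Q] that k by (rule mutate_cong)
    finally show ?thesis by simp
  qed
  then show ?thesis using Q by (simp add: is_mutation_def)
qed

lemma mutation_equivalent_invariant:
  assumes "mutation_equivalent N Q Q0" and base: "P (adj Q0)"
    and cong: "\<And>B B'. (\<And>i j. i \<in> {1..N} \<Longrightarrow> j \<in> {1..N} \<Longrightarrow> B' i j = B i j) \<Longrightarrow> P B \<Longrightarrow> P B'"
    and step: "\<And>B k. k \<in> {1..N} \<Longrightarrow> P B \<Longrightarrow> P (mutate k B)"
  shows "P (adj Q)"
proof -
  let ?R = "\<lambda>P P'. \<exists>k. is_mutation N k P P'"
  have "symp ?R\<^sup>*\<^sup>*" by (intro symp_rtranclp) (auto simp: symp_def intro: is_mutation_sym)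
  then have "?R\<^sup>*\<^sup>* Q0 Q" using assms(1) unfolding mutation_equivalent_def by (blast dest: sympD)
  then show ?thesis
  proof (induction rule: rtranclp_induct)
    case (step Q1 Q2)
    then obtain k where k: "is_mutation N k Q1 Q2" by blast
    then have "k \<in> {1..N}" by (simp add: is_mutation_def)
    then have "P (mutate k (adj Q1))" using assms(4) step.IH by blast
    then show ?case using cong[of "adj Q2" "mutate k (adj Q1)"] is_mutation_adj[OF k] by blast
  qed (rule base)
qed

subsection \<open>The initial family\<close>

abbreviation unit_vector :: "'v \<Rightarrow> 'v \<Rightarrow> int" where
  "unit_vector i \<equiv> (\<lambda>v. if v = i then 1 else 0)"

lemma (in weighted_graph) euler_unit_vectors:
  assumes "distinct L" "sorted_wrt R L" "i \<in> set L" "j \<in> set L" "i \<noteq> j"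
  shows "R i j \<and> euler L (unit_vector i) (unit_vector j) = 0 \<and>
      euler L (unit_vector j) (unit_vector i) = - wt i j \<or>
    R j i \<and> euler L (unit_vector j) (unit_vector i) = 0 \<and> euler L (unit_vector i) (unit_vector j) = - wt i j"
  using assms
proof (induction L)
  case (Cons s L)
  have first: "R s v \<and> euler (s # L) (unit_vector s) (unit_vector v) = 0 \<and>
      euler (s # L) (unit_vector v) (unit_vector s) = - wt s v" if v: "v \<in> set L" for v
  proof -
    have "simple_root (set (s # L)) s (unit_vector s)" by (simp add: simple_root_def)
    note simple = euler_simple_first[OF Cons.prems(1) this]
    have sv: "s \<noteq> v" using v Cons.prems(1) by auto
    have "(\<Sum>k\<in>set L. wt k s * unit_vector v k) = wt v s"
      using v by (simp add: if_distrib[of "times _"] cong: if_cong)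
    then have "reflect (set (s # L)) s (unit_vector v) s = wt s v"
      using Cons.prems(1) sv wt_sym[of v s] by (simp add: reflect_insert_self)
    then show ?thesis using simple[of "unit_vector v"] sv v Cons.prems(2) by (simp del: euler.simps)
  qed
  have rest: "euler (s # L) (unit_vector u) (unit_vector v) = euler L (unit_vector u) (unit_vector v)"
    if "v \<in> set L" for u v
    using that Cons.prems(1) by auto
  consider "i = s" "j \<in> set L" | "j = s" "i \<in> set L" | "i \<in> set L" "j \<in> set L" using Cons.prems(3-5) by auto
  then show ?case
  proof cases
    case 3
    then show ?thesis using Cons by (simp only: rest) simp
  qed (use first[of j] first[of i] wt_sym[of i j] in auto)
qed simp

lemma (in oriented_affine_graph) root_companion_unit_vectors:
  assumes L: "sorted_wrt (\<lambda>u v. B u v = wt u v \<and> B v u = - wt u v) L" and diag: "\<And>i. B i i = 0"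
  shows "root_companion B (gram unit_vector)"
proof -
  have units: "B i j = wt i j \<and> E (unit_vector i) (unit_vector j) = 0 \<and>
      E (unit_vector j) (unit_vector i) = - wt i j \<or>
    B i j = - wt i j \<and> E (unit_vector j) (unit_vector i) = 0 \<and> E (unit_vector i) (unit_vector j) = - wt i j"
    if "i \<in> I" "j \<in> I" "i \<noteq> j" for i j
    using euler_unit_vectors[OF distinct_L L, of i j] that wt_sym[of i j] set_L by auto
  have "compatible_family unit_vector"
    unfolding compatible_family_def
  proof (intro conjI ballI impI)
    show "root I (unit_vector i)" if "i \<in> I" for i
      using that fin by (simp add: root_def cartan_form_def if_distrib[of "times _"] cong: if_cong)
    have "nonneg_on I (unit_vector i)" for i by (simp add: nonneg_on_def)
    then show "compatible L (unit_vector i) (unit_vector j)" if "i \<in> I" "j \<in> I" "i \<noteq> j" for i j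
      using units[OF that] wt_nonneg[of i j] set_L by (auto simp: compatible_def hom_free_def)
    obtain s M where "L = s # M" using set_L nonempty by (cases L) auto
    then have "flip s L (M @ [s])" "s \<in> I" using set_L by (auto simp: flip_def)
    moreover have "simple_root I s (unit_vector s)" by (simp add: simple_root_def)
    ultimately show "\<exists>l\<in>I. E \<delta> (unit_vector l) \<noteq> 0"
      using regular_not_simple_root(1)[OF distinct_L set_L] by blast
  qed
  moreover have "B i j = exchange unit_vector i j" if "i \<in> I" "j \<in> I" for i j
    using units[OF that] diag by (cases "i = j") (auto simp: exchange_def)
  ultimately show ?thesis
    using lattice_basis_unit[OF fin] unfolding root_companion_def by blast
qed

locale affine_quiver_type = affine_graph "graph_weight X" "{1..N}" \<delta>
  for X :: "nat set set" and N :: nat and \<delta> :: "nat \<Rightarrow> int" +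
  assumes finite_edges: "finite X"

locale acyclic_affine_quiver = affine_quiver_type X N \<delta> + oriented_affine_graph "graph_weight X" "{1..N}" \<delta> L
  for X N \<delta> L +
  fixes Q0 :: quiver
  assumes quiver_Q0: "quiver N Q0" and underlying: "has_underlying_graph Q0 X"
    and sorted_L: "sorted_wrt (\<lambda>u v. (v, u) \<notin># Q0) L"

lemma (in affine_quiver_type) acyclic_quiver_orientation:
  assumes "quiver N Q0" "acyclic (set_mset Q0)" "has_underlying_graph Q0 X"
  obtains L where "acyclic_affine_quiver X N \<delta> L Q0"
proof -
  obtain L where L: "distinct L" "set L = {1..N}" "sorted_wrt (\<lambda>u v. (v, u) \<notin> set_mset Q0) L"
    using topological_order[of "{1..N}" "set_mset Q0"] assms(2) by auto
  then have "acyclic_affine_quiver X N \<delta> L Q0" using assms by unfold_locales auto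
  then show ?thesis by (rule that)
qed

context acyclic_affine_quiver begin

lemma adj_Q0_eq_0_iff: "i \<noteq> j \<Longrightarrow> adj Q0 i j = 0 \<longleftrightarrow> {i, j} \<notin> X"
proof -
  assume ij: "i \<noteq> j"
  have "count Q0 (i, j) = 0 \<or> count Q0 (j, i) = 0"
    using quiver_Q0 unfolding quiver_def by (metis not_in_iff)
  then show ?thesis
    using count_underlying_graph[OF underlying finite_edges ij] ij
    by (auto simp: adj_def graph_weight_def split: if_splits)
qed

lemma root_companion_Q0: "root_companion (adj Q0) (gram unit_vector)"
proof (rule root_companion_unit_vectors)
  have "sorted_wrt (\<lambda>u v. u \<noteq> v \<and> (v, u) \<notin># Q0) L"
    using distinct_L sorted_L by (induction L) auto
  then show "sorted_wrt (\<lambda>u v. adj Q0 u v = graph_weight X u v \<and> adj Q0 v u = - graph_weight X u v) L"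
  proof (rule sorted_wrt_mono_rel[rotated])
    fix u v assume "u \<noteq> v \<and> (v, u) \<notin># Q0"
    then show "adj Q0 u v = graph_weight X u v \<and> adj Q0 v u = - graph_weight X u v"
      using count_underlying_graph[OF underlying finite_edges, of u v] by (simp add: adj_def not_in_iff)
  qed
qed simp

lemma mutation_equivalent_root_companion:
  assumes "mutation_equivalent N Q Q0"
  obtains A where "root_companion (adj Q) A"
proof -
  have "\<exists>A. root_companion (adj Q) A"
    using assms
  proof (rule mutation_equivalent_invariant[where P = "\<lambda>B. \<exists>A. root_companion B A"])
    show "\<exists>A. root_companion (adj Q0) A" using root_companion_Q0 by blast
    show "\<exists>A. root_companion B' A"
      if "\<And>i j. i \<in> {1..N} \<Longrightarrow> j \<in> {1..N} \<Longrightarrow> B' i j = B i j" "\<exists>A. root_companion B A" for B B'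
      using root_companion_cong[of B' B, OF that(1)] that(2) by blast
    show "\<exists>A. root_companion (mutate k B) A" if "k \<in> {1..N}" "\<exists>A. root_companion B A" for B k
      using that(2) by (elim exE) (erule root_companion_mutate[OF _ that(1)], blast)
  qed
  then show ?thesis using that by blast
qed

lemma mutation_equivalent_connected:
  assumes "mutation_equivalent N Q Q0"
  shows "connected_matrix {1..N} (adj Q)"
  using assms
proof (rule mutation_equivalent_invariant[where P = "connected_matrix {1..N}"])
  show "connected_matrix {1..N} (adj Q0)"
    unfolding connected_matrix_def
  proof (intro allI impI)
    fix S assume S: "S \<subseteq> {1..N}" "S \<noteq> {}" "\<forall>i\<in>S. \<forall>j\<in>{1..N} - S. adj Q0 i j = 0"
    have "graph_weight X i j = 0" if "i \<in> S" "j \<in> {1..N} - S" for i j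
      using S(3) that adj_Q0_eq_0_iff[of i j] by (auto simp: graph_weight_def)
    then show "S = {1..N}" by (rule connected[OF S(1,2)])
  qed
qed (rule connected_matrix_cong connected_matrix_mutate; assumption)+

end

lemma tree_companions_sign_equivalent:
  fixes I :: "nat set"
  assumes "finite I" "quasi_cartan_companion I B A" "quasi_cartan_companion I B A'"
    and "\<And>i j. i \<in> I \<Longrightarrow> j \<in> I \<Longrightarrow> i < j \<Longrightarrow> B i j \<noteq> 0 \<Longrightarrow> i = p j"
  shows "sign_equivalent I A A'"
  using assms
proof (induction I rule: finite_linorder_max_induct)
  case empty
  then show ?case by (simp add: sign_equivalent_def signs_on_def)
next
  case (insert m I)
  note companionD = quasi_cartan_companionD[OF insert.prems(1)]
    and companionD' = quasi_cartan_companionD[OF insert.prems(2)]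
  have "quasi_cartan_companion I B A" "quasi_cartan_companion I B A'"
    using insert.prems(1,2) unfolding quasi_cartan_companion_def by blast+
  then have "sign_equivalent I A A'" using insert.IH insert.prems(3) by blast
  then obtain D where D: "signs_on I D" "\<And>i j. i \<in> I \<Longrightarrow> j \<in> I \<Longrightarrow> A' i j = D i * D j * A i j"
    unfolding sign_equivalent_def sign_conjugate_def by blast
  define D' where "D' = D(m := if A' (p m) m = D (p m) * A (p m) m then 1 else - 1)"
  have D': "signs_on (insert m I) D'" using D(1) by (auto simp: signs_on_def D'_def)
  have new: "A' i m = D' i * D' m * A i m" if i: "i \<in> I" for i
  proof (cases "B i m = 0")
    case True
    then show ?thesis using companionD(6)[of i m] companionD'(6)[of i m] i insert.hyps(2) by auto
  next
    case False
    then have "i = p m" using insert.prems(3)[of i m] i insert.hyps(2) by auto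
    moreover have "\<bar>A' i m\<bar> = \<bar>A i m\<bar>"
      using companionD(3)[of i m] companionD'(3)[of i m] i insert.hyps(2) by auto
    ultimately show ?thesis
      using signs_onD[OF D(1) i] i insert.hyps(2) by (auto simp: D'_def abs_eq_iff)
  qed
  have new': "A' m i = D' m * D' i * A m i" if i: "i \<in> I" for i
    using new[OF i] companionD(2)[of i m] companionD'(2)[of i m] i by (simp add: mult_ac)
  have "A' m m = D' m * D' m * A m m" using companionD(4)[of m m] companionD'(4)[of m m] by (simp add: D'_def)
  moreover have "A' i j = D' i * D' j * A i j" if "i \<in> I" "j \<in> I" for i j
    using D(2)[OF that] that insert.hyps(2) by (auto simp: D'_def)
  ultimately have "\<forall>i\<in>insert m I. \<forall>j\<in>insert m I. A' i j = D' i * D' j * A i j"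
    using new new' by blast
  then show ?case using D' unfolding sign_equivalent_def sign_conjugate_def by blast
qed

lemma (in acyclic_affine_quiver) mutation_equivalent_sign_rigid:
  assumes "mutation_equivalent N Q Q0" and tree: "\<And>i j. i < j \<Longrightarrow> {i, j} \<in> X \<Longrightarrow> i = p j"
  shows "sign_rigid (adj Q)"
  using assms(1)
proof (rule mutation_equivalent_invariant[where P = sign_rigid])
  show "sign_rigid (adj Q0)"
    unfolding sign_rigid_def
  proof (intro allI impI)
    fix A A' assume "root_companion (adj Q0) A" "root_companion (adj Q0) A'"
    then show "sign_equivalent {1..N} A A'"
      using tree adj_Q0_eq_0_iff root_companion_quasi_cartan
      by (intro tree_companions_sign_equivalent[of _ "adj Q0" A A' p]) auto
  qed
  show "sign_rigid B'" if "\<And>i j. i \<in> {1..N} \<Longrightarrow> j \<in> {1..N} \<Longrightarrow> B' i j = B i j" "sign_rigid B" for B B'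
    using sign_rigid_cong[of B' B, OF that(1)] that(2) by blast
qed (rule sign_rigid_mutate)

subsection \<open>Admissibility of generated groups\<close>

lemma G_admissibleI:
  assumes "G_invariant N G Q" "\<And>g i. g \<in> G \<Longrightarrow> i \<in> {1..N} \<Longrightarrow> foldable {1..N} (adj Q) i (g i)"
  shows "G_admissible N G Q"
  using assms unfolding G_admissible_def same_orbit_def foldable_def by blast

lemma foldable_refl: "foldable {1..N} (adj Q) i i"
  by (simp add: foldable_def)

lemma foldable_sym: "foldable {1..N} (adj Q) i j \<longleftrightarrow> foldable {1..N} (adj Q) j i"
  using adj_skew[of Q i j] by (auto simp: foldable_def mult.commute)

lemma generate_sym_group_subset:
  assumes S: "\<And>s. s \<in> S \<Longrightarrow> s permutes {1..N}" "S \<subseteq> H" "\<And>s. s \<in> S \<Longrightarrow> inv' s \<in> H"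
    and H: "id \<in> H" "\<And>f g. f \<in> H \<Longrightarrow> g \<in> H \<Longrightarrow> f \<circ> g \<in> H"
  shows "generate (sym_group N) S \<subseteq> H"
proof
  fix g assume "g \<in> generate (sym_group N) S"
  then show "g \<in> H"
  proof (induction rule: generate.induct)
    case one
    then show ?case using H(1) by (simp only: sym_group_one)
  next
    case (incl s)
    then show ?case using S(2) by blast
  next
    case (inv s)
    then show ?case using S(1,3) by (simp add: sym_group_inv_equality sym_group_carrier)
  next
    case (eng f g)
    then show ?case using H(2) by (simp only: sym_group_mult)
  qed
qed

lemma generate_involution:
  assumes "s permutes {1..N}" "\<And>x. s (s x) = x"
  shows "generate (sym_group N) {s} \<subseteq> {id, s}"
proof (rule generate_sym_group_subset)
  have "inv' s = s" using assms(2) by (intro inv_equality)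
  then show "inv' r \<in> {id, s}" if "r \<in> {s}" for r using that by simp
  have "s \<circ> s = id" using assms(2) by (simp add: fun_eq_iff)
  then show "f \<circ> g \<in> {id, s}" if "f \<in> {id, s}" "g \<in> {id, s}" for f g using that by auto
qed (use assms(1) in auto)

lemma generate_commuting_involutions:
  assumes s: "s permutes {1..N}" "\<And>x. s (s x) = x" and r: "r permutes {1..N}" "\<And>x. r (r x) = x"
    and commute: "\<And>x. r (s x) = s (r x)"
  shows "generate (sym_group N) {s, r} \<subseteq> {id, s, r, s \<circ> r}"
proof (rule generate_sym_group_subset)
  have "inv' s = s" "inv' r = r" using s(2) r(2) by (auto intro: inv_equality)
  then show "inv' t \<in> {id, s, r, s \<circ> r}" if "t \<in> {s, r}" for t using that by auto
  show "f \<circ> g \<in> {id, s, r, s \<circ> r}" if "f \<in> {id, s, r, s \<circ> r}" "g \<in> {id, s, r, s \<circ> r}" for f g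
  proof -
    have "s \<circ> s = id" "r \<circ> r = id" "r \<circ> s = s \<circ> r" "s \<circ> (s \<circ> r) = r" "r \<circ> (s \<circ> r) = s"
      "s \<circ> r \<circ> s = r" "s \<circ> r \<circ> r = s" "s \<circ> r \<circ> (s \<circ> r) = id"
      using s(2) r(2) commute by (simp_all add: fun_eq_iff)
    then show ?thesis using that by (elim insertE emptyE) simp_all
  qed
qed (use s(1) r(1) in auto)

lemma generate_order_three:
  assumes "s permutes {1..N}" "\<And>x. s (s (s x)) = x"
  shows "generate (sym_group N) {s} \<subseteq> {id, s, s \<circ> s}"
proof (rule generate_sym_group_subset)
  have "inv' s = s \<circ> s" using assms(2) by (intro inv_equality) simp_all
  then show "inv' r \<in> {id, s, s \<circ> s}" if "r \<in> {s}" for r using that by simp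
  show "f \<circ> g \<in> {id, s, s \<circ> s}" if "f \<in> {id, s, s \<circ> s}" "g \<in> {id, s, s \<circ> s}" for f g
  proof -
    have "s \<circ> (s \<circ> s) = id" "s \<circ> s \<circ> s = id" "s \<circ> s \<circ> (s \<circ> s) = s"
      using assms(2) by (simp_all add: fun_eq_iff)
    then show ?thesis using that by (elim insertE emptyE) simp_all
  qed
qed (use assms(1) in auto)

lemma G_invariant_generator:
  assumes "G_invariant N (generate (sym_group N) S) Q" "s \<in> S" "i \<in> {1..N}" "j \<in> {1..N}"
  shows "adj Q (s i) (s j) = adj Q i j"
  using assms generate.incl[of s S "sym_group N"] unfolding G_invariant_def by blast

lemma G_admissible_generated_involution:
  assumes s: "s permutes {1..N}" "\<And>x. s (s x) = x"
    and inv: "G_invariant N (generate (sym_group N) {s}) Q"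
    and fold: "\<And>i. i \<in> {1..N} \<Longrightarrow> foldable {1..N} (adj Q) i (s i)"
  shows "G_admissible N (generate (sym_group N) {s}) Q"
  using inv
proof (rule G_admissibleI)
  fix g i assume "g \<in> generate (sym_group N) {s}" and i: "i \<in> {1..N}"
  then have "g = id \<or> g = s" using generate_involution[OF s] by blast
  then show "foldable {1..N} (adj Q) i (g i)" using fold[OF i] foldable_refl by auto
qed

lemma G_admissible_generated_order_three:
  assumes s: "s permutes {1..N}" "\<And>x. s (s (s x)) = x"
    and inv: "G_invariant N (generate (sym_group N) {s}) Q"
    and fold: "\<And>i. i \<in> {1..N} \<Longrightarrow> foldable {1..N} (adj Q) i (s i)"
  shows "G_admissible N (generate (sym_group N) {s}) Q"
  using inv
proof (rule G_admissibleI)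
  fix g i assume "g \<in> generate (sym_group N) {s}" and i: "i \<in> {1..N}"
  then have g: "g = id \<or> g = s \<or> g = s \<circ> s" using generate_order_three[OF s] by blast
  have "s (s i) \<in> {1..N}" using i by (simp only: permutes_in_image[OF s(1)])
  from fold[OF this] have "foldable {1..N} (adj Q) i (s (s i))" unfolding s(2) by (simp only: foldable_sym)
  with g fold[OF i] foldable_refl show "foldable {1..N} (adj Q) i (g i)" by (elim disjE) simp_all
qed

section \<open>Trees\<close>

locale affine_tree =
  fixes N :: nat and p :: "nat \<Rightarrow> nat" and X :: "nat set set" and \<delta> :: "nat \<Rightarrow> int"
  assumes root: "1 \<le> N" and parent: "v \<in> {2..N} \<Longrightarrow> 1 \<le> p v \<and> p v < v"
    and edges: "X = (\<lambda>v. {p v, v}) ` {2..N}"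
    and delta_pos: "i \<in> {1..N} \<Longrightarrow> 0 < \<delta> i" and delta_out: "i \<notin> {1..N} \<Longrightarrow> \<delta> i = 0"
    and balanced: "i \<in> {1..N} \<Longrightarrow>
      (if i = 1 then 0 else \<delta> (p i)) + (\<Sum>j\<in>{j\<in>{2..N}. p j = i}. \<delta> j) = 2 * \<delta> i"
begin

lemma edge_iff: "{i, j} \<in> X \<longleftrightarrow> i \<in> {2..N} \<and> p i = j \<or> j \<in> {2..N} \<and> p j = i"
  unfolding edges image_iff doubleton_eq_iff by blast

lemma edge_parent: "i < j \<Longrightarrow> {i, j} \<in> X \<Longrightarrow> i = p j"
  using parent[of i] by (auto simp: edge_iff)

lemma graph_weight_eq:
  "graph_weight X j i = (if i \<in> {2..N} \<and> p i = j then 1 else 0) + (if j \<in> {2..N} \<and> p j = i then 1 else 0)"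
  using parent[of i] parent[of j] unfolding graph_weight_def edge_iff by (cases i j rule: linorder_cases) auto

lemma graph_weight_balanced:
  assumes i: "i \<in> {1..N}"
  shows "(\<Sum>j\<in>{1..N}. graph_weight X j i * \<delta> j) = 2 * \<delta> i"
proof -
  have "(\<Sum>j\<in>{1..N}. graph_weight X j i * \<delta> j)
      = (\<Sum>j\<in>{1..N}. if i \<in> {2..N} \<and> p i = j then \<delta> j else 0)
        + (\<Sum>j\<in>{1..N}. if j \<in> {2..N} \<and> p j = i then \<delta> j else 0)"
    unfolding graph_weight_eq sum.distrib[symmetric] by (intro sum.cong) auto
  also have "(\<Sum>j\<in>{1..N}. if i \<in> {2..N} \<and> p i = j then \<delta> j else 0) = (if i = 1 then 0 else \<delta> (p i))"
    using i parent[of i] by (cases "i = 1") auto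
  also have "(\<Sum>j\<in>{1..N}. if j \<in> {2..N} \<and> p j = i then \<delta> j else 0) = (\<Sum>j\<in>{j\<in>{2..N}. p j = i}. \<delta> j)"
    by (rule sum.mono_neutral_cong_right) auto
  finally show ?thesis using balanced[OF i] by simp
qed

lemma graph_connected:
  assumes S: "S \<subseteq> {1..N}" "S \<noteq> {}"
    and separated: "\<And>i j. i \<in> S \<Longrightarrow> j \<in> {1..N} - S \<Longrightarrow> graph_weight X i j = 0"
  shows "S = {1..N}"
proof -
  have "v \<in> S \<longleftrightarrow> 1 \<in> S" if "v \<in> {1..N}" for v
    using that
  proof (induction v rule: less_induct)
    case (less v)
    show ?case
    proof (cases "v = 1")
      case False
      then have v: "v \<in> {2..N}" "p v < v" "p v \<in> {1..N}" using less.prems parent[of v] by auto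
      have "graph_weight X (p v) v \<noteq> 0" "graph_weight X v (p v) \<noteq> 0"
        using v(1) by (simp_all add: graph_weight_eq)
      then have "v \<in> S \<longleftrightarrow> p v \<in> S" using separated[of "p v" v] separated[of v "p v"] v less.prems by blast
      then show ?thesis using less.IH[OF v(2,3)] by blast
    qed simp
  qed
  then show ?thesis using S by blast
qed

sublocale affine_quiver_type X N \<delta>
proof -
  interpret weighted_graph "graph_weight X" by (rule weighted_graph_graph_weight)
  show "affine_quiver_type X N \<delta>"
    using root delta_pos delta_out graph_weight_balanced graph_connected
    by unfold_locales (auto simp: edges)
qed

lemma of_type_involution_foldable:
  assumes Q: "of_type N X Q" and g: "g permutes {1..N}" "\<And>x. g (g x) = x" and f: "f \<in> {1..N}" "g f = f"
    and inv: "\<And>i j. i \<in> {1..N} \<Longrightarrow> j \<in> {1..N} \<Longrightarrow> adj Q (g i) (g j) = adj Q i j" and i: "i \<in> {1..N}"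
  shows "foldable {1..N} (adj Q) i (g i)"
proof -
  obtain Q0 where Q0: "quiver N Q0" "acyclic (set_mset Q0)" "has_underlying_graph Q0 X"
    and eq: "mutation_equivalent N Q Q0"
    using Q unfolding of_type_def by blast
  obtain L where "acyclic_affine_quiver X N \<delta> L Q0" by (rule acyclic_quiver_orientation[OF Q0])
  then interpret acyclic_affine_quiver X N \<delta> L Q0 .
  obtain A where A: "root_companion (adj Q) A" by (rule mutation_equivalent_root_companion[OF eq])
  have g_in: "g i \<in> {1..N}" if "i \<in> {1..N}" for i using that by (simp only: permutes_in_image[OF g(1)])
  note no_square = sign_rigid_involution_no_square[OF A mutation_equivalent_sign_rigid[OF eq edge_parent]
      mutation_equivalent_connected[OF eq] g_in g(2) f inv]
  show ?thesis by (rule involution_foldable[OF adj_skew g_in g(2) inv no_square i])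
qed

lemma G_admissible_involutions:
  assumes "of_type N X Q" "G_invariant N G Q" "f \<in> {1..N}"
    and G: "\<And>g. g \<in> G \<Longrightarrow> g permutes {1..N} \<and> g \<circ> g = id \<and> g f = f"
  shows "G_admissible N G Q"
  using assms(2)
proof (rule G_admissibleI)
  fix g i assume g: "g \<in> G" and i: "i \<in> {1..N}"
  have "adj Q (g i) (g j) = adj Q i j" if "i \<in> {1..N}" "j \<in> {1..N}" for i j
    using assms(2) g that unfolding G_invariant_def by blast
  then show "foldable {1..N} (adj Q) i (g i)"
    using G[OF g] by (intro of_type_involution_foldable[OF assms(1) _ _ assms(3) _ _ i]) (auto simp: fun_eq_iff)
qed

lemma G_admissible_generated_involution_fixing:
  assumes "of_type N X Q" "G_invariant N (generate (sym_group N) {s}) Q" "f \<in> {1..N}"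
    and s: "s permutes {1..N}" "\<And>x. s (s x) = x" "s f = f"
  shows "G_admissible N (generate (sym_group N) {s}) Q"
  using assms(1-3)
proof (rule G_admissible_involutions)
  fix g assume "g \<in> generate (sym_group N) {s}"
  then have "g = id \<or> g = s" using generate_involution[OF s(1,2)] by blast
  moreover have "s \<circ> s = id" using s(2) by (simp add: fun_eq_iff)
  ultimately show "g permutes {1..N} \<and> g \<circ> g = id \<and> g f = f" using s(1,3) permutes_id by auto
qed

end

subsection \<open>Type D\<close>

definition D_parent :: "nat \<Rightarrow> nat \<Rightarrow> nat" where
  "D_parent n v = (if v \<le> 4 then 1 else if v = n + 1 then n - 1 else v - 1)"

definition D_delta :: "nat \<Rightarrow> nat \<Rightarrow> int" where
  "D_delta n i = (if i \<notin> {1..n + 1} then 0 else if i \<in> {2, 3, n, n + 1} then 1 else 2)"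

lemma D_edges_parent:
  assumes "5 \<le> n"
  shows "D_edges n = (\<lambda>v. {D_parent n v, v}) ` {2..n + 1}"
proof -
  have "(\<lambda>v. {D_parent n v, v}) ` {5..n - 1} = (\<lambda>v. {D_parent n v, v}) ` Suc ` {4..n - 2}"
    using assms by (simp add: image_Suc_atLeastAtMost Suc_diff_Suc numeral_eq_Suc)
  also have "\<dots> = (\<lambda>i. {i, i + 1}) ` {4..n - 2}"
    unfolding image_image using assms by (intro image_cong) (auto simp: D_parent_def)
  also have "\<dots> = {{i, i + 1} | i. 4 \<le> i \<and> i \<le> n - 2}"
    by (simp only: setcompr_eq_image atLeastAtMost_iff[symmetric] Collect_mem_eq)
  finally have chain: "(\<lambda>v. {D_parent n v, v}) ` {5..n - 1} = {{i, i + 1} | i. 4 \<le> i \<and> i \<le> n - 2}" .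
  have ends: "(\<lambda>v. {D_parent n v, v}) ` {2, 3, 4} = {{1, 2}, {1, 3}, {1, 4}}"
    "(\<lambda>v. {D_parent n v, v}) ` {n, n + 1} = {{n - 1, n}, {n - 1, n + 1}}"
    using assms by (simp_all add: D_parent_def)
  have "{2..n + 1} = {2, 3, 4} \<union> {5..n - 1} \<union> {n, n + 1}" using assms by auto
  then show ?thesis by (simp only: D_edges_def image_Un chain ends)
qed

lemma D_children:
  assumes "5 \<le> n" "i \<in> {1..n + 1}"
  shows "{j \<in> {2..n + 1}. D_parent n j = i} =
    (if i = 1 then {2, 3, 4} else if i = n - 1 then {n, n + 1} else if i \<in> {4..n - 2} then {i + 1} else {})"
  using assms by (auto simp: D_parent_def split: if_splits)

lemma affine_tree_D:
  assumes n: "5 \<le> n"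
  shows "affine_tree (n + 1) (D_parent n) (D_edges n) (D_delta n)"
proof
  show "1 \<le> D_parent n v \<and> D_parent n v < v" if "v \<in> {2..n + 1}" for v
    using that n by (auto simp: D_parent_def)
  have one: "D_delta n i = 1" if "i \<in> {2, 3, n, n + 1}" for i
    using that n by (auto simp: D_delta_def)
  have two: "D_delta n i = 2" if "i = 1 \<or> 4 \<le> i \<and> i < n" for i
    using that n by (auto simp: D_delta_def)
  have inner: "D_delta n (D_parent n i) = 2" if "i \<in> {2..n + 1}" for i
    using that n by (intro two) (auto simp: D_parent_def)
  show "(if i = 1 then 0 else D_delta n (D_parent n i)) + (\<Sum>j\<in>{j \<in> {2..n + 1}. D_parent n j = i}. D_delta n j)
      = 2 * D_delta n i" if i: "i \<in> {1..n + 1}" for i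
  proof -
    consider "i = 1" | "i \<in> {2, 3, n, n + 1}" | "4 \<le> i" "i \<le> n - 2" | "i = n - 1" "4 \<le> i" "i < n"
      using i n by force
    then show ?thesis
    proof cases
      case 1
      then show ?thesis using D_children[OF n i] n by (simp add: one two)
    next
      case 2
      then have "{j \<in> {2..n + 1}. D_parent n j = i} = {}" unfolding D_children[OF n i] using n by auto
      moreover have "i \<noteq> 1" "D_delta n (D_parent n i) = 2" "D_delta n i = 1"
        using 2 i n inner[of i] one[OF 2] by auto
      ultimately show ?thesis by (simp only: if_False sum.empty)
    next
      case 3
      then show ?thesis using D_children[OF n i] n by (simp add: two inner)
    next
      case 4
      then have "{j \<in> {2..n + 1}. D_parent n j = i} = {n, n + 1}" unfolding D_children[OF n i] using n by auto
      moreover have "i \<noteq> 1" "D_delta n (D_parent n i) = 2" "D_delta n i = 2"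
        using 4(2,3) i inner[of i] two[of i] by auto
      ultimately show ?thesis by (simp only: if_False) (simp add: one)
    qed
  qed
  show "D_edges n = (\<lambda>v. {D_parent n v, v}) ` {2..n + 1}" by (rule D_edges_parent[OF n])
qed (auto simp: D_delta_def)

lemma D_swap_ends_admissible:
  assumes n: "5 \<le> n" and "of_type (n + 1) (D_edges n) Q"
    and "G_invariant (n + 1) (generate (sym_group (n + 1)) {transpose 2 3 \<circ> transpose n (n + 1)}) Q"
  shows "G_admissible (n + 1) (generate (sym_group (n + 1)) {transpose 2 3 \<circ> transpose n (n + 1)}) Q"
proof (rule affine_tree.G_admissible_generated_involution_fixing[OF affine_tree_D[OF n] assms(2,3)])
  show "transpose 2 3 \<circ> transpose n (n + 1) permutes {1..n + 1}"
    using n by (intro permutes_compose permutes_swap_id) auto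
qed (use n in \<open>auto simp: transpose_def\<close>)

lemma D_swap_end_admissible:
  assumes n: "5 \<le> n" and "of_type (n + 1) (D_edges n) Q"
    and "G_invariant (n + 1) (generate (sym_group (n + 1)) {transpose n (n + 1)}) Q"
  shows "G_admissible (n + 1) (generate (sym_group (n + 1)) {transpose n (n + 1)}) Q"
proof (rule affine_tree.G_admissible_generated_involution_fixing[OF affine_tree_D[OF n] assms(2,3)])
  show "transpose n (n + 1) permutes {1..n + 1}" using n by (intro permutes_swap_id) auto
  show "transpose n (n + 1) 1 = 1" using n by (auto simp: transpose_def)
qed (use n in auto)

lemma involution_permutes: "(\<And>x. s (s x) = x) \<Longrightarrow> (\<And>x. x \<notin> S \<Longrightarrow> s x = x) \<Longrightarrow> s permutes S"
  unfolding permutes_def by metis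

lemma sigma_sigma:
  assumes n: "3 \<le> n"
  shows "sigma n (sigma n x) = x"
proof -
  define m where "m = 2 * n - 6"
  then have m: "2 * n = m + 6" using n by simp
  note sigma = sigma_def[of n, unfolded m]
  have "x = 1 \<or> x = 2 \<or> x = 3 \<or> x = m + 5 \<or> x = m + 6 \<or> x = m + 7 \<or> 4 \<le> x \<and> x \<le> m + 4 \<or> x = 0 \<or> m + 7 < x"
    by linarith
  then show ?thesis
  proof (elim disjE conjE)
    have middle: "sigma n y = m + 8 - y" if "4 \<le> y" "y \<le> m + 4" for y using that by (simp add: sigma)
    assume x: "4 \<le> x" "x \<le> m + 4"
    then have "sigma n (m + 8 - x) = x" using middle[of "m + 8 - x"] by simp
    then show ?thesis by (simp only: middle[OF x])
  qed (simp_all add: sigma)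
qed

lemma sigma_permutes:
  assumes "3 \<le> n"
  shows "sigma n permutes {1..2 * n + 1}"
proof (rule involution_permutes)
  show "sigma n x = x" if "x \<notin> {1..2 * n + 1}" for x using that assms by (auto simp: sigma_def)
qed (rule sigma_sigma[OF assms])

lemma sigma_middle: "3 \<le> n \<Longrightarrow> sigma n (n + 1) = n + 1"
  by (auto simp: sigma_def)

lemma sigma_D_ends:
  assumes "3 \<le> n"
  shows "sigma n 2 = 2 * n + 1" "sigma n 3 = 2 * n" "sigma n (2 * n) = 3" "sigma n (2 * n + 1) = 2"
  using assms by (simp_all add: sigma_def)

lemma sigma_swap_ends_commute:
  assumes n: "3 \<le> n"
  defines "r \<equiv> transpose 2 3 \<circ> transpose (2 * n) (2 * n + 1)"
  shows "r (sigma n x) = sigma n (r x)"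
proof (cases "x \<in> {2, 3, 2 * n, 2 * n + 1}")
  case True
  have "r 2 = 3" "r 3 = 2" "r (2 * n) = 2 * n + 1" "r (2 * n + 1) = 2 * n"
    using n by (auto simp: r_def transpose_def)
  then show ?thesis using True sigma_D_ends[OF n] by (elim insertE emptyE) simp_all
next
  case False
  have outside: "r y = y" if "y \<notin> {2, 3, 2 * n, 2 * n + 1}" for y using that by (simp add: r_def transpose_def)
  have "sigma n x \<notin> {2, 3, 2 * n, 2 * n + 1}"
  proof
    assume "sigma n x \<in> {2, 3, 2 * n, 2 * n + 1}"
    then have "sigma n (sigma n x) \<in> {2, 3, 2 * n, 2 * n + 1}" using sigma_D_ends[OF n] by auto
    then show False using False sigma_sigma[OF n] by simp
  qed
  then show ?thesis using False outside[of x] outside[of "sigma n x"] by (simp only: simp_thms)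
qed

lemma D_reflect_admissible:
  assumes n: "3 \<le> n" and "of_type (2 * n + 1) (D_edges (2 * n)) Q"
    and "G_invariant (2 * n + 1) (generate (sym_group (2 * n + 1)) {sigma n}) Q"
  shows "G_admissible (2 * n + 1) (generate (sym_group (2 * n + 1)) {sigma n}) Q"
proof -
  interpret affine_tree "2 * n + 1" "D_parent (2 * n)" "D_edges (2 * n)" "D_delta (2 * n)"
    using n by (intro affine_tree_D) simp
  have "n + 1 \<in> {1..2 * n + 1}" by simp
  then show ?thesis
    using sigma_permutes[OF n] sigma_sigma[OF n] sigma_middle[OF n]
    by (rule G_admissible_generated_involution_fixing[OF assms(2,3)])
qed

lemma D_reflect_swap_admissible:
  assumes n: "3 \<le> n" and "of_type (2 * n + 1) (D_edges (2 * n)) Q"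
    and "G_invariant (2 * n + 1) (generate (sym_group (2 * n + 1))
           {sigma n, transpose 2 3 \<circ> transpose (2 * n) (2 * n + 1)}) Q"
  shows "G_admissible (2 * n + 1) (generate (sym_group (2 * n + 1))
           {sigma n, transpose 2 3 \<circ> transpose (2 * n) (2 * n + 1)}) Q"
proof -
  interpret affine_tree "2 * n + 1" "D_parent (2 * n)" "D_edges (2 * n)" "D_delta (2 * n)"
    using n by (intro affine_tree_D) simp
  define r where "r = transpose 2 3 \<circ> transpose (2 * n) (2 * n + 1)"
  have r: "r permutes {1..2 * n + 1}" "r \<circ> r = id" "r (n + 1) = n + 1"
    using n by (auto simp: r_def transpose_def fun_eq_iff intro!: permutes_compose permutes_swap_id)
  have s: "sigma n permutes {1..2 * n + 1}" "sigma n \<circ> sigma n = id" "sigma n (n + 1) = n + 1"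
    using sigma_permutes[OF n] sigma_sigma[OF n] sigma_middle[OF n] by (simp_all add: fun_eq_iff)
  have commute: "r (sigma n x) = sigma n (r x)" for x
    unfolding r_def by (rule sigma_swap_ends_commute[OF n])
  have r_r: "r (r x) = x" for x using r(2) by (simp add: fun_eq_iff)
  have sr: "sigma n \<circ> r permutes {1..2 * n + 1}" "sigma n \<circ> r \<circ> (sigma n \<circ> r) = id"
    "(sigma n \<circ> r) (n + 1) = n + 1"
    using permutes_compose[OF r(1) s(1)] r(3) s(3) by (simp_all add: fun_eq_iff commute r_r sigma_sigma[OF n])
  have "n + 1 \<in> {1..2 * n + 1}" by simp
  with assms(2,3) have "G_admissible (2 * n + 1) (generate (sym_group (2 * n + 1)) {sigma n, r}) Q"
    unfolding r_def[symmetric]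
  proof (rule G_admissible_involutions)
    fix g assume "g \<in> generate (sym_group (2 * n + 1)) {sigma n, r}"
    then consider "g = id" | "g = sigma n" | "g = r" | "g = sigma n \<circ> r"
      using generate_commuting_involutions[OF s(1) sigma_sigma[OF n] r(1) r_r commute] by blast
    then show "g permutes {1..2 * n + 1} \<and> g \<circ> g = id \<and> g (n + 1) = n + 1"
      by cases (use r s sr permutes_id in \<open>simp_all only: id_apply id_comp simp_thms\<close>)
  qed
  then show ?thesis by (simp only: r_def)
qed

subsection \<open>Exceptional types\<close>

definition D4_delta :: "nat \<Rightarrow> int" where
  "D4_delta i = (if i = 1 then 2 else if i \<in> {2, 3, 4, 5} then 1 else 0)"

lemma affine_tree_D4: "affine_tree 5 (\<lambda>v. 1) D4_edges D4_delta"
proof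
  have I: "{2..5} = {2, 3, 4, 5::nat}" by auto
  show "D4_edges = (\<lambda>v. {1, v}) ` {2..5}" by (simp add: I D4_edges_def)
  have children: "{j \<in> {2..5::nat}. 1 = i} = (if i = 1 then {2, 3, 4, 5} else {})" for i :: nat
    unfolding I by auto
  show "(if i = 1 then 0 else D4_delta 1) + (\<Sum>j\<in>{j \<in> {2..5}. 1 = i}. D4_delta j) = 2 * D4_delta i"
    if "i \<in> {1..5}" for i
    unfolding children[of i] using that by (auto simp: D4_delta_def)
qed (auto simp: D4_delta_def)

lemma D4_klein_admissible:
  assumes "of_type 5 D4_edges Q"
    and "G_invariant 5 {id, transpose 2 3 \<circ> transpose 4 5, transpose 2 4 \<circ> transpose 3 5,
         transpose 2 5 \<circ> transpose 3 4} Q"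
  shows "G_admissible 5 {id, transpose 2 3 \<circ> transpose 4 5, transpose 2 4 \<circ> transpose 3 5,
         transpose 2 5 \<circ> transpose 3 4} Q"
proof (rule affine_tree.G_admissible_involutions[OF affine_tree_D4 assms, of 1])
  fix g :: "nat \<Rightarrow> nat"
  assume "g \<in> {id, transpose 2 3 \<circ> transpose 4 5, transpose 2 4 \<circ> transpose 3 5, transpose 2 5 \<circ> transpose 3 4}"
  then have "g permutes {1..5}" by (auto intro!: permutes_id permutes_compose permutes_swap_id)
  moreover have "g \<circ> g = id \<and> g 1 = 1"
    using \<open>g \<in> _\<close> by (elim insertE emptyE) (auto simp: fun_eq_iff transpose_def)
  ultimately show "g permutes {1..5} \<and> g \<circ> g = id \<and> g 1 = 1" by blast
qed simp

definition E6_parent :: "nat \<Rightarrow> nat" where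
  "E6_parent v = (if v \<in> {3, 5, 7} then v - 1 else 1)"

definition E6_delta :: "nat \<Rightarrow> int" where
  "E6_delta i = (if i = 1 then 3 else if i \<in> {2, 4, 6} then 2 else if i \<in> {3, 5, 7} then 1 else 0)"

lemma affine_tree_E6: "affine_tree 7 E6_parent E6_edges E6_delta"
proof
  have I: "{2..7} = {2, 3, 4, 5, 6, 7::nat}" "{1..7} = {1, 2, 3, 4, 5, 6, 7::nat}" by auto
  show "E6_edges = (\<lambda>v. {E6_parent v, v}) ` {2..7}"
    unfolding E6_edges_def I E6_parent_def by (simp add: insert_commute)
  show "1 \<le> E6_parent v \<and> E6_parent v < v" if "v \<in> {2..7}" for v
    using that by (auto simp: I E6_parent_def)
  show "0 < E6_delta i" if "i \<in> {1..7}" for i using that by (auto simp: I E6_delta_def)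
  show "E6_delta i = 0" if "i \<notin> {1..7}" for i using that by (auto simp: I E6_delta_def)
  have children: "{j \<in> {2..7}. E6_parent j = i} =
      (if i = 1 then {2, 4, 6} else if i \<in> {2, 4, 6} then {i + 1} else {})"
    if "i \<in> {1..7}" for i
    using that unfolding I E6_parent_def by auto
  show "(if i = 1 then 0 else E6_delta (E6_parent i)) + (\<Sum>j\<in>{j \<in> {2..7}. E6_parent j = i}. E6_delta j)
      = 2 * E6_delta i"
    if "i \<in> {1..7}" for i
    unfolding children[OF that] using that by (auto simp: I E6_delta_def E6_parent_def)
qed simp

lemma E6_swap_admissible:
  assumes "of_type 7 E6_edges Q"
    and "G_invariant 7 (generate (sym_group 7) {transpose 4 6 \<circ> transpose 5 7}) Q"
  shows "G_admissible 7 (generate (sym_group 7) {transpose 4 6 \<circ> transpose 5 7}) Q"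
proof (rule affine_tree.G_admissible_generated_involution_fixing[OF affine_tree_E6 assms])
  show "transpose 4 6 \<circ> transpose 5 7 permutes {1..7::nat}"
    by (intro permutes_compose permutes_swap_id) auto
qed (auto simp: transpose_def)

definition E7_parent :: "nat \<Rightarrow> nat" where
  "E7_parent v = (if v \<in> {2, 3, 6} then 1 else v - 1)"

definition E7_delta :: "nat \<Rightarrow> int" where
  "E7_delta i = (if i = 1 then 4 else if i \<in> {3, 6} then 3 else if i \<in> {2, 4, 7} then 2
     else if i \<in> {5, 8} then 1 else 0)"

lemma affine_tree_E7: "affine_tree 8 E7_parent E7_edges E7_delta"
proof
  have I: "{2..8} = {2, 3, 4, 5, 6, 7, 8::nat}" "{1..8} = {1, 2, 3, 4, 5, 6, 7, 8::nat}" by auto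
  show "E7_edges = (\<lambda>v. {E7_parent v, v}) ` {2..8}"
    unfolding E7_edges_def I E7_parent_def by (simp add: insert_commute)
  show "1 \<le> E7_parent v \<and> E7_parent v < v" if "v \<in> {2..8}" for v
    using that by (auto simp: I E7_parent_def)
  show "0 < E7_delta i" if "i \<in> {1..8}" for i using that by (auto simp: I E7_delta_def)
  show "E7_delta i = 0" if "i \<notin> {1..8}" for i using that by (auto simp: I E7_delta_def)
  have children: "{j \<in> {2..8}. E7_parent j = i} =
      (if i = 1 then {2, 3, 6} else if i \<in> {3, 4, 6, 7} then {i + 1} else {})"
    if "i \<in> {1..8}" for i
    using that unfolding I E7_parent_def by auto
  show "(if i = 1 then 0 else E7_delta (E7_parent i)) + (\<Sum>j\<in>{j \<in> {2..8}. E7_parent j = i}. E7_delta j)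
      = 2 * E7_delta i"
    if "i \<in> {1..8}" for i
    unfolding children[OF that] using that by (auto simp: I E7_delta_def E7_parent_def)
qed simp

lemma E7_swap_admissible:
  assumes "of_type 8 E7_edges Q"
    and "G_invariant 8 (generate (sym_group 8) {transpose 3 6 \<circ> transpose 4 7 \<circ> transpose 5 8}) Q"
  shows "G_admissible 8 (generate (sym_group 8) {transpose 3 6 \<circ> transpose 4 7 \<circ> transpose 5 8}) Q"
proof (rule affine_tree.G_admissible_generated_involution_fixing[OF affine_tree_E7 assms])
  show "transpose 3 6 \<circ> transpose 4 7 \<circ> transpose 5 8 permutes {1..8::nat}"
    by (intro permutes_compose permutes_swap_id) auto
qed (auto simp: transpose_def)

section \<open>Cycles\<close>

subsection \<open>Differences of unit vectors\<close>

definition difference_root :: "'v \<Rightarrow> 'v \<Rightarrow> 'v \<Rightarrow> int" where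
  "difference_root a b v = unit_vector a v - unit_vector b v"

lemma sum_difference_root:
  assumes "finite I" "a \<in> I" "b \<in> I"
  shows "(\<Sum>v\<in>I. difference_root a b v * x v) = x a - x b"
proof -
  have "(\<Sum>v\<in>I. difference_root a b v * x v) = (\<Sum>v\<in>I. (if v = a then x a else 0) - (if v = b then x b else 0))"
    by (intro sum.cong) (auto simp: difference_root_def)
  then show ?thesis using assms by (simp add: sum_subtractf)
qed

lemma sum_zero_has_pos:
  fixes u :: "'a \<Rightarrow> int"
  assumes "finite I" "(\<Sum>v\<in>I. u v) = 0" "v \<in> I" "u v \<noteq> 0"
  obtains a where "a \<in> I" "0 < u a"
proof -
  have "\<exists>a\<in>I. 0 < u a"
  proof (rule ccontr)
    assume "\<not> ?thesis"
    then have "\<And>v. v \<in> I \<Longrightarrow> 0 \<le> - u v" by (simp add: not_less)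
    moreover have "(\<Sum>v\<in>I. - u v) = 0" using assms(2) by (simp add: sum_negf)
    ultimately show False using sum_nonneg_eq_0_iff[OF assms(1), of "\<lambda>v. - u v"] assms(3,4) by simp
  qed
  then show ?thesis using that by blast
qed

lemma difference_rootE:
  fixes u :: "'a \<Rightarrow> int"
  assumes fin: "finite I" and sq: "(\<Sum>v\<in>I. u v * u v) = 2" and sum: "(\<Sum>v\<in>I. u v) = 0"
  obtains a b where "a \<in> I" "b \<in> I" "a \<noteq> b" "\<And>v. v \<in> I \<Longrightarrow> u v = difference_root a b v"
proof -
  have "\<exists>v\<in>I. u v \<noteq> 0"
  proof (rule ccontr)
    assume "\<not> ?thesis"
    then show False using sq by simp
  qed
  then obtain v where v: "v \<in> I" "u v \<noteq> 0" by blast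
  obtain a where a: "a \<in> I" "0 < u a" using sum_zero_has_pos[OF fin sum v] .
  obtain b where b: "b \<in> I" "0 < - u b"
    using sum_zero_has_pos[OF fin, of "\<lambda>v. - u v" v] sum v by (auto simp: sum_negf)
  have ab: "a \<noteq> b" using a b by auto
  have "(\<Sum>v\<in>I. u v * u v) = u a * u a + (u b * u b + (\<Sum>v\<in>I - {a} - {b}. u v * u v))"
    using fin a b ab by (simp add: sum.remove[of I a] sum.remove[of "I - {a}" b])
  moreover have "1 \<le> u a * u a" "1 \<le> u b * u b"
    using a b by (simp_all add: int_one_le_iff_zero_less zero_less_mult_iff)
  moreover have "0 \<le> (\<Sum>v\<in>I - {a} - {b}. u v * u v)" by (intro sum_nonneg) simp
  ultimately have squares: "u a * u a = 1" "u b * u b = 1" "(\<Sum>v\<in>I - {a} - {b}. u v * u v) = 0"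
    using sq by linarith+
  then have "u v = 0" if "v \<in> I - {a} - {b}" for v
    using sum_nonneg_eq_0_iff[of "I - {a} - {b}" "\<lambda>v. u v * u v"] fin that by simp
  moreover have "u a = 1" "u b = - 1" using squares a b by (auto simp: zmult_eq_1_iff)
  ultimately have "u v = difference_root a b v" if "v \<in> I" for v
    using ab that by (auto simp: difference_root_def)
  then show ?thesis using that a b ab by blast
qed

lemma difference_root_simps:
  assumes "a \<noteq> b"
  shows "difference_root a b a = 1" "difference_root a b b = - 1" "v \<notin> {a, b} \<Longrightarrow> difference_root a b v = 0"
  using assms by (auto simp: difference_root_def)

lemma difference_root_orthogonal:
  assumes "a \<noteq> b" "c \<noteq> d" "difference_root c d a = difference_root c d b"
  shows "a \<notin> {c, d} \<and> b \<notin> {c, d}"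
proof -
  have "difference_root c d v = 0" if "v \<notin> {c, d}" for v by (rule difference_root_simps(3)[OF assms(2) that])
  then show ?thesis
    using assms difference_root_simps(1,2)[OF assms(2)]
    by (metis insert_iff one_neq_neg_one one_neq_zero zero_neq_neg_one singletonD)
qed

lemma difference_root_square_nonneg:
  assumes ne: "a \<noteq> b" "p \<noteq> q" "c \<noteq> d" "x \<noteq> y"
    and orth: "difference_root c d a = difference_root c d b" "difference_root x y p = difference_root x y q"
  shows "0 \<le> (difference_root p q a - difference_root p q b) * (difference_root p q c - difference_root p q d) *
    ((difference_root x y c - difference_root x y d) * (difference_root x y a - difference_root x y b))"
proof (rule ccontr)
  assume neg: "\<not> ?thesis"
  note disjoint = difference_root_orthogonal[OF ne(1,3) orth(1)] difference_root_orthogonal[OF ne(2,4) orth(2)]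
  have meets: "u = a \<or> u = b \<or> w = a \<or> w = b" "u = c \<or> u = d \<or> w = c \<or> w = d"
    if "difference_root u w a \<noteq> difference_root u w b" "difference_root u w c \<noteq> difference_root u w d" for u w
    using that unfolding difference_root_def by metis+
  have "p \<in> {a, b} \<and> q \<in> {c, d} \<or> q \<in> {a, b} \<and> p \<in> {c, d}"
    using meets[of p q] neg disjoint(1) by force
  moreover have "x \<in> {a, b} \<and> y \<in> {c, d} \<or> y \<in> {a, b} \<and> x \<in> {c, d}"
    using meets[of x y] neg disjoint(1) by force
  ultimately show False
    using neg ne disjoint unfolding difference_root_def by auto
qed

subsection \<open>Invariant quivers of cyclic type\<close>

locale affine_cycle =
  fixes N :: nat and nx :: "nat \<Rightarrow> nat" and X :: "nat set set"
  assumes bij: "bij_betw nx {1..N} {1..N}" and N: "1 \<le> N" and edges: "X = (\<lambda>v. {v, nx v}) ` {1..N}"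
    and no_loop: "i \<in> {1..N} \<Longrightarrow> nx i \<noteq> i" and no_two_cycle: "i \<in> {1..N} \<Longrightarrow> nx (nx i) \<noteq> i"
    and transitive: "S \<subseteq> {1..N} \<Longrightarrow> S \<noteq> {} \<Longrightarrow> (\<And>i. i \<in> {1..N} \<Longrightarrow> nx i \<in> S \<longleftrightarrow> i \<in> S) \<Longrightarrow> S = {1..N}"
begin

lemma nx_in: "i \<in> {1..N} \<Longrightarrow> nx i \<in> {1..N}"
  using bij by (auto simp: bij_betw_def)

lemma graph_weight_eq:
  assumes ij: "i \<in> {1..N}" "j \<in> {1..N}"
  shows "graph_weight X i j = (if j = nx i then 1 else 0) + (if i = nx j then 1 else 0)"
proof -
  have "{i, j} \<in> X \<longleftrightarrow> j = nx i \<or> i = nx j"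
    using ij unfolding edges image_iff doubleton_eq_iff by blast
  then show ?thesis
    using no_loop[OF ij(1)] no_loop[OF ij(2)] no_two_cycle[OF ij(1)] by (auto simp: graph_weight_def)
qed

lemma graph_weight_balanced:
  assumes i: "i \<in> {1..N}"
  shows "(\<Sum>j\<in>{1..N}. graph_weight X j i) = 2"
proof -
  have "(\<Sum>j\<in>{1..N}. graph_weight X j i)
      = (\<Sum>j\<in>{1..N}. if i = nx j then 1 else 0) + (\<Sum>j\<in>{1..N}. if j = nx i then 1 else 0)"
    unfolding sum.distrib[symmetric] by (intro sum.cong refl) (simp only: graph_weight_eq[OF _ i])
  also have "(\<Sum>j\<in>{1..N}. if i = nx j then 1 else (0::int)) = (\<Sum>j\<in>{1..N}. if i = j then 1 else 0)"
    by (rule sum.reindex_bij_betw[OF bij, of "\<lambda>j. if i = j then 1 else 0"])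
  finally show ?thesis using i nx_in[OF i] by simp
qed

sublocale affine_quiver_type X N "\<lambda>i. of_bool (i \<in> {1..N})"
proof -
  interpret weighted_graph "graph_weight X" by (rule weighted_graph_graph_weight)
  show "affine_quiver_type X N (\<lambda>i. of_bool (i \<in> {1..N}))"
  proof unfold_locales
    show "(\<Sum>j\<in>{1..N}. graph_weight X j i * of_bool (j \<in> {1..N})) = 2 * of_bool (i \<in> {1..N})"
      if "i \<in> {1..N}" for i
      using graph_weight_balanced[OF that] that by simp
    fix S assume S: "S \<subseteq> {1..N}" "S \<noteq> {}"
      and separated: "\<And>i j. i \<in> S \<Longrightarrow> j \<in> {1..N} - S \<Longrightarrow> graph_weight X i j = 0"
    show "S = {1..N}"
    proof (rule transitive[OF S])
      fix i assume i: "i \<in> {1..N}"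
      have "graph_weight X i (nx i) \<noteq> 0" "graph_weight X (nx i) i \<noteq> 0"
        using graph_weight_eq[OF i nx_in[OF i]] graph_weight_eq[OF nx_in[OF i] i] by auto
      then show "nx i \<in> S \<longleftrightarrow> i \<in> S" using separated[of i "nx i"] separated[of "nx i" i] i nx_in[OF i] by blast
    qed
  qed (use N in \<open>auto simp: edges\<close>)
qed

definition difference :: "(nat \<Rightarrow> int) \<Rightarrow> nat \<Rightarrow> int" where
  "difference x v = x v - x (nx v)"

lemma sum_nx: "(\<Sum>v\<in>{1..N}. f (nx v)) = (\<Sum>v\<in>{1..N}. f v)"
  by (rule sum.reindex_bij_betw[OF bij])

lemma sum_difference: "(\<Sum>v\<in>{1..N}. difference x v) = 0"
  using sum_nx[of x] by (simp add: difference_def sum_subtractf)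

lemma cartan_form_cycle: "cartan_form {1..N} x = (\<Sum>v\<in>{1..N}. difference x v * difference x v)"
proof -
  have "(\<Sum>j\<in>{1..N}. (if j = nx i then 1 else 0) * x i * x j) = x i * x (nx i)" if "i \<in> {1..N}" for i
  proof -
    have "(\<Sum>j\<in>{1..N}. (if j = nx i then 1 else 0) * x i * x j)
        = (\<Sum>j\<in>{1..N}. if j = nx i then x i * x (nx i) else 0)"
      by (intro sum.cong) auto
    then show ?thesis using nx_in[OF that] by simp
  qed
  then have pairs:
    "(\<Sum>i\<in>{1..N}. \<Sum>j\<in>{1..N}. (if j = nx i then 1 else 0) * x i * x j) = (\<Sum>i\<in>{1..N}. x i * x (nx i))"
    by (intro sum.cong refl)
  have "(\<Sum>i\<in>{1..N}. \<Sum>j\<in>{1..N}. graph_weight X i j * x i * x j)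
      = (\<Sum>i\<in>{1..N}. \<Sum>j\<in>{1..N}. (if j = nx i then 1 else 0) * x i * x j)
        + (\<Sum>i\<in>{1..N}. \<Sum>j\<in>{1..N}. (if i = nx j then 1 else 0) * x i * x j)"
    unfolding sum.distrib[symmetric] by (intro sum.cong refl) (simp only: graph_weight_eq distrib_right)
  also have "(\<Sum>i\<in>{1..N}. \<Sum>j\<in>{1..N}. (if i = nx j then 1 else 0) * x i * x j)
      = (\<Sum>j\<in>{1..N}. \<Sum>i\<in>{1..N}. (if i = nx j then 1 else 0) * x j * x i)"
    by (subst sum.swap) (intro sum.cong refl, simp)
  finally have "(\<Sum>i\<in>{1..N}. \<Sum>j\<in>{1..N}. graph_weight X i j * x i * x j) = 2 * (\<Sum>i\<in>{1..N}. x i * x (nx i))"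
    unfolding pairs by simp
  moreover have "(\<Sum>v\<in>{1..N}. difference x v * difference x v)
      = (\<Sum>v\<in>{1..N}. x v * x v) + (\<Sum>v\<in>{1..N}. x (nx v) * x (nx v)) - 2 * (\<Sum>i\<in>{1..N}. x i * x (nx i))"
    by (simp add: difference_def algebra_simps sum.distrib sum_subtractf sum_distrib_left)
  ultimately show ?thesis using sum_nx[of "\<lambda>v. x v * x v"] by (simp add: cartan_form_def)
qed

end

locale oriented_affine_cycle = affine_cycle N nx X +
  oriented_affine_graph "graph_weight X" "{1..N}" "\<lambda>i. of_bool (i \<in> {1..N})" L for N nx X L
begin

lemma gram_cycle: "gram c i j = (\<Sum>v\<in>{1..N}. difference (c i) v * difference (c j) v)"
proof -
  let ?z = "\<lambda>v. c i v + 1 * c j v"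
  have norm: "2 * E z z = (\<Sum>v\<in>{1..N}. difference z v * difference z v)" for z
    using euler_self[OF distinct_L, of z] set_L cartan_form_cycle by simp
  have "E ?z ?z = E (c i) (c i) + E (c j) (c j) + gram c i j"
    unfolding euler_add_scaled_left euler_add_scaled_right gram_def by simp
  then have "2 * gram c i j = 2 * E ?z ?z - 2 * E (c i) (c i) - 2 * E (c j) (c j)" by simp
  also have "\<dots> = (\<Sum>v\<in>{1..N}. 2 * (difference (c i) v * difference (c j) v))"
    unfolding norm sum_subtractf[symmetric] by (intro sum.cong refl) (simp add: difference_def algebra_simps)
  finally show ?thesis by (simp add: sum_distrib_left[symmetric])
qed

lemma no_oriented_square:
  assumes BA: "root_companion B A" and I: "i \<in> {1..N}" "j \<in> {1..N}" "k \<in> {1..N}" "l \<in> {1..N}"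
  shows "\<not> oriented_square B i j k l"
proof
  assume square: "oriented_square B i j k l"
  obtain c where c: "compatible_family c" and A: "\<And>i j. i \<in> {1..N} \<Longrightarrow> j \<in> {1..N} \<Longrightarrow> A i j = gram c i j"
    using root_companionE[OF BA] by metis
  have "\<exists>a b. a \<in> {1..N} \<and> b \<in> {1..N} \<and> a \<noteq> b \<and> (\<forall>v\<in>{1..N}. difference (c i) v = difference_root a b v)"
    if i: "i \<in> {1..N}" for i
  proof -
    have "(\<Sum>v\<in>{1..N}. difference (c i) v * difference (c i) v) = 2"
      using compatible_familyD(2)[OF c i] unfolding gram_cycle[symmetric] gram_def by simp
    then show ?thesis
      using difference_rootE[of "{1..N}" "difference (c i)"] sum_difference[of "c i"]
      by (metis finite_atLeastAtMost)
  qed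
  then obtain a b where ab: "\<And>i. i \<in> {1..N} \<Longrightarrow> a i \<in> {1..N}" "\<And>i. i \<in> {1..N} \<Longrightarrow> b i \<in> {1..N}"
      "\<And>i. i \<in> {1..N} \<Longrightarrow> a i \<noteq> b i"
    and c_eq: "\<And>i v. i \<in> {1..N} \<Longrightarrow> v \<in> {1..N} \<Longrightarrow> difference (c i) v = difference_root (a i) (b i) v"
    by metis
  have A_eq: "A i j = difference_root (a j) (b j) (a i) - difference_root (a j) (b j) (b i)"
    if ij: "i \<in> {1..N}" "j \<in> {1..N}" for i j
  proof -
    have "A i j = (\<Sum>v\<in>{1..N}. difference_root (a i) (b i) v * difference_root (a j) (b j) v)"
      unfolding A[OF ij] gram_cycle by (intro sum.cong refl) (simp only: c_eq ij)
    then show ?thesis using ab(1,2)[OF ij(1)] by (simp only: sum_difference_root finite_atLeastAtMost)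
  qed
  note companionD = quasi_cartan_companionD[OF root_companion_quasi_cartan[OF BA]]
  have "A i k = 0" "A j l = 0"
    using square companionD(6)[OF I(1,3)] companionD(6)[OF I(2,4)] by (auto simp: oriented_square_def)
  then have "difference_root (a k) (b k) (a i) = difference_root (a k) (b k) (b i)"
    "difference_root (a l) (b l) (a j) = difference_root (a l) (b l) (b j)"
    using A_eq[OF I(1,3)] A_eq[OF I(2,4)] by linarith+
  then have "0 \<le> A i j * A k j * (A k l * A i l)"
    unfolding A_eq[OF I(1,2)] A_eq[OF I(3,2)] A_eq[OF I(3,4)] A_eq[OF I(1,4)]
    by (rule difference_root_square_nonneg[OF ab(3)[OF I(1)] ab(3)[OF I(2)] ab(3)[OF I(3)] ab(3)[OF I(4)]])
  moreover have "A i j * A j k * A k l * A l i < 0" by (rule root_companion_square[OF BA I square])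
  ultimately show False unfolding companionD(2)[OF I(3,2)] companionD(2)[OF I(1,4)] by (simp add: mult.assoc)
qed

end

lemma (in affine_cycle) G_admissible_involution_cycle:
  assumes "of_type_A N X c p q Q" and s: "s permutes {1..N}" "\<And>x. s (s x) = x"
    and inv: "G_invariant N (generate (sym_group N) {s}) Q"
  shows "G_admissible N (generate (sym_group N) {s}) Q"
proof (rule G_admissible_generated_involution[OF s inv])
  fix i assume i: "i \<in> {1..N}"
  obtain Q0 where Q0: "quiver N Q0" "acyclic (set_mset Q0)" "has_underlying_graph Q0 X"
    and eq: "mutation_equivalent N Q Q0"
    using assms(1) unfolding of_type_A_def by blast
  obtain L where "acyclic_affine_quiver X N (\<lambda>i. of_bool (i \<in> {1..N})) L Q0"
    by (rule acyclic_quiver_orientation[OF Q0])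
  then interpret acyclic_affine_quiver X N "\<lambda>i. of_bool (i \<in> {1..N})" L Q0 .
  interpret oriented_affine_cycle N nx X L by unfold_locales
  obtain A where A: "root_companion (adj Q) A" by (rule mutation_equivalent_root_companion[OF eq])
  have s_in: "s i \<in> {1..N}" if "i \<in> {1..N}" for i using that by (simp only: permutes_in_image[OF s(1)])
  have s_inv: "adj Q (s i) (s j) = adj Q i j" if "i \<in> {1..N}" "j \<in> {1..N}" for i j
    using G_invariant_generator[OF inv _ that] by simp
  note no_square = no_oriented_square[OF A _ _ s_in s_in]
  show "foldable {1..N} (adj Q) i (s i)"
    by (rule involution_foldable[OF adj_skew s_in s(2) s_inv no_square i])
qed

definition A_next :: "nat \<Rightarrow> nat \<Rightarrow> nat" where
  "A_next n i = (if i < n then i + 1 else if i = n then 2 * n else if i = n + 1 then 1 else i - 1)"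

lemma A_next_bij:
  assumes "2 \<le> n"
  shows "bij_betw (A_next n) {1..2 * n} {1..2 * n}"
proof -
  have "inj_on (A_next n) {1..2 * n}" using assms by (auto simp: inj_on_def A_next_def split: if_splits)
  moreover have "A_next n ` {1..2 * n} \<subseteq> {1..2 * n}" using assms by (auto simp: A_next_def)
  ultimately show ?thesis by (simp add: bij_betw_def endo_inj_surj)
qed

lemma A_edges_next:
  assumes n: "2 \<le> n"
  shows "A_edges n = (\<lambda>i. {i, A_next n i}) ` {1..2 * n}"
proof -
  have "(\<lambda>i. {i, A_next n i}) ` {1..n - 1} = (\<lambda>i. {i, i + 1}) ` {1..n - 1}"
    by (intro image_cong) (auto simp: A_next_def)
  also have "\<dots> = {{i, i + 1} | i. 1 \<le> i \<and> i \<le> n - 1}"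
    by (simp only: setcompr_eq_image atLeastAtMost_iff[symmetric] Collect_mem_eq)
  finally have up: "(\<lambda>i. {i, A_next n i}) ` {1..n - 1} = {{i, i + 1} | i. 1 \<le> i \<and> i \<le> n - 1}" .
  have "(\<lambda>i. {i, A_next n i}) ` {n + 2..2 * n} = (\<lambda>i. {i, A_next n i}) ` Suc ` {n + 1..2 * n - 1}"
    using n by (simp add: image_Suc_atLeastAtMost)
  also have "\<dots> = (\<lambda>j. {j, j + 1}) ` {n + 1..2 * n - 1}"
    unfolding image_image by (intro image_cong) (auto simp: A_next_def insert_commute)
  also have "\<dots> = {{j, j + 1} | j. n + 1 \<le> j \<and> j \<le> 2 * n - 1}"
    by (simp only: setcompr_eq_image atLeastAtMost_iff[symmetric] Collect_mem_eq)
  finally have down: "(\<lambda>i. {i, A_next n i}) ` {n + 2..2 * n} = {{j, j + 1} | j. n + 1 \<le> j \<and> j \<le> 2 * n - 1}" .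
  have turns: "(\<lambda>i. {i, A_next n i}) ` {n, n + 1} = {{n, 2 * n}, {1, n + 1}}"
    by (simp add: A_next_def insert_commute)
  have "{1..2 * n} = {1..n - 1} \<union> {n, n + 1} \<union> {n + 2..2 * n}" using n by auto
  then show ?thesis by (simp only: A_edges_def image_Un up down turns)
qed

lemma A_next_transitive:
  assumes S: "S \<subseteq> {1..2 * n}" "S \<noteq> {}" and inv: "\<And>i. i \<in> {1..2 * n} \<Longrightarrow> A_next n i \<in> S \<longleftrightarrow> i \<in> S"
  shows "S = {1..2 * n}"
proof -
  have low: "i \<in> S \<longleftrightarrow> 1 \<in> S" if "1 \<le> i" "i \<le> n" for i
    using that
  proof (induction i rule: dec_induct)
    case (step i)
    then have "i \<in> S \<longleftrightarrow> i + 1 \<in> S" using inv[of i] by (simp add: A_next_def)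
    then show ?case using step by simp
  qed simp
  have high: "j \<in> S \<longleftrightarrow> 1 \<in> S" if "n + 1 \<le> j" "j \<le> 2 * n" for j
    using that
  proof (induction j rule: dec_induct)
    case base
    then show ?case using inv[of "n + 1"] by (simp add: A_next_def)
  next
    case (step j)
    then have "Suc j \<in> S \<longleftrightarrow> j \<in> S" using inv[of "Suc j"] by (simp add: A_next_def)
    then show ?case using step by simp
  qed
  have "i \<in> S \<longleftrightarrow> 1 \<in> S" if "i \<in> {1..2 * n}" for i
    using low[of i] high[of i] that by (cases "i \<le> n") auto
  then show ?thesis using S by blast
qed

lemma affine_cycle_A:
  assumes n: "2 \<le> n"
  shows "affine_cycle (2 * n) (A_next n) (A_edges n)"
proof
  show "A_next n i \<noteq> i" "A_next n (A_next n i) \<noteq> i" if "i \<in> {1..2 * n}" for i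
    using n that by (auto simp: A_next_def)
qed (use n A_next_bij[OF n] A_edges_next[OF n] A_next_transitive in simp_all)

lemma tau_tau: "2 \<le> n \<Longrightarrow> tau n (tau n x) = x"
  unfolding tau_def by auto

lemma A_reflect_admissible:
  assumes n: "2 \<le> n" and "of_type_A (2 * n) (A_edges n) c p q Q"
    and "G_invariant (2 * n) (generate (sym_group (2 * n)) {tau n}) Q"
  shows "G_admissible (2 * n) (generate (sym_group (2 * n)) {tau n}) Q"
proof (rule affine_cycle.G_admissible_involution_cycle[OF affine_cycle_A[OF n] assms(2) _ tau_tau[OF n] assms(3)])
  have "tau n x = x" if "x \<notin> {1..2 * n}" for x using n that by (auto simp: tau_def)
  then show "tau n permutes {1..2 * n}" by (intro involution_permutes tau_tau[OF n])
qed

lemma A2_edges: "{{1, 2}, {2, 4}, {4, 3}, {3, 1}} = A_edges 2"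
proof -
  have vertices: "{1..2 * 2} = {1, 2, 3, 4::nat}" by auto
  have successors: "A_next 2 1 = 2" "A_next 2 2 = 4" "A_next 2 3 = 1" "A_next 2 4 = 3"
    by (simp_all add: A_next_def)
  show ?thesis
    unfolding A_edges_next[OF order_refl] vertices image_insert image_empty successors by blast
qed

lemma A2_rotate_admissible:
  assumes "of_type_A 4 {{1, 2}, {2, 4}, {4, 3}, {3, 1}} c p q Q"
    and "G_invariant 4 (generate (sym_group 4) {transpose 1 4 \<circ> transpose 2 3}) Q"
  shows "G_admissible 4 (generate (sym_group 4) {transpose 1 4 \<circ> transpose 2 3}) Q"
proof -
  interpret affine_cycle 4 "A_next 2" "A_edges 2" using affine_cycle_A[of 2] by simp
  have "transpose 1 4 \<circ> transpose 2 3 permutes {1..4::nat}" by (intro permutes_compose permutes_swap_id) auto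
  moreover have "(transpose 1 4 \<circ> transpose 2 3) ((transpose 1 4 \<circ> transpose 2 3) x) = x" for x :: nat
    by (simp add: transpose_def)
  ultimately show ?thesis using assms(2) by (rule G_admissible_involution_cycle[OF assms(1)[unfolded A2_edges]])
qed

section \<open>Automorphisms of order three\<close>

lemma companion_triangle_apex:
  assumes A: "admissible_companion I B A" and I: "f \<in> I" "x \<in> I" "y \<in> I"
    and f: "0 < B f x * B f y" and xy: "B x y \<noteq> 0"
  shows "A f x * A f y * A x y < 0"
proof -
  note companionD = quasi_cartan_companionD[OF admissible_companionD(1)[OF A]]
  have ne: "f \<noteq> x" "f \<noteq> y" "x \<noteq> y" using f xy companionD(5)[OF I(1,1)] companionD(5)[OF I(2,2)] by auto
  have sym: "A x f = A f x" "A y f = A f y" "A y x = A x y" using companionD(2) I by blast+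
  have skew: "B x f = - B f x" "B y f = - B f y" "B y x = - B x y" using companionD(1) I by blast+
  note acyclic = admissible_companionD(2)[OF A]
  have signs: "0 < B f x \<and> 0 < B f y \<or> B f x < 0 \<and> B f y < 0" using f by (auto simp: zero_less_mult_iff)
  show ?thesis
  proof (cases "0 < B x y")
    case True
    have "A f x * A x y * A f y < 0 \<or> A x y * A y f * A x f < 0"
      using acyclic[OF I(1,2,3)] acyclic[OF I(2,3,1)] ne signs True skew by fastforce
    then show ?thesis unfolding sym by (simp add: mult_ac)
  next
    case False
    have "A f y * A y x * A f x < 0 \<or> A y x * A x f * A y f < 0"
      using acyclic[OF I(1,3,2)] acyclic[OF I(3,2,1)] ne signs False xy skew by fastforce
    then show ?thesis unfolding sym by (simp add: mult_ac)
  qed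
qed

lemma orbit_triangle_sign:
  assumes A: "admissible_companion I B A" and I: "x \<in> I" "y \<in> I" "z \<in> I"
    and orbit: "B x y = B y z" "B y z = B z x" and nz: "B x y \<noteq> 0"
  shows "0 < A x y * A y z * A z x"
proof -
  note companionD = quasi_cartan_companionD[OF admissible_companionD(1)[OF A]]
  have ne: "x \<noteq> z" using orbit nz companionD(5)[OF I(1,1)] by auto
  have skew: "B x z = - B z x" "B z y = - B y z" "B y x = - B x y" using companionD(1) I by blast+
  have sym: "A x z = A z x" "A z y = A y z" "A y x = A x y" using companionD(2) I by blast+
  show ?thesis
  proof (cases "0 < B x y")
    case True
    then have "0 < A x y * A y z * A x z"
      using orbit skew by (intro admissible_companionD(3)[OF A I ne]) simp_all
    then show ?thesis by (simp only: sym)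
  next
    case False
    then have "0 < A z y * A y x * A z x"
      using orbit skew nz by (intro admissible_companionD(3)[OF A I(3,2,1) ne[symmetric]]) simp_all
    then show ?thesis unfolding sym by (simp only: mult_ac)
  qed
qed

text \<open>An arrow from \<open>f\<close> to the orbit would make the product of the three triangle signs at \<open>f\<close>
  negative, but up to a square it is the sign of the oriented triangle.\<close>

lemma fixed_vertex_orbit_triangle:
  assumes A: "admissible_companion I B A" and I: "f \<in> I" "x \<in> I" "y \<in> I" "z \<in> I"
    and orbit: "B x y = B y z" "B y z = B z x" "B x y \<noteq> 0" and f: "B f x = B f y" "B f y = B f z"
  shows "B f x = 0"
proof (rule ccontr)
  assume "B f x \<noteq> 0"
  then have "0 < B f x * B f x" by (simp add: zero_less_mult_iff) linarith
  then have triangles: "A f x * A f y * A x y < 0" "A f y * A f z * A y z < 0" "A f z * A f x * A z x < 0"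
    using companion_triangle_apex[OF A I(1) I(2,3)] companion_triangle_apex[OF A I(1) I(3,4)]
      companion_triangle_apex[OF A I(1) I(4,2)] f orbit by auto
  have "(A f x * A f y * A x y) * (A f y * A f z * A y z) * (A f z * A f x * A z x) < 0"
    by (rule mult_pos_neg[OF mult_neg_neg[OF triangles(1,2)] triangles(3)])
  moreover have "(A f x * A f y * A x y) * (A f y * A f z * A y z) * (A f z * A f x * A z x)
      = (A f x * A f y * A f z) * (A f x * A f y * A f z) * (A x y * A y z * A z x)"
    by (simp only: mult_ac)
  moreover have "0 \<le> (A f x * A f y * A f z) * (A f x * A f y * A f z) * (A x y * A y z * A z x)"
    using orbit_triangle_sign[OF A I(2-4) orbit] by (intro mult_nonneg_nonneg[OF zero_le_square]) simp
  ultimately show False by linarith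
qed

lemma (in oriented_affine_graph) order_three_invariant_companion:
  assumes BA: "root_companion B A" "sign_rigid B"
    and g: "\<And>i. i \<in> I \<Longrightarrow> g i \<in> I" "\<And>i. i \<in> I \<Longrightarrow> g (g (g i)) = i"
    and inv: "\<And>i j. i \<in> I \<Longrightarrow> j \<in> I \<Longrightarrow> B (g i) (g j) = B i j"
  obtains C where "admissible_companion I B C" "semidefinite_corank_one I C"
    "\<And>i j. i \<in> I \<Longrightarrow> j \<in> I \<Longrightarrow> C (g i) (g j) = C i j"
proof -
  have "bij_betw g I I" using g by (intro bij_betw_byWitness[where f' = "\<lambda>i. g (g i)"]) auto
  then obtain D where D: "signs_on I D"
    and A: "\<And>i j. i \<in> I \<Longrightarrow> j \<in> I \<Longrightarrow> A (g i) (g j) = D i * D j * A i j"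
    using automorphism_signs[OF BA(2,1) _ inv] by blast
  define S where "S i = D (g i)" for i
  define t where "t i = D i * D (g i) * D (g (g i))" for i
  have S: "signs_on I S" using D g(1) by (simp add: signs_on_def S_def)
  have "sign_conjugate S A (g i) (g j) = sign_conjugate S A i j" if ij: "i \<in> I" "j \<in> I" for i j
  proof -
    have "A i j = A (g (g (g i))) (g (g (g j)))" by (simp only: g(2) ij)
    also have "\<dots> = D (g (g i)) * D (g (g j)) * (D (g i) * D (g j) * (D i * D j * A i j))"
      by (simp only: A g(1) ij)
    finally have cube: "A i j = t i * t j * A i j" unfolding t_def by (simp only: mult_ac)
    have S_eq: "D i * S (g i) * t i = S i" if "i \<in> I" for i
      using signs_onD[OF D that] signs_onD[OF D g(1)[OF that]] signs_onD[OF D g(1)[OF g(1)[OF that]]]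
      by (auto simp: S_def t_def)
    have "sign_conjugate S A (g i) (g j) = (D i * S (g i)) * (D j * S (g j)) * A i j"
      by (simp only: sign_conjugate_def A ij mult_ac)
    also have "\<dots> = (D i * S (g i)) * (D j * S (g j)) * (t i * t j * A i j)"
      by (simp only: cube[symmetric])
    also have "\<dots> = (D i * S (g i) * t i) * (D j * S (g j) * t j) * A i j"
      by (simp only: mult_ac)
    also have "\<dots> = S i * S j * A i j" by (simp only: S_eq ij)
    finally show ?thesis by (simp only: sign_conjugate_def)
  qed
  then show ?thesis
    using that admissible_companion_sign_conjugate[OF root_companion_admissible[OF BA(1)] S]
      semidefinite_corank_one_sign_conjugate[OF root_companion_corank_one[OF BA(1)] S] by blast
qed

lemma (in affine_tree) of_type_order_three_companion:
  assumes "of_type N X Q" and g: "g permutes {1..N}" "\<And>x. g (g (g x)) = x"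
    and inv: "\<And>i j. i \<in> {1..N} \<Longrightarrow> j \<in> {1..N} \<Longrightarrow> adj Q (g i) (g j) = adj Q i j"
  obtains C where "admissible_companion {1..N} (adj Q) C" "semidefinite_corank_one {1..N} C"
    "\<And>i j. i \<in> {1..N} \<Longrightarrow> j \<in> {1..N} \<Longrightarrow> C (g i) (g j) = C i j" "connected_matrix {1..N} (adj Q)"
proof -
  obtain Q0 where Q0: "quiver N Q0" "acyclic (set_mset Q0)" "has_underlying_graph Q0 X"
    and eq: "mutation_equivalent N Q Q0"
    using assms(1) unfolding of_type_def by blast
  obtain L where "acyclic_affine_quiver X N \<delta> L Q0" by (rule acyclic_quiver_orientation[OF Q0])
  then interpret acyclic_affine_quiver X N \<delta> L Q0 .
  obtain A where A: "root_companion (adj Q) A" by (rule mutation_equivalent_root_companion[OF eq])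
  have g_in: "g i \<in> {1..N}" if "i \<in> {1..N}" for i using that by (simp only: permutes_in_image[OF g(1)])
  have "sign_rigid (adj Q)" using eq edge_parent by (rule mutation_equivalent_sign_rigid)
  from A this g_in g(2) inv show ?thesis
  proof (rule order_three_invariant_companion)
    fix C assume "admissible_companion {1..N} (adj Q) C" "semidefinite_corank_one {1..N} C"
      "\<And>i j. i \<in> {1..N} \<Longrightarrow> j \<in> {1..N} \<Longrightarrow> C (g i) (g j) = C i j"
    then show thesis using mutation_equivalent_connected[OF eq] by (rule that)
  qed
qed

subsection \<open>The rotation of the four-legged star\<close>

lemma D4_rotation_no_triangle:
  fixes B :: "nat \<Rightarrow> nat \<Rightarrow> int"
  assumes C: "admissible_companion {1..5} B C" and cn: "connected_matrix {1..5} B"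
    and orbit: "B 3 4 = B 4 5" "B 4 5 = B 5 3" and spokes: "\<And>f. f \<in> {1, 2} \<Longrightarrow> B f 3 = B f 4 \<and> B f 4 = B f 5"
  shows "B 3 4 = 0"
proof (rule ccontr)
  assume nz: "B 3 4 \<noteq> 0"
  have zero: "B f 3 = 0" if f: "f \<in> {1, 2}" for f
  proof -
    have "f \<in> {1..5}" using f by auto
    then show ?thesis
      by (rule fixed_vertex_orbit_triangle[OF C _ _ _ _ orbit nz]) (use spokes[OF f] in simp_all)
  qed
  have "{1, 2} = {1..5::nat}"
  proof (rule connected_matrixD[OF cn])
    fix i j :: nat assume i: "i \<in> {1, 2}" and "j \<in> {1..5} - {1, 2}"
    then have "j \<in> {3, 4, 5}" by auto
    then show "B i j = 0" using zero[OF i] spokes[OF i] by auto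
  qed auto
  moreover have "3 \<in> {1..5::nat}" by simp
  ultimately have "3 \<in> {1, 2::nat}" by blast
  then show False by simp
qed

lemma D4_rotate_admissible:
  assumes Q: "of_type 5 D4_edges Q"
    and inv: "G_invariant 5 (generate (sym_group 5) {cycle_of_list [3, 4, 5]}) Q"
  shows "G_admissible 5 (generate (sym_group 5) {cycle_of_list [3, 4, 5]}) Q"
proof -
  interpret affine_tree 5 "\<lambda>v. 1" D4_edges D4_delta by (rule affine_tree_D4)
  define g :: "nat \<Rightarrow> nat" where "g = cycle_of_list [3, 4, 5]"
  have g: "g 1 = 1" "g 2 = 2" "g 3 = 4" "g 4 = 5" "g 5 = 3" by (simp_all add: g_def transpose_def)
  have permutes: "g permutes {1..5}"
    unfolding g_def by (rule permutes_subset[OF cycle_permutes]) auto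
  have cube: "g (g (g x)) = x" for x by (simp add: g_def transpose_def)
  have rot: "adj Q (g i) (g j) = adj Q i j" if "i \<in> {1..5}" "j \<in> {1..5}" for i j
    by (rule G_invariant_generator[OF inv[folded g_def] _ that]) simp
  obtain C where C: "admissible_companion {1..5} (adj Q) C" and cn: "connected_matrix {1..5} (adj Q)"
    by (rule of_type_order_three_companion[OF Q permutes cube rot])
  have orbit: "adj Q 3 4 = adj Q 4 5" "adj Q 4 5 = adj Q 5 3" using rot[of 3 4] rot[of 4 5] by (simp_all add: g)
  have spokes: "adj Q f 3 = adj Q f 4 \<and> adj Q f 4 = adj Q f 5" if "f \<in> {1, 2}" for f
    using that rot[of f 3] rot[of f 4] g by auto
  have "adj Q 3 4 = 0" by (rule D4_rotation_no_triangle[OF C cn orbit spokes])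
  then have zero: "adj Q i j = 0" if "i \<in> {3, 4, 5}" "j \<in> {3, 4, 5}" for i j
    using that orbit adj_skew[of Q 4 3] adj_skew[of Q 5 4] adj_skew[of Q 3 5] by auto
  have vertices: "{1..5} = {1, 2} \<union> {3, 4, 5::nat}" by auto
  have "foldable {1..5} (adj Q) i (g i)" if i: "i \<in> {1..5}" for i
  proof (cases "i \<in> {1, 2}")
    case True
    then have "g i = i" using g by auto
    then show ?thesis by (simp only: foldable_refl)
  next
    case False
    then have orbit: "i \<in> {3, 4, 5}" "g i \<in> {3, 4, 5}" using i g unfolding vertices by auto
    have "0 \<le> adj Q i j * adj Q (g i) j" if j: "j \<in> {1..5}" for j
    proof (cases "j \<in> {1, 2}")
      case True
      then have "g j = j" using g by auto
      then show ?thesis using rot[OF i j] by simp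
    next
      case False
      then show ?thesis using j zero[OF orbit(1)] unfolding vertices by simp
    qed
    then show ?thesis using zero[OF orbit] by (simp add: foldable_def)
  qed
  then show ?thesis
    using G_admissible_generated_order_three[OF permutes cube] inv unfolding g_def by blast
qed

subsection \<open>Forms with a symmetry of order three\<close>

lemma quadratic_form_reindex:
  assumes "bij_betw g I I" "\<And>i j. i \<in> I \<Longrightarrow> j \<in> I \<Longrightarrow> C (g i) (g j) = C i j"
  shows "quadratic_form I C (\<lambda>i. x (g i)) = quadratic_form I C x"
proof -
  have "quadratic_form I C x = (\<Sum>i\<in>I. \<Sum>j\<in>I. x (g i) * x (g j) * C (g i) (g j))"
    unfolding quadratic_form_def
    by (simp only: sum.reindex_bij_betw[OF assms(1), of "\<lambda>i. \<Sum>j\<in>I. x i * x j * C i j", symmetric]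
        sum.reindex_bij_betw[OF assms(1), of "\<lambda>j. x (g i) * x j * C (g i) j" for i, symmetric])
  then show ?thesis by (simp add: quadratic_form_def assms(2))
qed

lemma quadratic_form_rows: "quadratic_form I A x = (\<Sum>i\<in>I. x i * (\<Sum>j\<in>I. A i j * x j))"
  unfolding quadratic_form_def sum_distrib_left by (intro sum.cong refl) (simp only: mult_ac)

lemma cyclic_geometric_eq:
  fixes a b c :: int
  assumes "a * a = b * c" "b * b = c * a" "c * c = a * b"
  shows "a = b"
proof -
  have "(a - b) * (a - b) + (b - c) * (b - c) + (c - a) * (c - a)
      = 2 * (a * a - b * c) + 2 * (b * b - c * a) + 2 * (c * c - a * b)"
    by (simp add: algebra_simps)
  then have "(a - b) * (a - b) + (b - c) * (b - c) + (c - a) * (c - a) = 0" using assms by simp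
  then have "(a - b) * (a - b) = 0"
    using zero_le_square[of "a - b"] zero_le_square[of "b - c"] zero_le_square[of "c - a"] by linarith
  then show ?thesis by simp
qed

locale order_three_form =
  fixes I :: "'v set" and g :: "'v \<Rightarrow> 'v" and C :: "'v \<Rightarrow> 'v \<Rightarrow> int"
  assumes g_in: "i \<in> I \<Longrightarrow> g i \<in> I" and g_cube: "i \<in> I \<Longrightarrow> g (g (g i)) = i"
    and g_inv: "i \<in> I \<Longrightarrow> j \<in> I \<Longrightarrow> C (g i) (g j) = C i j"
    and corank_one: "semidefinite_corank_one I C"
begin

lemma bij_g: "bij_betw g I I"
  using g_in g_cube by (intro bij_betw_byWitness[where f' = "\<lambda>i. g (g i)"]) auto

lemma quadratic_form_nonneg: "0 \<le> quadratic_form I C x"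
  using corank_one by (simp add: semidefinite_corank_one_def)

text \<open>The symmetry acts on the kernel by a rational cube root of unity, hence trivially.\<close>

lemma invariant_null_vectorE:
  obtains \<xi> where "\<exists>i\<in>I. \<xi> i \<noteq> 0" "\<And>i. i \<in> I \<Longrightarrow> (\<Sum>j\<in>I. C i j * \<xi> j) = 0" "\<And>i. i \<in> I \<Longrightarrow> \<xi> (g i) = \<xi> i"
    "\<And>x i j. quadratic_form I C x = 0 \<Longrightarrow> i \<in> I \<Longrightarrow> j \<in> I \<Longrightarrow> x i * \<xi> j = x j * \<xi> i"
proof -
  obtain \<xi> where nz: "\<exists>i\<in>I. \<xi> i \<noteq> 0" and null: "\<And>i. i \<in> I \<Longrightarrow> (\<Sum>j\<in>I. C i j * \<xi> j) = 0"
    and proportional: "\<And>x i j. quadratic_form I C x = 0 \<Longrightarrow> i \<in> I \<Longrightarrow> j \<in> I \<Longrightarrow> x i * \<xi> j = x j * \<xi> i"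
    using corank_one unfolding semidefinite_corank_one_def by blast
  have "quadratic_form I C \<xi> = 0" by (simp add: quadratic_form_rows null)
  then have "quadratic_form I C (\<lambda>i. \<xi> (g i)) = 0"
    by (simp only: quadratic_form_reindex[of g I C, OF bij_g g_inv])
  note rotated = proportional[OF this]
  have "\<xi> (g i) = \<xi> i" if i: "i \<in> I" for i
  proof (rule cyclic_geometric_eq)
    have gi: "g i \<in> I" "g (g i) \<in> I" using i g_in by blast+
    show "\<xi> (g i) * \<xi> (g i) = \<xi> i * \<xi> (g (g i))" using rotated[OF i gi(1)] by (simp only: mult.commute)
    show "\<xi> i * \<xi> i = \<xi> (g (g i)) * \<xi> (g i)"
      using rotated[OF gi(2) i] unfolding g_cube[OF i] by (simp only: mult.commute)
    show "\<xi> (g (g i)) * \<xi> (g (g i)) = \<xi> (g i) * \<xi> i"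
      using rotated[OF gi] unfolding g_cube[OF i] by (simp only: mult.commute)
  qed
  then show ?thesis using nz null proportional by (intro that)
qed

lemma quadratic_form_pos_of_orbit_sum_zero:
  assumes sum: "\<And>i. i \<in> I \<Longrightarrow> x i + x (g i) + x (g (g i)) = 0" and nz: "k \<in> I" "x k \<noteq> 0"
  shows "0 < quadratic_form I C x"
proof (rule ccontr)
  assume "\<not> ?thesis"
  then have null: "quadratic_form I C x = 0" using quadratic_form_nonneg[of x] by linarith
  show False
  proof (rule invariant_null_vectorE)
    fix \<xi> assume \<xi>: "\<exists>i\<in>I. \<xi> i \<noteq> 0" "\<And>i. i \<in> I \<Longrightarrow> \<xi> (g i) = \<xi> i"
      and "\<And>x i j. quadratic_form I C x = 0 \<Longrightarrow> i \<in> I \<Longrightarrow> j \<in> I \<Longrightarrow> x i * \<xi> j = x j * \<xi> i"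
    note proportional = this(3)[OF null _ nz(1)]
    obtain i where i: "i \<in> I" "\<xi> i \<noteq> 0" using \<xi>(1) by blast
    have gi: "g i \<in> I" "g (g i) \<in> I" using i g_in by blast+
    have "x i * \<xi> k = x k * \<xi> i" "x (g i) * \<xi> k = x k * \<xi> i" "x (g (g i)) * \<xi> k = x k * \<xi> i"
      using proportional[OF i(1)] proportional[OF gi(1)] proportional[OF gi(2)] \<xi>(2) gi i by simp_all
    then have "(x i + x (g i) + x (g (g i))) * \<xi> k = 3 * (x k * \<xi> i)" by (simp add: distrib_right)
    then show False using sum[OF i(1)] nz(2) i(2) by simp
  qed
qed

end

subsection \<open>The folded form of the three-armed star\<close>

lemma determinant_3_eq_0:
  fixes u v w :: int
  assumes rows: "a1 * u + b1 * v + c1 * w = 0" "a2 * u + b2 * v + c2 * w = 0" "a3 * u + b3 * v + c3 * w = 0"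
    and nz: "u \<noteq> 0 \<or> v \<noteq> 0 \<or> w \<noteq> 0"
  shows "a1 * (b2 * c3 - b3 * c2) - b1 * (a2 * c3 - a3 * c2) + c1 * (a2 * b3 - a3 * b2) = 0" (is "?D = 0")
proof -
  have "?D * u = (b2 * c3 - b3 * c2) * (a1 * u + b1 * v + c1 * w)
      - (b1 * c3 - b3 * c1) * (a2 * u + b2 * v + c2 * w) + (b1 * c2 - b2 * c1) * (a3 * u + b3 * v + c3 * w)"
    "?D * v = - (a2 * c3 - a3 * c2) * (a1 * u + b1 * v + c1 * w)
      + (a1 * c3 - a3 * c1) * (a2 * u + b2 * v + c2 * w) - (a1 * c2 - a2 * c1) * (a3 * u + b3 * v + c3 * w)"
    "?D * w = (a2 * b3 - a3 * b2) * (a1 * u + b1 * v + c1 * w)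
      - (a1 * b3 - a3 * b1) * (a2 * u + b2 * v + c2 * w) + (a1 * b2 - a2 * b1) * (a3 * u + b3 * v + c3 * w)"
    by algebra+
  then show ?thesis using nz unfolding rows by auto
qed

lemma square_ne_2: "y * y \<noteq> (2 :: int)"
proof
  assume y: "y * y = 2"
  have "\<bar>y\<bar> < 2"
  proof (rule ccontr)
    assume "\<not> ?thesis"
    then have "2 * 2 \<le> \<bar>y\<bar> * \<bar>y\<bar>" by (intro mult_mono) auto
    then show False using y by simp
  qed
  then have "y = 0 \<or> y = 1 \<or> y = - 1" by linarith
  then show False using y by auto
qed

lemma folded_orbit_weight_zero:
  fixes F1 F2 P1 P2 \<sigma> :: int
  assumes det: "2 * ((2 + 2 * P1) * (2 + 2 * P2) - \<sigma> * \<sigma>) - 3 * F1 * (F1 * (2 + 2 * P2) - F2 * \<sigma>)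
      + 3 * F2 * (F1 * \<sigma> - F2 * (2 + 2 * P1)) = 0"
    and P: "0 \<le> P1" "P1 \<le> 1" "0 \<le> P2" "0 < P1 \<Longrightarrow> F1 = 0" "0 < P2 \<Longrightarrow> F2 = 0"
    and F: "F1 \<noteq> 0 \<or> F2 \<noteq> 0" "P2 = 0 \<Longrightarrow> \<bar>F2\<bar> \<le> 1"
  shows "P1 = 0"
proof (rule ccontr)
  assume "P1 \<noteq> 0"
  then have P1: "P1 = 1" "F1 = 0" using P by auto
  then have F2: "F2 \<noteq> 0" "P2 = 0" using F(1) P(3,5) by fastforce+
  then have "F2 = 1 \<or> F2 = - 1" using F(2) by linarith
  then have "\<sigma> * \<sigma> = 2" using det P1 F2 by auto
  then show False using square_ne_2 by blast
qed

text \<open>The squared modulus of \<open>a + b \<omega> + c \<omega>\<^sup>2\<close> for a primitive third root of unity \<open>\<omega>\<close>.\<close>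

definition eisenstein_norm :: "int \<Rightarrow> int \<Rightarrow> int \<Rightarrow> int" where
  "eisenstein_norm a b c = a * a + b * b + c * c - a * b - b * c - a * c"

lemma eisenstein_norm_sum:
  "eisenstein_norm a b c = (a + b + c) * (a + b + c) - 3 * (a * b + b * c + a * c)"
  unfolding eisenstein_norm_def by algebra

lemma eisenstein_norm_nonneg: "0 \<le> eisenstein_norm a b c"
proof -
  have "2 * eisenstein_norm a b c = (a - b) * (a - b) + (b - c) * (b - c) + (a - c) * (a - c)"
    unfolding eisenstein_norm_def by algebra
  then show ?thesis
    using zero_le_square[of "a - b"] zero_le_square[of "b - c"] zero_le_square[of "a - c"] by linarith
qed

lemma one_le_square: "y \<noteq> 0 \<Longrightarrow> 1 \<le> y * (y :: int)"
  by (simp add: int_one_le_iff_zero_less zero_less_mult_iff) linarith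

lemma eisenstein_norm_sum_unit:
  assumes "eisenstein_norm a b c < 4" "(a + b + c) * (a + b + c) = 1"
  shows "a * b = 0 \<and> b * c = 0 \<and> a * c = 0"
proof -
  have "a * b + b * c + a * c = 0"
    using assms eisenstein_norm_sum[of a b c] eisenstein_norm_nonneg[of a b c] by presburger
  moreover have "(a + b + c) * (a + b + c) = a * a + b * b + c * c + 2 * (a * b + b * c + a * c)" by algebra
  ultimately have "a * a + b * b + c * c = 1" using assms(2) by simp
  then show ?thesis
    using one_le_square[of a] one_le_square[of b] one_le_square[of c]
    by (cases "a = 0"; cases "b = 0"; cases "c = 0") auto
qed

lemma eisenstein_norm_sum_two:
  assumes "eisenstein_norm a b c < 4" "a + b + c = 2"
  shows "0 \<le> a \<and> 0 \<le> b \<and> 0 \<le> c"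
proof -
  have "a * b + b * c + a * c = 1"
    using assms eisenstein_norm_sum[of a b c] eisenstein_norm_nonneg[of a b c] by simp
  moreover have "(a + b + c) * (a + b + c) = a * a + b * b + c * c + 2 * (a * b + b * c + a * c)" by algebra
  ultimately have squares: "a * a + b * b + c * c = 2" using assms(2) by simp
  have small: "y \<le> 1" if "y * y \<le> 2" for y :: int
  proof (rule ccontr)
    assume "\<not> y \<le> 1"
    then have "2 * 2 \<le> y * y" by (intro mult_mono) auto
    then show False using that by simp
  qed
  have "a * a \<le> 2" "b * b \<le> 2" "c * c \<le> 2"
    using squares zero_le_square[of a] zero_le_square[of b] zero_le_square[of c] by linarith+
  then have "a \<le> 1" "b \<le> 1" "c \<le> 1" using small by blast+
  then show ?thesis using assms(2) by linarith
qed

definition one_sided :: "int \<Rightarrow> int \<Rightarrow> int \<Rightarrow> int \<Rightarrow> bool" where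
  "one_sided \<epsilon> a b c \<longleftrightarrow> a * b = 0 \<and> b * c = 0 \<and> a * c = 0 \<or>
     \<epsilon> \<noteq> 0 \<and> 0 \<le> \<epsilon> * a \<and> 0 \<le> \<epsilon> * b \<and> 0 \<le> \<epsilon> * c"

lemma folded_arms_one_sided:
  fixes F1 F2 a b c :: int
  assumes det: "4 - (a + b + c) * (a + b + c) = 3 * (F1 * F1 + F2 * F2 - F1 * F2 * (a + b + c))"
    and F: "\<bar>F1\<bar> \<le> 1" "\<bar>F2\<bar> \<le> 1" "F1 \<noteq> 0 \<or> F2 \<noteq> 0" and norm: "eisenstein_norm a b c < 4"
  shows "one_sided (F1 * F2) a b c"
proof -
  let ?\<sigma> = "a + b + c"
  have F_cases: "F1 = 0 \<or> F1 = 1 \<or> F1 = - 1" "F2 = 0 \<or> F2 = 1 \<or> F2 = - 1" using F(1,2) by linarith+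
  show ?thesis
  proof (cases "F1 * F2 = 0")
    case True
    then have "F1 * F1 + F2 * F2 = 1" using F_cases F(3) by auto
    then have "?\<sigma> * ?\<sigma> = 1" using det True by simp
    then show ?thesis using eisenstein_norm_sum_unit[OF norm] by (simp add: one_sided_def)
  next
    case False
    define s where "s = F1 * F2 * ?\<sigma>"
    have unit: "F1 * F2 = 1 \<or> F1 * F2 = - 1" "F1 * F1 = 1" "F2 * F2 = 1" using F_cases False by auto
    have \<sigma>: "?\<sigma> = F1 * F2 * s" and s_square: "s * s = ?\<sigma> * ?\<sigma>" using unit(1) by (auto simp: s_def)
    have "4 - s * s = 3 * (2 - s)"
      using det unfolding s_square[symmetric] unit(2,3) s_def[symmetric] by simp
    then have "(s - 1) * (s - 2) = 0" by (simp add: algebra_simps)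
    then consider "s = 1" | "s = 2" by auto
    then show ?thesis
    proof cases
      case 1
      then show ?thesis using eisenstein_norm_sum_unit[OF norm] s_square False by (simp add: one_sided_def)
    next
      case 2
      have norm': "eisenstein_norm (- a) (- b) (- c) < 4" using norm by (simp add: eisenstein_norm_def)
      from unit(1) show ?thesis
      proof
        assume "F1 * F2 = 1"
        then show ?thesis using \<sigma> 2 eisenstein_norm_sum_two[OF norm] by (simp add: one_sided_def)
      next
        assume minus: "F1 * F2 = - 1"
        then have "- a + - b + - c = 2" using \<sigma> 2 by simp
        then show ?thesis using minus eisenstein_norm_sum_two[OF norm'] by (simp add: one_sided_def)
      qed
    qed
  qed
qed

subsection \<open>The rotation of the three-armed star\<close>

definition E6_rotation :: "nat \<Rightarrow> nat" where
  "E6_rotation = cycle_of_list [2, 4, 6] \<circ> cycle_of_list [3, 5, 7]"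

lemma E6_rotation_values: "E6_rotation 1 = 1" "E6_rotation 2 = 4" "E6_rotation 4 = 6" "E6_rotation 6 = 2"
  "E6_rotation 3 = 5" "E6_rotation 5 = 7" "E6_rotation 7 = 3"
  by (simp_all add: E6_rotation_def transpose_def)

lemma E6_rotation_permutes: "E6_rotation permutes {1..7}"
  unfolding E6_rotation_def
  by (intro permutes_compose; rule permutes_subset[OF cycle_permutes]) auto

lemma E6_rotation_cube: "E6_rotation (E6_rotation (E6_rotation x)) = x"
proof (cases "x \<in> {1..7}")
  case True
  then have "x \<in> {1, 2, 3, 4, 5, 6, 7}" by auto
  then show ?thesis by (elim insertE emptyE) (simp_all only: E6_rotation_values)
next
  case False
  then show ?thesis by (simp only: permutes_not_in[OF E6_rotation_permutes False])
qed

lemma E6_rotation_entries: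
  assumes "\<forall>i\<in>{1..7}. \<forall>j\<in>{1..7}. M (E6_rotation i) (E6_rotation j) = M i j"
  shows "M 1 4 = M 1 2" "M 1 6 = M 1 2" "M 1 5 = M 1 3" "M 1 7 = M 1 3" "M 4 6 = M 2 4" "M 6 2 = M 2 4"
    "M 5 7 = M 3 5" "M 7 3 = M 3 5" "M 4 5 = M 2 3" "M 6 7 = M 2 3" "M 4 7 = M 2 5" "M 6 3 = M 2 5"
    "M 4 3 = M 2 7" "M 6 5 = M 2 7"
proof -
  have inv: "M (E6_rotation i) (E6_rotation j) = M i j" if "1 \<le> i" "i \<le> 7" "1 \<le> j" "j \<le> 7" for i j
    using assms that by simp
  show "M 1 4 = M 1 2" "M 1 6 = M 1 2" "M 1 5 = M 1 3" "M 1 7 = M 1 3" "M 4 6 = M 2 4" "M 6 2 = M 2 4"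
    "M 5 7 = M 3 5" "M 7 3 = M 3 5" "M 4 5 = M 2 3" "M 6 7 = M 2 3" "M 4 7 = M 2 5" "M 6 3 = M 2 5"
    "M 4 3 = M 2 7" "M 6 5 = M 2 7"
    using inv[of 1 2] inv[of 1 4] inv[of 1 3] inv[of 1 5] inv[of 2 4] inv[of 4 6] inv[of 3 5] inv[of 5 7]
      inv[of 2 3] inv[of 4 5] inv[of 2 5] inv[of 4 7] inv[of 2 7] inv[of 4 3]
    by (simp_all add: E6_rotation_values del: One_nat_def)
qed

locale E6_form = order_three_form "{1..7}" E6_rotation C for C :: "nat \<Rightarrow> nat \<Rightarrow> int" +
  assumes diagonal: "i \<in> {1..7} \<Longrightarrow> C i i = 2"
    and symmetric: "i \<in> {1..7} \<Longrightarrow> j \<in> {1..7} \<Longrightarrow> C i j = C j i"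
begin

lemma rotation_invariant: "\<forall>i\<in>{1..7}. \<forall>j\<in>{1..7}. C (E6_rotation i) (E6_rotation j) = C i j"
  using g_inv by blast

lemmas entries = E6_rotation_entries[OF rotation_invariant]

lemma quadratic_form_insert:
  assumes "k \<notin> S" "insert k S \<subseteq> {1..7}"
  shows "quadratic_form (insert k S) C x
    = 2 * (x k * x k) + 2 * (x k * (\<Sum>j\<in>S. C k j * x j)) + quadratic_form S C x"
proof -
  have fin: "finite S" using assms(2) finite_subset by fastforce
  have "(\<Sum>i\<in>S. x i * x k * C i k) = x k * (\<Sum>j\<in>S. C k j * x j)"
    unfolding sum_distrib_left
  proof (rule sum.cong[OF refl])
    show "x i * x k * C i k = x k * (C k i * x i)" if "i \<in> S" for i
      using symmetric[of i k] that assms(2) by auto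
  qed
  moreover have "(\<Sum>j\<in>S. x k * x j * C k j) = x k * (\<Sum>j\<in>S. C k j * x j)"
    unfolding sum_distrib_left by (intro sum.cong refl) (simp only: mult_ac)
  ultimately show ?thesis
    using assms diagonal[of k] by (simp add: quadratic_form_def fin sum.distrib)
qed

lemma quadratic_form_eq:
  "quadratic_form {1..7} C x
    = 2 * (x 1 * x 1 + x 2 * x 2 + x 3 * x 3 + x 4 * x 4 + x 5 * x 5 + x 6 * x 6 + x 7 * x 7
    + C 1 2 * x 1 * (x 2 + x 4 + x 6) + C 1 3 * x 1 * (x 3 + x 5 + x 7)
    + C 2 4 * (x 2 * x 4 + x 4 * x 6 + x 6 * x 2) + C 3 5 * (x 3 * x 5 + x 5 * x 7 + x 7 * x 3)
    + C 2 3 * (x 2 * x 3 + x 4 * x 5 + x 6 * x 7) + C 2 5 * (x 2 * x 5 + x 4 * x 7 + x 6 * x 3)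
    + C 2 7 * (x 2 * x 7 + x 4 * x 3 + x 6 * x 5))"
proof -
  have vertices: "{1..7} = {1, 2, 4, 6, 3, 5, 7::nat}" by auto
  have "C 2 6 = C 2 4" "C 3 7 = C 3 5" using entries(6,8) symmetric[of 2 6] symmetric[of 3 7] by simp_all
  moreover have "quadratic_form {} C x = 0" by (simp add: quadratic_form_def)
  ultimately show ?thesis
    unfolding vertices by (simp add: quadratic_form_insert entries algebra_simps del: One_nat_def)
qed

lemma quadratic_form_pos:
  assumes sums: "x 1 = 0" "x 2 + x 4 + x 6 = 0" "x 3 + x 5 + x 7 = 0" and "x 2 \<noteq> 0 \<or> x 3 \<noteq> 0"
  shows "0 < quadratic_form {1..7} C x"
proof -
  obtain k where "k \<in> {2, 3}" "x k \<noteq> 0" using assms(4) by blast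
  moreover have "x i + x (E6_rotation i) + x (E6_rotation (E6_rotation i)) = 0" if "i \<in> {1..7}" for i
  proof -
    have "i \<in> {1, 2, 3, 4, 5, 6, 7}" using that by auto
    then show ?thesis by (elim insertE emptyE) (use sums in \<open>simp_all add: E6_rotation_values del: One_nat_def\<close>)
  qed
  ultimately show ?thesis by (intro quadratic_form_pos_of_orbit_sum_zero[of x k]) auto
qed

lemma orbit_weight_le_1: "C 2 4 \<le> 1" "C 3 5 \<le> 1"
proof -
  have "0 < quadratic_form {1..7} C ((\<lambda>_. 0)(2 := 1, 4 := - 1))"
    by (rule quadratic_form_pos) simp_all
  then show "C 2 4 \<le> 1" by (simp add: quadratic_form_eq del: One_nat_def)
  have "0 < quadratic_form {1..7} C ((\<lambda>_. 0)(3 := 1, 5 := - 1))"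
    by (rule quadratic_form_pos) simp_all
  then show "C 3 5 \<le> 1" by (simp add: quadratic_form_eq del: One_nat_def)
qed

lemma spoke_le_1: "C 2 4 = 0 \<Longrightarrow> \<bar>C 1 2\<bar> \<le> 1" "C 3 5 = 0 \<Longrightarrow> \<bar>C 1 3\<bar> \<le> 1"
proof -
  have "0 \<le> quadratic_form {1..7} C ((\<lambda>_. 0)(1 := 1, 2 := a, 4 := a, 6 := a, 3 := b, 5 := b, 7 := b))" for a b
    by (rule quadratic_form_nonneg)
  note this[of 1 0] this[of "- 1" 0] this[of 0 1] this[of 0 "- 1"]
  then show "C 2 4 = 0 \<Longrightarrow> \<bar>C 1 2\<bar> \<le> 1" "C 3 5 = 0 \<Longrightarrow> \<bar>C 1 3\<bar> \<le> 1"
    by (simp_all add: quadratic_form_eq del: One_nat_def)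
qed

lemma eisenstein_norm_arms: "eisenstein_norm (C 2 3) (C 2 5) (C 2 7) < (2 - C 2 4) * (2 - C 3 5)"
proof -
  define k where "k = 2 - C 3 5"
  have k: "0 < k" "C 3 5 = 2 - k" using orbit_weight_le_1(2) by (simp_all add: k_def)
  let ?x = "(\<lambda>_. 0)(2 := k, 4 := - k, 3 := C 2 7 - C 2 3, 5 := C 2 3 - C 2 5, 7 := C 2 5 - C 2 7)"
  have "0 < quadratic_form {1..7} C ?x"
    by (rule quadratic_form_pos) (use k(1) in simp_all)
  also have "quadratic_form {1..7} C ?x = 2 * k * (k * (2 - C 2 4) - eisenstein_norm (C 2 3) (C 2 5) (C 2 7))"
    unfolding quadratic_form_eq k(2) eisenstein_norm_def by (simp del: One_nat_def) algebra
  finally have "0 < k * (2 - C 2 4) - eisenstein_norm (C 2 3) (C 2 5) (C 2 7)"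
    using k(1) by (simp add: zero_less_mult_iff)
  then show ?thesis by (simp add: k_def mult.commute)
qed

lemma folded_determinant:
  defines "\<sigma> \<equiv> C 2 3 + C 2 5 + C 2 7"
  shows "2 * ((2 + 2 * C 2 4) * (2 + 2 * C 3 5) - \<sigma> * \<sigma>) - 3 * C 1 2 * (C 1 2 * (2 + 2 * C 3 5) - C 1 3 * \<sigma>)
    + 3 * C 1 3 * (C 1 2 * \<sigma> - C 1 3 * (2 + 2 * C 2 4)) = 0"
proof (rule invariant_null_vectorE)
  fix \<xi> assume nz: "\<exists>i\<in>{1..7}. \<xi> i \<noteq> 0" and null: "\<And>i. i \<in> {1..7} \<Longrightarrow> (\<Sum>j\<in>{1..7}. C i j * \<xi> j) = 0"
    and inv: "\<And>i. i \<in> {1..7} \<Longrightarrow> \<xi> (E6_rotation i) = \<xi> i"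
  have \<xi>: "\<xi> 4 = \<xi> 2" "\<xi> 6 = \<xi> 2" "\<xi> 5 = \<xi> 3" "\<xi> 7 = \<xi> 3"
    using inv[of 2] inv[of 4] inv[of 3] inv[of 5] by (simp_all add: E6_rotation_values)
  have vertices: "{1..7} = {1, 2, 3, 4, 5, 6, 7::nat}" by auto
  have rows: "C i 1 * \<xi> 1 + (C i 2 + C i 4 + C i 6) * \<xi> 2 + (C i 3 + C i 5 + C i 7) * \<xi> 3 = 0"
    if "i \<in> {1..7}" for i
    using null[OF that] unfolding vertices by (simp add: \<xi> algebra_simps del: One_nat_def)
  have lower: "C 2 1 = C 1 2" "C 3 1 = C 1 3" "C 2 6 = C 2 4" "C 3 7 = C 3 5" "C 3 2 = C 2 3"
    "C 3 4 = C 2 7" "C 3 6 = C 2 5"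
    using entries(6,8,12,13) symmetric[of 2 1] symmetric[of 3 1] symmetric[of 2 6] symmetric[of 3 7]
      symmetric[of 3 2] symmetric[of 3 4] symmetric[of 3 6] by simp_all
  have "2 * \<xi> 1 + 3 * C 1 2 * \<xi> 2 + 3 * C 1 3 * \<xi> 3 = 0"
    using rows[of 1] diagonal[of 1] by (simp add: entries del: One_nat_def)
  moreover have "C 1 2 * \<xi> 1 + (2 + 2 * C 2 4) * \<xi> 2 + \<sigma> * \<xi> 3 = 0"
    using rows[of 2] diagonal[of 2] by (simp add: lower \<sigma>_def add.assoc del: One_nat_def)
  moreover have "C 1 3 * \<xi> 1 + \<sigma> * \<xi> 2 + (2 + 2 * C 3 5) * \<xi> 3 = 0"
    using rows[of 3] diagonal[of 3] by (simp add: lower \<sigma>_def algebra_simps del: One_nat_def)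
  moreover have "\<xi> 1 \<noteq> 0 \<or> \<xi> 2 \<noteq> 0 \<or> \<xi> 3 \<noteq> 0"
    using nz \<xi> unfolding vertices by (auto simp del: One_nat_def)
  ultimately show ?thesis by (rule determinant_3_eq_0)
qed

lemma orbit_weights_zero:
  assumes orbits: "C 2 4 \<noteq> 0 \<Longrightarrow> 0 < C 2 4 \<and> C 1 2 = 0" "C 3 5 \<noteq> 0 \<Longrightarrow> 0 < C 3 5 \<and> C 1 3 = 0"
    and hub: "C 1 2 \<noteq> 0 \<or> C 1 3 \<noteq> 0"
  shows "C 2 4 = 0" "C 3 5 = 0"
proof -
  have nonneg: "0 \<le> C 2 4" "0 \<le> C 3 5" using orbits by linarith+
  show "C 2 4 = 0"
    using folded_determinant nonneg(1) orbit_weight_le_1(1) nonneg(2) _ _ hub spoke_le_1(2)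
    by (rule folded_orbit_weight_zero) (use orbits in auto)
  have "2 * ((2 + 2 * C 3 5) * (2 + 2 * C 2 4) - (C 2 3 + C 2 5 + C 2 7) * (C 2 3 + C 2 5 + C 2 7))
      - 3 * C 1 3 * (C 1 3 * (2 + 2 * C 2 4) - C 1 2 * (C 2 3 + C 2 5 + C 2 7))
      + 3 * C 1 2 * (C 1 3 * (C 2 3 + C 2 5 + C 2 7) - C 1 2 * (2 + 2 * C 3 5)) = 0"
    using folded_determinant by algebra
  then show "C 3 5 = 0"
    using nonneg(2) orbit_weight_le_1(2) nonneg(1) _ _ disj_commute[THEN iffD1, OF hub] spoke_le_1(1)
    by (rule folded_orbit_weight_zero) (use orbits in auto)
qed

lemma arms_one_sided:
  assumes orbits: "C 2 4 = 0" "C 3 5 = 0" and hub: "C 1 2 \<noteq> 0 \<or> C 1 3 \<noteq> 0"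
  shows "one_sided (C 1 2 * C 1 3) (C 2 3) (C 2 5) (C 2 7)"
proof (rule folded_arms_one_sided[OF _ spoke_le_1(1)[OF orbits(1)] spoke_le_1(2)[OF orbits(2)] hub])
  show "eisenstein_norm (C 2 3) (C 2 5) (C 2 7) < 4" using eisenstein_norm_arms orbits by simp
  show "4 - (C 2 3 + C 2 5 + C 2 7) * (C 2 3 + C 2 5 + C 2 7)
      = 3 * (C 1 2 * C 1 2 + C 1 3 * C 1 3 - C 1 2 * C 1 3 * (C 2 3 + C 2 5 + C 2 7))"
    using folded_determinant unfolding orbits by (simp add: algebra_simps)
qed

end

locale E6_rotation_companion =
  fixes B C :: "nat \<Rightarrow> nat \<Rightarrow> int"
  assumes companion: "admissible_companion {1..7} B C" and corank: "semidefinite_corank_one {1..7} C"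
    and connected: "connected_matrix {1..7} B"
    and B_invariant: "\<forall>i\<in>{1..7}. \<forall>j\<in>{1..7}. B (E6_rotation i) (E6_rotation j) = B i j"
    and C_invariant: "\<forall>i\<in>{1..7}. \<forall>j\<in>{1..7}. C (E6_rotation i) (E6_rotation j) = C i j"
begin

lemmas companionD = quasi_cartan_companionD[OF admissible_companionD(1)[OF companion]]
  and B_entries = E6_rotation_entries[OF B_invariant]

sublocale E6_form C
proof
  show "E6_rotation i \<in> {1..7}" if "i \<in> {1..7}" for i
    using that by (simp only: permutes_in_image[OF E6_rotation_permutes])
qed (use E6_rotation_cube C_invariant corank companionD(2,4) in auto)

lemma C_eq_0_iff: "i \<in> {1..7} \<Longrightarrow> j \<in> {1..7} \<Longrightarrow> i \<noteq> j \<Longrightarrow> C i j = 0 \<longleftrightarrow> B i j = 0"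
  by (rule companionD(6))

lemma orbit_triangle:
  assumes xyz: "{x, y, z} \<subseteq> {1..7}" "x \<noteq> y" and C: "C x y = a" "C y z = a" "C z x = a"
    and B: "B x y = B y z" "B y z = B z x" "B 1 x = B 1 y" "B 1 y = B 1 z" and nz: "B x y \<noteq> 0"
  shows "0 < a \<and> B 1 x = 0"
proof
  have "0 < C x y * C y z * C z x" using xyz(1) B(1,2) nz by (intro orbit_triangle_sign[OF companion]) auto
  then have "0 < a * a * a" by (simp only: C)
  then show "0 < a" by (simp add: zero_less_mult_iff)
  show "B 1 x = 0" using xyz(1) B nz by (intro fixed_vertex_orbit_triangle[OF companion, of 1 x y z]) auto
qed

lemma hub_connected: "C 1 2 \<noteq> 0 \<or> C 1 3 \<noteq> 0"
proof (rule ccontr)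
  assume "\<not> ?thesis"
  then have "B 1 2 = 0" "B 1 3 = 0" using C_eq_0_iff[of 1 2] C_eq_0_iff[of 1 3] by simp_all
  then have hub: "B 1 j = 0" if "j \<in> {2, 3, 4, 5, 6, 7}" for j
    using that B_entries(1-4) by (elim insertE emptyE) (simp_all only:)
  have "{1} = {1..7::nat}"
  proof (rule connected_matrixD[OF connected])
    fix i j :: nat assume "i \<in> {1}" "j \<in> {1..7} - {1}"
    then have "i = 1" "j \<in> {2, 3, 4, 5, 6, 7}" by auto
    then show "B i j = 0" using hub by blast
  qed auto
  moreover have "2 \<in> {1..7::nat}" by simp
  ultimately have "2 \<in> {1::nat}" by blast
  then show False by simp
qed

lemma orbits_totally_disconnected: "C 2 4 = 0" "C 3 5 = 0" "B 2 4 = 0" "B 3 5 = 0"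
proof -
  have "0 < C 2 4 \<and> C 1 2 = 0" if "C 2 4 \<noteq> 0"
    using orbit_triangle[of 2 4 6 "C 2 4"] C_eq_0_iff[of 2 4] C_eq_0_iff[of 1 2] that entries B_entries by simp
  moreover have "0 < C 3 5 \<and> C 1 3 = 0" if "C 3 5 \<noteq> 0"
    using orbit_triangle[of 3 5 7 "C 3 5"] C_eq_0_iff[of 3 5] C_eq_0_iff[of 1 3] that entries B_entries by simp
  ultimately show "C 2 4 = 0" "C 3 5 = 0" using orbit_weights_zero hub_connected by blast+
  then show "B 2 4 = 0" "B 3 5 = 0" using C_eq_0_iff[of 2 4] C_eq_0_iff[of 3 5] by simp_all
qed

lemma arm_opposite_hub:
  assumes y: "y \<in> {3, 5, 7}" and pos: "0 < C 1 2 * C 1 3 * C 2 y"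
  shows "B 2 1 * B 2 y < 0"
proof (rule ccontr)
  assume nonneg: "\<not> ?thesis"
  have yI: "y \<in> {1..7}" "2 \<noteq> y" "1 \<noteq> y" using y by auto
  have C: "C 2 1 = C 1 2" "C 1 y = C 1 3" using y entries(3,4) symmetric[of 2 1] by auto
  then have "B 2 1 \<noteq> 0" "B 2 y \<noteq> 0" "B 1 y \<noteq> 0"
    using pos C_eq_0_iff[of 2 1] C_eq_0_iff[of 2 y] C_eq_0_iff[of 1 y] yI by auto
  moreover from this have "0 < B 2 1 * B 2 y" using nonneg by (simp add: not_less order_less_le)
  ultimately have "C 2 1 * C 2 y * C 1 y < 0" by (intro companion_triangle_apex[OF companion]) (use yI in auto)
  then show False using pos unfolding C by (simp add: mult_ac)
qed

lemma arms_same_direction: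
  assumes xy: "x \<in> {3, 5, 7}" "y \<in> {3, 5, 7}"
  shows "0 \<le> B 2 x * B 2 y"
proof (cases "x = y \<or> B 2 x = 0 \<or> B 2 y = 0")
  case False
  have I: "x \<in> {1..7}" "y \<in> {1..7}" "2 \<noteq> x" "2 \<noteq> y" using xy by auto
  have nz: "C 2 x \<noteq> 0" "C 2 y \<noteq> 0" using False C_eq_0_iff[of 2 x] C_eq_0_iff[of 2 y] I by auto
  let ?\<epsilon> = "C 1 2 * C 1 3"
  have "C 2 3 * C 2 5 \<noteq> 0 \<or> C 2 5 * C 2 7 \<noteq> 0 \<or> C 2 3 * C 2 7 \<noteq> 0" using False nz xy by auto
  then have "?\<epsilon> \<noteq> 0 \<and> 0 \<le> ?\<epsilon> * C 2 3 \<and> 0 \<le> ?\<epsilon> * C 2 5 \<and> 0 \<le> ?\<epsilon> * C 2 7"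
    using arms_one_sided[OF orbits_totally_disconnected(1,2) hub_connected] unfolding one_sided_def by blast
  moreover from this have "0 < ?\<epsilon> * C 2 x" "0 < ?\<epsilon> * C 2 y"
    using nz xy by (auto simp: order_less_le)
  ultimately have "B 2 1 * B 2 x < 0" "B 2 1 * B 2 y < 0" using arm_opposite_hub xy by blast+
  then show ?thesis by (auto simp: mult_less_0_iff zero_le_mult_iff)
qed auto

lemma same_orbit_entry_zero:
  assumes "i \<in> {2, 4, 6} \<and> j \<in> {2, 4, 6} \<or> i \<in> {3, 5, 7} \<and> j \<in> {3, 5, 7}"
  shows "B i j = 0"
proof -
  have self: "B j j = 0" if "j \<in> {1..7}" for j using companionD(5)[OF that that] .
  have "B 4 2 = - B 2 4" "B 6 4 = - B 4 6" "B 2 6 = - B 6 2" "B 5 3 = - B 3 5" "B 7 5 = - B 5 7"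
    "B 3 7 = - B 7 3"
    by (rule companionD(1); simp)+
  then show ?thesis using assms orbits_totally_disconnected(3,4) B_entries(5-8) self by auto
qed

lemma different_orbits_same_sign:
  assumes "i \<in> {2, 4, 6}" "j \<in> {3, 5, 7}" "i' \<in> {2, 4, 6}" "j' \<in> {3, 5, 7}"
  shows "0 \<le> B i j * B i' j'" "0 \<le> B j i * B j' i'"
proof -
  have arms: "\<exists>y\<in>{3, 5, 7}. B i j = B 2 y" if "i \<in> {2, 4, 6}" "j \<in> {3, 5, 7}" for i j
    using that B_entries(9-14) by auto
  show "0 \<le> B i j * B i' j'"
    using arms[OF assms(1,2)] arms[OF assms(3,4)] arms_same_direction by metis
  moreover have "B j i = - B i j" "B j' i' = - B i' j'" using assms by (intro companionD(1); auto)+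
  ultimately show "0 \<le> B j i * B j' i'" by simp
qed

lemma foldable_rotation:
  assumes i: "i \<in> {1..7}"
  shows "foldable {1..7} B i (E6_rotation i)"
proof -
  let ?P = "{2, 4, 6} :: nat set" and ?R = "{3, 5, 7} :: nat set"
  have vertices: "k = 1 \<or> k \<in> ?P \<or> k \<in> ?R" if "k \<in> {1..7}" for k using that by auto
  have hub: "B (E6_rotation i) 1 = B i 1" using B_invariant i E6_rotation_values(1) by force
  consider "i = 1" | "i \<in> ?P" "E6_rotation i \<in> ?P" | "i \<in> ?R" "E6_rotation i \<in> ?R"
    using vertices[OF i] E6_rotation_values by (elim disjE insertE emptyE) simp_all
  then show ?thesis
  proof cases
    case 1
    then show ?thesis using companionD(5)[OF i i] E6_rotation_values(1) by (simp add: foldable_def)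
  next
    case 2
    have "0 \<le> B i j * B (E6_rotation i) j" if j: "j \<in> {1..7}" for j
      using vertices[OF j] hub same_orbit_entry_zero[of i j] different_orbits_same_sign(1)[OF 2(1) _ 2(2)] 2
      by (elim disjE) simp_all
    then show ?thesis using same_orbit_entry_zero 2 by (simp add: foldable_def)
  next
    case 3
    have "0 \<le> B i j * B (E6_rotation i) j" if j: "j \<in> {1..7}" for j
      using vertices[OF j] hub same_orbit_entry_zero[of i j] different_orbits_same_sign(2)[OF _ 3(1) _ 3(2)] 3
      by (elim disjE) simp_all
    then show ?thesis using same_orbit_entry_zero 3 by (simp add: foldable_def)
  qed
qed

end

lemma E6_rotate_admissible:
  assumes Q: "of_type 7 E6_edges Q"
    and inv: "G_invariant 7 (generate (sym_group 7) {cycle_of_list [2, 4, 6] \<circ> cycle_of_list [3, 5, 7]}) Q"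
  shows "G_admissible 7 (generate (sym_group 7) {cycle_of_list [2, 4, 6] \<circ> cycle_of_list [3, 5, 7]}) Q"
proof -
  interpret affine_tree 7 E6_parent E6_edges E6_delta by (rule affine_tree_E6)
  note inv = inv[folded E6_rotation_def]
  have rot: "adj Q (E6_rotation i) (E6_rotation j) = adj Q i j" if "i \<in> {1..7}" "j \<in> {1..7}" for i j
    by (rule G_invariant_generator[OF inv _ that]) simp
  have "G_admissible 7 (generate (sym_group 7) {E6_rotation}) Q"
    using E6_rotation_permutes E6_rotation_cube inv
  proof (rule G_admissible_generated_order_three)
    fix i :: nat assume i: "i \<in> {1..7}"
    show "foldable {1..7} (adj Q) i (E6_rotation i)"
    proof (rule of_type_order_three_companion[OF Q E6_rotation_permutes E6_rotation_cube])
      fix C assume "admissible_companion {1..7} (adj Q) C" "semidefinite_corank_one {1..7} C"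
        "\<And>i j. i \<in> {1..7} \<Longrightarrow> j \<in> {1..7} \<Longrightarrow> C (E6_rotation i) (E6_rotation j) = C i j"
        "connected_matrix {1..7} (adj Q)"
      then interpret E6_rotation_companion "adj Q" C by unfold_locales (use rot in auto)
      show ?thesis by (rule foldable_rotation[OF i])
    qed (rule rot)
  qed
  then show ?thesis by (simp only: E6_rotation_def)
qed

lemma invariant_imp_admissible:
  assumes "folding_pair N of_type_X G" "of_type_X Q" "G_invariant N G Q"
  shows "G_admissible N G Q"
  using assms
  by (induction rule: folding_pair.induct)
     (rule A2_rotate_admissible A_reflect_admissible D4_klein_admissible D4_rotate_admissible
        D_swap_ends_admissible D_swap_end_admissible D_reflect_admissible D_reflect_swap_admissible
        E6_rotate_admissible E6_swap_admissible E7_swap_admissible; assumption)+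

theorem theorem3p7:
  fixes N :: nat and of_type_X :: "quiver \<Rightarrow> bool" and G :: "(nat \<Rightarrow> nat) set" and Q :: quiver
  assumes "folding_pair N of_type_X G"
    and "quiver N Q"
    and "of_type_X Q"
  shows "(G_invariant N G Q \<longrightarrow> G_admissible N G Q) \<and>
         (G_invariant N G Q \<longleftrightarrow> G_admissible N G Q)"
proof -
  have "G_admissible N G Q" if "G_invariant N G Q"
    using assms(1,3) that by (rule invariant_imp_admissible)
  moreover have "G_invariant N G Q" if "G_admissible N G Q"
    using that by (simp add: G_admissible_def)
  ultimately show ?thesis by (intro conjI impI iffI)
qed

end
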